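(* Let $\pi\colon P\to M$ be a circle bundle with circle metric $g$ over a connected oriented surface $M$, let $K\colon M\to\mathbb{R}$ be the Gaussian curvature of the induced metric $h$ on $M$, and let $H\colon M\to\mathbb{R}$ be the curvature function of the horizontal distribution. Then $g$ is conformally flat if and only if $$\mathrm{Hess}\,H=\nabla\,\mathrm{grad}\,H=H(H^2-K)\,\mathrm{Id}$$ and $$2K-3H^2=\alpha$$ are satisfied on $M$ for some constant $\alpha\in\mathbb{R}$.
   Context: All manifolds, maps and metrics are smooth. A circle bundle with circle metric is a Riemannian $3$-manifold $(P,g)$ together with a submersion $\pi\colon P\to M$ onto an oriented surface $M$ which is a principal bundle $S^1\to P\to M$ such that $S^1$ acts by isometries and such that the vector field $T$ generating the action ($T_x=\frac{d}{d\varphi}|_{\varphi=0}\,x\cdot e^{i\varphi}$) has constant length $1$ (so all fibers are minimal, i.e. geodesic, of length $2\pi$). $M$ carries the unique Riemannian metric $h$ for which $\pi$ is a Riemannian submersion, and $\mathrm{vol}_M$ is its area form. The horizontal distribution $\mathcal{H}=(\ker d\pi)^\perp$ is a principal connection with connection form $i\,g(T,\cdot)$. Its curvature form $\Omega=d(i\,g(T,\cdot))$ can be written $\Omega=iH\,\pi^*\mathrm{vol}_M$ with a real function $H$ constant along the fibers; the function it induces on $M$ is also denoted $H$ and called the curvature function of the horizontal distribution. On $(M,h)$, $\mathrm{grad}$ and $\nabla$ are the gradient and Levi-Civita connection, and $\mathrm{Hess}\,H=\nabla\,\mathrm{grad}\,H$ is viewed as an endomorphism field of $TM$. A Riemannian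 manifold $(P,g)$ is conformally flat if around each point there is a locally defined function $\lambda$ such that $e^{2\lambda}g$ is flat. *)

theory Defs
  imports "HOL-Analysis.Analysis"
begin

section \<open>Smooth maps between open subsets of Euclidean spaces\<close>

text \<open>\<open>Ck_on k S f\<close>: \<open>f\<close> is of class \<open>C\<^sup>k\<close> on the open set \<open>S\<close>; for a finite-dimensional domain this
  is equivalent to all iterated directional derivatives of order at most \<open>k\<close> being continuous.\<close>

primrec Ck_on :: "nat \<Rightarrow> 'a::euclidean_space set \<Rightarrow> ('a \<Rightarrow> 'b::real_normed_vector) \<Rightarrow> bool" where
  "Ck_on 0 S f \<longleftrightarrow> continuous_on S f"
| "Ck_on (Suc k) S f \<longleftrightarrow>
     (\<forall>x\<in>S. f differentiable (at x)) \<and> (\<forall>v. Ck_on k S (\<lambda>x. frechet_derivative f (at x) v))"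

definition smooth_on :: "'a::euclidean_space set \<Rightarrow> ('a \<Rightarrow> 'b::real_normed_vector) \<Rightarrow> bool" where
  "smooth_on S f \<longleftrightarrow> open S \<and> (\<forall>k. Ck_on k S f)"


section \<open>Smooth manifolds\<close>

text \<open>A chart is a domain together with a coordinate map into the model space \<open>'e\<close>. A manifold is
  a topological space with an atlas; the atlas need not be maximal.\<close>

type_synonym ('a, 'e) chart = "'a set \<times> ('a \<Rightarrow> 'e)"

record ('a, 'e) manifold =
  man_top :: "'a topology"
  man_atlas :: "('a, 'e) chart set"

definition chart_inv :: "('a, 'e) chart \<Rightarrow> 'e \<Rightarrow> 'a" where
  "chart_inv c = inv_into (fst c) (snd c)"

abbreviation points :: "('a, 'e) manifold \<Rightarrow> 'a set" where
  "points M \<equiv> topspace (man_top M)"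

abbreviation charts_at :: "('a, 'e) manifold \<Rightarrow> 'a \<Rightarrow> ('a, 'e) chart set" where
  "charts_at M p \<equiv> {c \<in> man_atlas M. p \<in> fst c}"

definition smooth_manifold :: "('a, 'e::euclidean_space) manifold \<Rightarrow> bool" where
  "smooth_manifold M \<longleftrightarrow>
     Hausdorff_space (man_top M) \<and> second_countable (man_top M) \<and>
     (\<Union>c\<in>man_atlas M. fst c) = points M \<and>
     (\<forall>c\<in>man_atlas M. openin (man_top M) (fst c) \<and> open (snd c ` fst c) \<and>
        homeomorphic_map (subtopology (man_top M) (fst c)) (top_of_set (snd c ` fst c)) (snd c)) \<and>
     (\<forall>c\<in>man_atlas M. \<forall>d\<in>man_atlas M.
        smooth_on (snd c ` (fst c \<inter> fst d)) (snd d \<circ> chart_inv c))"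

definition smooth_map ::
  "('a, 'e::euclidean_space) manifold \<Rightarrow> ('b, 'f::euclidean_space) manifold \<Rightarrow> ('a \<Rightarrow> 'b) \<Rightarrow> bool" where
  "smooth_map M N f \<longleftrightarrow> continuous_map (man_top M) (man_top N) f \<and>
     (\<forall>c\<in>man_atlas M. \<forall>d\<in>man_atlas N.
        smooth_on (snd c ` (fst c \<inter> f -` fst d)) (snd d \<circ> f \<circ> chart_inv c))"

definition diffeomorphism ::
  "('a, 'e::euclidean_space) manifold \<Rightarrow> ('b, 'f::euclidean_space) manifold \<Rightarrow> ('a \<Rightarrow> 'b) \<Rightarrow> bool" where
  "diffeomorphism M N f \<longleftrightarrow> smooth_map M N f \<and>
     (\<exists>g. smooth_map N M g \<and> (\<forall>p\<in>points M. g (f p) = p) \<and> (\<forall>q\<in>points N. f (g q) = q))"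

definition restrict_manifold :: "('a, 'e) manifold \<Rightarrow> 'a set \<Rightarrow> ('a, 'e) manifold" where
  "restrict_manifold M U =
     \<lparr>man_top = subtopology (man_top M) U, man_atlas = (\<lambda>c. (fst c \<inter> U, snd c)) ` man_atlas M\<rparr>"

definition prod_manifold ::
  "('a, 'e) manifold \<Rightarrow> ('b, 'f) manifold \<Rightarrow> ('a \<times> 'b, 'e \<times> 'f) manifold" where
  "prod_manifold M N =
     \<lparr>man_top = prod_topology (man_top M) (man_top N),
      man_atlas = (\<lambda>(c, d). (fst c \<times> fst d, map_prod (snd c) (snd d))) ` (man_atlas M \<times> man_atlas N)\<rparr>"

definition real_manifold :: "(real, real) manifold" where
  "real_manifold = \<lparr>man_top = euclidean, man_atlas = {(UNIV, id)}\<rparr>"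

definition circle_manifold :: "(complex, real) manifold" where
  "circle_manifold =
     \<lparr>man_top = top_of_set (sphere 0 1),
      man_atlas = {(sphere 0 1 - {- z}, \<lambda>w. Arg (w / z)) | z. z \<in> sphere 0 1}\<rparr>"

text \<open>Tangent vectors at \<open>p\<close> are represented by their components in a chart at \<open>p\<close>. Then
  \<open>dchart c F p v\<close> is the derivative at \<open>p\<close> of a function \<open>F\<close> on the manifold with values in a
  normed space, in the direction with components \<open>v\<close> in the chart \<open>c\<close>. In particular
  \<open>dchart c (snd d) p v\<close> are the components in the chart \<open>d\<close> of the same tangent vector.\<close>

definition dchart ::
  "('a, 'e::euclidean_space) chart \<Rightarrow> ('a \<Rightarrow> 'b::real_normed_vector) \<Rightarrow> 'a \<Rightarrow> 'e \<Rightarrow> 'b" where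
  "dchart c F p v = frechet_derivative (F \<circ> chart_inv c) (at (snd c p)) v"

definition tangent_map ::
  "('a, 'e::euclidean_space) chart \<Rightarrow> ('b, 'f::euclidean_space) chart \<Rightarrow> ('a \<Rightarrow> 'b) \<Rightarrow> 'a \<Rightarrow> 'e \<Rightarrow> 'f" where
  "tangent_map c d f p v = dchart c (snd d \<circ> f) p v"

text \<open>An orientation is given by an atlas with orientation-preserving coordinate changes.\<close>

definition oriented_surface :: "('a, real^2) manifold \<Rightarrow> bool" where
  "oriented_surface M \<longleftrightarrow> smooth_manifold M \<and>
     (\<forall>p\<in>points M. \<forall>c\<in>charts_at M p. \<forall>d\<in>charts_at M p. det (matrix (dchart c (snd d) p)) > 0)"

definition submersion ::
  "('a, 'e::euclidean_space) manifold \<Rightarrow> ('b, 'f::euclidean_space) manifold \<Rightarrow> ('a \<Rightarrow> 'b) \<Rightarrow> bool" where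
  "submersion M N f \<longleftrightarrow> smooth_map M N f \<and>
     (\<forall>p\<in>points M. \<forall>c\<in>charts_at M p. \<forall>d\<in>charts_at N (f p). surj (tangent_map c d f p))"


section \<open>Riemannian metrics, Levi-Civita connection and curvature\<close>

text \<open>A covariant 2-tensor is given by its components in every chart: \<open>g c p u v\<close> is the value at
  \<open>p\<close> on the tangent vectors with components \<open>u\<close>, \<open>v\<close> in \<open>c\<close>. The last clause of
  \<open>riemannian_metric\<close> is the transformation law.\<close>

type_synonym ('a, 'e) tensor2 = "('a, 'e) chart \<Rightarrow> 'a \<Rightarrow> 'e \<Rightarrow> 'e \<Rightarrow> real"

definition riemannian_metric ::
  "('a, 'e::euclidean_space) manifold \<Rightarrow> ('a, 'e) tensor2 \<Rightarrow> bool" where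
  "riemannian_metric M g \<longleftrightarrow>
     (\<forall>c\<in>man_atlas M. \<forall>p\<in>fst c. bilinear (g c p) \<and>
        (\<forall>u v. g c p u v = g c p v u) \<and> (\<forall>u. u \<noteq> 0 \<longrightarrow> g c p u u > 0)) \<and>
     (\<forall>c\<in>man_atlas M. \<forall>u v. smooth_on (snd c ` fst c) ((\<lambda>p. g c p u v) \<circ> chart_inv c)) \<and>
     (\<forall>p\<in>points M. \<forall>c\<in>charts_at M p. \<forall>d\<in>charts_at M p. \<forall>u v.
        g c p u v = g d p (dchart c (snd d) p u) (dchart c (snd d) p v))"

text \<open>\<open>christoffel c g p u v\<close> is the covariant derivative at \<open>p\<close>, in direction \<open>u\<close>, of the vector
  field with constant components \<open>v\<close> in \<open>c\<close>, as determined by the Koszul formula for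
  coordinate fields. \<open>nabla c g p u X\<close> is the covariant derivative at \<open>p\<close> in direction \<open>u\<close> of the
  vector field with components \<open>X\<close>.\<close>

definition christoffel ::
  "('a, 'e::euclidean_space) chart \<Rightarrow> ('a, 'e) tensor2 \<Rightarrow> 'a \<Rightarrow> 'e \<Rightarrow> 'e \<Rightarrow> 'e" where
  "christoffel c g p u v =
     (THE w. \<forall>z. 2 * g c p w z =
        dchart c (\<lambda>q. g c q v z) p u + dchart c (\<lambda>q. g c q u z) p v - dchart c (\<lambda>q. g c q u v) p z)"

definition nabla ::
  "('a, 'e::euclidean_space) chart \<Rightarrow> ('a, 'e) tensor2 \<Rightarrow> 'a \<Rightarrow> 'e \<Rightarrow> ('a \<Rightarrow> 'e) \<Rightarrow> 'e" where
  "nabla c g p u X = dchart c X p u + christoffel c g p u (X p)"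

definition gradient ::
  "('a, 'e::euclidean_space) chart \<Rightarrow> ('a, 'e) tensor2 \<Rightarrow> ('a \<Rightarrow> real) \<Rightarrow> 'a \<Rightarrow> 'e" where
  "gradient c g f p = (THE w. \<forall>v. g c p w v = dchart c f p v)"

definition hessian ::
  "('a, 'e::euclidean_space) chart \<Rightarrow> ('a, 'e) tensor2 \<Rightarrow> ('a \<Rightarrow> real) \<Rightarrow> 'a \<Rightarrow> 'e \<Rightarrow> 'e" where
  "hessian c g f p u = nabla c g p u (gradient c g f)"

text \<open>\<open>R(u,v)w = \<nabla>\<^sub>u\<nabla>\<^sub>v w - \<nabla>\<^sub>v\<nabla>\<^sub>u w\<close> for vector fields with constant components in \<open>c\<close>, whose Lie
  bracket vanishes.\<close>

definition riemann ::
  "('a, 'e::euclidean_space) chart \<Rightarrow> ('a, 'e) tensor2 \<Rightarrow> 'a \<Rightarrow> 'e \<Rightarrow> 'e \<Rightarrow> 'e \<Rightarrow> 'e" where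
  "riemann c g p u v w =
     nabla c g p u (\<lambda>q. nabla c g q v (\<lambda>_. w)) - nabla c g p v (\<lambda>q. nabla c g q u (\<lambda>_. w))"

definition gaussian_curvature ::
  "('a, real^2) manifold \<Rightarrow> ('a, real^2) tensor2 \<Rightarrow> ('a \<Rightarrow> real) \<Rightarrow> bool" where
  "gaussian_curvature M h K \<longleftrightarrow>
     (\<forall>p\<in>points M. \<forall>c\<in>charts_at M p. \<forall>u v.
        h c p (riemann c h p u v v) u = K p * (h c p u u * h c p v v - (h c p u v)\<^sup>2))"

definition flat_on ::
  "('a, 'e::euclidean_space) manifold \<Rightarrow> 'a set \<Rightarrow> ('a, 'e) tensor2 \<Rightarrow> bool" where
  "flat_on M U g \<longleftrightarrow> (\<forall>p\<in>U. \<forall>c\<in>charts_at M p. \<forall>u v w. riemann c g p u v w = 0)"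

definition conformally_flat ::
  "('a, 'e::euclidean_space) manifold \<Rightarrow> ('a, 'e) tensor2 \<Rightarrow> bool" where
  "conformally_flat M g \<longleftrightarrow>
     (\<forall>p\<in>points M. \<exists>U lam. openin (man_top M) U \<and> p \<in> U \<and>
        smooth_map (restrict_manifold M U) real_manifold lam \<and>
        flat_on M U (\<lambda>c q u v. exp (2 * lam q) * g c q u v))"

definition area_form :: "('a, real^2) tensor2 \<Rightarrow> ('a, real^2) tensor2" where
  "area_form h c p u v =
     sqrt (det (\<chi> i j. h c p (axis i 1) (axis j 1))) * det (vector [u, v] :: real^2^2)"


section \<open>Circle bundles with circle metric\<close>

definition principal_circle_bundle ::
  "('p, 'e::euclidean_space) manifold \<Rightarrow> ('m, 'f::euclidean_space) manifold \<Rightarrow> ('p \<Rightarrow> 'm)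
     \<Rightarrow> ('p \<Rightarrow> complex \<Rightarrow> 'p) \<Rightarrow> bool" where
  "principal_circle_bundle P M \<pi> act \<longleftrightarrow>
     smooth_manifold P \<and> smooth_manifold M \<and> smooth_map P M \<pi> \<and>
     smooth_map (prod_manifold P circle_manifold) P (\<lambda>(p, z). act p z) \<and>
     (\<forall>p\<in>points P. act p 1 = p) \<and>
     (\<forall>p\<in>points P. \<forall>z\<in>sphere 0 1. \<forall>w\<in>sphere 0 1. act (act p z) w = act p (z * w)) \<and>
     (\<forall>p\<in>points P. \<forall>z\<in>sphere 0 1. \<pi> (act p z) = \<pi> p) \<and>
     (\<forall>m\<in>points M. \<exists>U \<Phi>. openin (man_top M) U \<and> m \<in> U \<and>
        diffeomorphism (restrict_manifold P (points P \<inter> \<pi> -` U))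
          (prod_manifold (restrict_manifold M U) circle_manifold) \<Phi> \<and>
        (\<forall>p\<in>points P \<inter> \<pi> -` U. fst (\<Phi> p) = \<pi> p \<and>
           (\<forall>z\<in>sphere 0 1. \<Phi> (act p z) = (\<pi> p, snd (\<Phi> p) * z))))"

definition isometry ::
  "('a, 'e::euclidean_space) manifold \<Rightarrow> ('a, 'e) tensor2 \<Rightarrow> ('a \<Rightarrow> 'a) \<Rightarrow> bool" where
  "isometry M g f \<longleftrightarrow> diffeomorphism M M f \<and>
     (\<forall>p\<in>points M. \<forall>c\<in>charts_at M p. \<forall>d\<in>charts_at M (f p). \<forall>u v.
        g d (f p) (tangent_map c d f p u) (tangent_map c d f p v) = g c p u v)"

definition generating_field ::
  "('p \<Rightarrow> complex \<Rightarrow> 'p) \<Rightarrow> ('p, 'e::euclidean_space) chart \<Rightarrow> 'p \<Rightarrow> 'e" where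
  "generating_field act c p = vector_derivative (\<lambda>\<phi>. snd c (act p (cis \<phi>))) (at 0)"

definition circle_bundle_with_circle_metric ::
  "('p, real^3) manifold \<Rightarrow> ('m, real^2) manifold \<Rightarrow> ('p \<Rightarrow> 'm) \<Rightarrow> ('p \<Rightarrow> complex \<Rightarrow> 'p)
     \<Rightarrow> ('p, real^3) tensor2 \<Rightarrow> bool" where
  "circle_bundle_with_circle_metric P M \<pi> act g \<longleftrightarrow>
     oriented_surface M \<and> principal_circle_bundle P M \<pi> act \<and> submersion P M \<pi> \<and>
     riemannian_metric P g \<and>
     (\<forall>z\<in>sphere 0 1. isometry P g (\<lambda>p. act p z)) \<and>
     (\<forall>p\<in>points P. \<forall>c\<in>charts_at P p.
        sqrt (g c p (generating_field act c p) (generating_field act c p)) = 1)"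

text \<open>Components in \<open>c\<close> of the vectors in \<open>ker d\<pi>\<close> and in its orthogonal complement.\<close>

definition vertical ::
  "('m, 'f::euclidean_space) manifold \<Rightarrow> ('p \<Rightarrow> 'm) \<Rightarrow> ('p, 'e::euclidean_space) chart \<Rightarrow> 'p \<Rightarrow> 'e set" where
  "vertical M \<pi> c p = {v. \<forall>d\<in>charts_at M (\<pi> p). tangent_map c d \<pi> p v = 0}"

definition horizontal ::
  "('m, 'f::euclidean_space) manifold \<Rightarrow> ('p \<Rightarrow> 'm) \<Rightarrow> ('p, 'e::euclidean_space) tensor2
     \<Rightarrow> ('p, 'e) chart \<Rightarrow> 'p \<Rightarrow> 'e set" where
  "horizontal M \<pi> g c p = {u. \<forall>v\<in>vertical M \<pi> c p. g c p u v = 0}"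

definition riemannian_submersion ::
  "('p, 'e::euclidean_space) manifold \<Rightarrow> ('p, 'e) tensor2 \<Rightarrow> ('m, 'f::euclidean_space) manifold
     \<Rightarrow> ('m, 'f) tensor2 \<Rightarrow> ('p \<Rightarrow> 'm) \<Rightarrow> bool" where
  "riemannian_submersion P g M h \<pi> \<longleftrightarrow> submersion P M \<pi> \<and>
     (\<forall>p\<in>points P. \<forall>c\<in>charts_at P p. \<forall>d\<in>charts_at M (\<pi> p).
        \<forall>u\<in>horizontal M \<pi> g c p. \<forall>v\<in>horizontal M \<pi> g c p.
          h d (\<pi> p) (tangent_map c d \<pi> p u) (tangent_map c d \<pi> p v) = g c p u v)"

definition connection_form ::
  "('p \<Rightarrow> complex \<Rightarrow> 'p) \<Rightarrow> ('p, 'e::euclidean_space) tensor2 \<Rightarrow> ('p, 'e) chart \<Rightarrow> 'p \<Rightarrow> 'e \<Rightarrow> complex" where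
  "connection_form act g c p u = \<i> * complex_of_real (g c p (generating_field act c p) u)"

text \<open>Normalisation: \<open>d\<omega>(X,Y) = X(\<omega>(Y)) - Y(\<omega>(X)) - \<omega>([X,Y])\<close>, without a factor 1/2.\<close>

definition exterior_derivative ::
  "(('a, 'e::euclidean_space) chart \<Rightarrow> 'a \<Rightarrow> 'e \<Rightarrow> 'b::real_normed_vector)
     \<Rightarrow> ('a, 'e) chart \<Rightarrow> 'a \<Rightarrow> 'e \<Rightarrow> 'e \<Rightarrow> 'b" where
  "exterior_derivative \<omega> c p u v = dchart c (\<lambda>q. \<omega> c q v) p u - dchart c (\<lambda>q. \<omega> c q u) p v"

text \<open>\<open>\<Omega> = \<i> H \<pi>\<^sup>*vol\<^sub>M\<close>, with \<open>H\<close> regarded as a function on the base.\<close>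

definition curvature_function ::
  "('p, 'e::euclidean_space) manifold \<Rightarrow> ('p, 'e) tensor2 \<Rightarrow> ('m, real^2) manifold
     \<Rightarrow> ('m, real^2) tensor2 \<Rightarrow> ('p \<Rightarrow> 'm) \<Rightarrow> ('p \<Rightarrow> complex \<Rightarrow> 'p) \<Rightarrow> ('m \<Rightarrow> real) \<Rightarrow> bool" where
  "curvature_function P g M h \<pi> act H \<longleftrightarrow>
     (\<forall>p\<in>points P. \<forall>c\<in>charts_at P p. \<forall>d\<in>charts_at M (\<pi> p). \<forall>u v.
        exterior_derivative (connection_form act g) c p u v =
          \<i> * complex_of_real
            (H (\<pi> p) * area_form h d (\<pi> p) (tangent_map c d \<pi> p u) (tangent_map c d \<pi> p v)))"

end

theory Submission
  imports Defs
begin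

text \<open>
  Over a chart of the base, lift an orthonormal frame horizontally to \<open>E\<^sub>1, E\<^sub>2\<close> and let \<open>E\<^sub>3\<close> be the
  generator \<open>T\<close> of the action. Then \<open>[E\<^sub>i, E\<^sub>3] = 0\<close> and \<open>[E\<^sub>1, E\<^sub>2] = a E\<^sub>1 + b E\<^sub>2 - H E\<^sub>3\<close>, so the
  curvature of \<open>g\<close> is a polynomial in \<open>H\<close>, \<open>K\<close> and the derivatives of \<open>H\<close>.

  If \<open>exp (2 \<lambda>) g\<close> is flat, then \<open>\<sigma> = exp (- \<lambda>)\<close> satisfies \<open>\<nabla>d\<sigma> = - \<sigma> S - \<rho> g\<close> and \<open>2 \<sigma> \<rho> + |d\<sigma>|\<^sup>2 = 0\<close>,
  where \<open>S\<close> is the Schouten tensor of \<open>g\<close>. Commuting derivatives shows that \<open>\<sigma>\<close> times the Cotton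
  tensor of \<open>g\<close> vanishes, and the components of the Cotton tensor are the two equations on the base.

  Conversely, the equations say that the linear system for \<open>(\<sigma>, d\<sigma>, \<rho>)\<close>, the conformal tractor
  connection, is flat. It therefore has a local solution equal to \<open>(1, 0, 0)\<close> at a given point. Along it
  \<open>2 \<sigma> \<rho> + |d\<sigma>|\<^sup>2\<close> is constant, hence zero, and \<open>\<sigma>\<^sup>-\<^sup>2 g\<close> is flat near the point.
\<close>

section \<open>Smooth functions\<close>

text \<open>In dimension three there is no Weyl tensor, so \<open>exp (2 * lam) * g\<close> is flat
  iff its Schouten tensor vanishes. As an equation for \<lambda> this is quadratic in d\<lambda>.
  Written for exp(-\<lambda>), with the trace part split off as an unknown of its own, it becomes
  linear, at the price of one quadratic constraint. In the frame the Schouten tensor has the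
  diagonal K/2 - 3H^2/8 (twice) and 5H^2/8 - K/2; its other entries are S(E1,E3) = E2(H)/2, S(E2,E3)
  = -E1(H)/2 and S(E1,E2) = 0.

  Three obstacles shape the rest. Curvature is defined by coordinate formulas, while flatness is
  demanded in every chart of the atlas; it is therefore tested on frames, whose structure functions
  do not depend on the chart. The function \<open>H\<close> is given only by its values, through the
  differential of the connection form, so its smoothness has to be derived, with the help of local
  sections. And the overdetermined linear system has to be solved on an open set, not just along
  curves, which is where its integrability condition enters the estimates.\<close>

abbreviation fderiv :: "('a::real_normed_vector \<Rightarrow> 'b::real_normed_vector) \<Rightarrow> 'a \<Rightarrow> 'a \<Rightarrow> 'b" where
  "fderiv f x \<equiv> frechet_derivative f (at x)"

text \<open>\<open>frechet_derivative\<close> is a choice among the derivatives at \<open>x\<close>,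
  and functions that agree near \<open>x\<close> have the same derivatives there. Hence the equation
  holds even where neither function is differentiable.\<close>

lemma frechet_derivative_eq_on_open:
  assumes "open S" "x \<in> S" "\<And>y. y \<in> S \<Longrightarrow> f y = g y"
  shows "fderiv f x = fderiv g x"
proof -
  have *: "(f has_derivative D) (at x) \<longleftrightarrow> (g has_derivative D) (at x)" for D
    using has_derivative_transform_within_open[OF _ assms(1,2), where f = f and g = g]
      has_derivative_transform_within_open[OF _ assms(1,2), where f = g and g = f] assms(3) by metis
  show ?thesis unfolding frechet_derivative_def * ..
qed

lemma differentiable_eq_on_open:
  assumes "open S" "x \<in> S" "\<And>y. y \<in> S \<Longrightarrow> f y = g y" "f differentiable (at x)"
  shows "g differentiable (at x)"
proof -
  obtain D where "(f has_derivative D) (at x)" using assms(4) unfolding differentiable_def ..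
  then have "(g has_derivative D) (at x)"
    by (rule has_derivative_transform_within_open[OF _ assms(1,2,3)])
  then show ?thesis by (auto simp: differentiable_def)
qed

lemma frechet_derivative_has:
  "f differentiable (at x) \<Longrightarrow> (f has_derivative fderiv f x) (at x)"
  using frechet_derivative_works by blast

lemma frechet_derivative_eqI:
  "(f has_derivative f') (at x) \<Longrightarrow> fderiv f x = f'"
  using frechet_derivative_at by metis

lemma Ck_on_cong:
  assumes "open S" "\<And>x. x \<in> S \<Longrightarrow> f x = g x" "Ck_on k S f"
  shows "Ck_on k S g"
  using assms(2,3)
proof (induction k arbitrary: f g)
  case 0
  then show ?case by (simp cong: continuous_on_cong)
next
  case (Suc k)
  have "g differentiable (at x)" if "x \<in> S" for x
    using Suc.prems that differentiable_eq_on_open[OF assms(1) that] by auto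
  moreover have "Ck_on k S (\<lambda>x. fderiv g x v)" for v
  proof (rule Suc.IH)
    show "Ck_on k S (\<lambda>x. fderiv f x v)" using Suc.prems by simp
    show "fderiv f x v = fderiv g x v" if "x \<in> S" for x
      using frechet_derivative_eq_on_open[OF assms(1) that Suc.prems(1)] by simp
  qed
  ultimately show ?case by simp
qed

lemma Ck_on_subset: "Ck_on k S f \<Longrightarrow> T \<subseteq> S \<Longrightarrow> Ck_on k T f"
  by (induction k arbitrary: f) (auto intro: continuous_on_subset)

lemma Ck_on_Suc_imp: "Ck_on (Suc k) S f \<Longrightarrow> Ck_on k S f"
proof (induction k arbitrary: f)
  case 0
  then show ?case
    by (auto intro!: continuous_at_imp_continuous_on differentiable_imp_continuous_within)
next
  case (Suc k)
  have "Ck_on k S (\<lambda>x. fderiv f x v)" for v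
    using Suc.prems by (intro Suc.IH) simp
  then show ?case using Suc.prems by simp
qed

lemma Ck_on_local:
  assumes "\<And>x. x \<in> S \<Longrightarrow> \<exists>N. open N \<and> x \<in> N \<and> Ck_on k N f"
  shows "Ck_on k S f"
  using assms
proof (induction k arbitrary: f)
  case 0
  have "isCont f x" if "x \<in> S" for x
    using 0[OF that] by (auto simp: continuous_on_eq_continuous_at)
  then show ?case by (auto intro: continuous_at_imp_continuous_on)
next
  case (Suc k)
  have "f differentiable (at x)" if "x \<in> S" for x
    using Suc.prems[OF that] by auto
  moreover have "Ck_on k S (\<lambda>x. fderiv f x v)" for v
    using Suc.prems by (intro Suc.IH) (metis Ck_on.simps(2))
  ultimately show ?case by simp
qed

lemma Ck_on_const: "Ck_on k S (\<lambda>x. c)"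
  by (induction k arbitrary: c) auto

lemma Ck_on_bounded_linear:
  assumes "open S" "bounded_linear L" "Ck_on k S f"
  shows "Ck_on k S (\<lambda>x. L (f x))"
  using assms(3)
proof (induction k arbitrary: f)
  case 0
  then show ?case using bounded_linear.continuous_on[OF assms(2), of S f] by simp
next
  case (Suc k)
  have D: "((\<lambda>x. L (f x)) has_derivative (\<lambda>v. L (fderiv f x v))) (at x)"
    if "x \<in> S" for x
    using Suc.prems that by (intro bounded_linear.has_derivative[OF assms(2)] frechet_derivative_has) auto
  have "Ck_on k S (\<lambda>x. fderiv (\<lambda>x. L (f x)) x v)" for v
    by (rule Ck_on_cong[OF assms(1) _ Suc.IH[of "\<lambda>x. fderiv f x v"]])
      (use Suc.prems in \<open>auto simp: frechet_derivative_eqI[OF D]\<close>)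
  then show ?case using D by (auto simp: differentiable_def)
qed

lemma Ck_on_linear: "bounded_linear L \<Longrightarrow> Ck_on k S L"
proof (cases k)
  case 0
  then show "bounded_linear L \<Longrightarrow> ?thesis" by (auto intro: linear_continuous_on)
next
  case (Suc j)
  assume "bounded_linear L"
  then have D: "(L has_derivative L) (at x)" for x
    by (rule bounded_linear_imp_has_derivative)
  show ?thesis using Suc D by (auto simp: frechet_derivative_eqI[OF D] Ck_on_const differentiable_def)
qed

lemma Ck_on_add:
  assumes "open S" "Ck_on k S f" "Ck_on k S g"
  shows "Ck_on k S (\<lambda>x. f x + g x)"
  using assms(2,3)
proof (induction k arbitrary: f g)
  case 0
  then show ?case by (auto intro: continuous_on_add)
next
  case (Suc k)
  have D: "((\<lambda>x. f x + g x) has_derivative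
      (\<lambda>v. fderiv f x v + fderiv g x v)) (at x)"
    if "x \<in> S" for x
    using Suc.prems that by (intro has_derivative_add frechet_derivative_has) auto
  have "Ck_on k S (\<lambda>x. fderiv (\<lambda>x. f x + g x) x v)" for v
    by (rule Ck_on_cong[OF assms(1) _ Suc.IH[of "\<lambda>x. fderiv f x v"
          "\<lambda>x. fderiv g x v"]])
      (use Suc.prems in \<open>auto simp: frechet_derivative_eqI[OF D]\<close>)
  then show ?case using D by (auto simp: differentiable_def)
qed

text \<open>Each Leibniz term pairs a derivative of class C^k with an undifferentiated factor, which
  \<open>Ck_on_Suc_imp\<close> lowers to the same class.\<close>

lemma Ck_on_bilinear:
  assumes "open S" "bounded_bilinear B" "Ck_on k S f" "Ck_on k S g"
  shows "Ck_on k S (\<lambda>x. B (f x) (g x))"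
  using assms(3,4)
proof (induction k arbitrary: f g)
  case 0
  then show ?case using bounded_bilinear.continuous_on[OF assms(2), of S f g] by simp
next
  case (Suc k)
  have D: "((\<lambda>x. B (f x) (g x)) has_derivative
      (\<lambda>v. B (f x) (fderiv g x v) + B (fderiv f x v) (g x))) (at x)"
    if "x \<in> S" for x
    using Suc.prems that by (intro bounded_bilinear.FDERIV[OF assms(2)] frechet_derivative_has) auto
  have "Ck_on k S (\<lambda>x. fderiv (\<lambda>x. B (f x) (g x)) x v)" for v
  proof (rule Ck_on_cong[OF assms(1)])
    show "Ck_on k S (\<lambda>x. B (f x) (fderiv g x v) + B (fderiv f x v) (g x))"
      using Suc.prems
      by (intro Ck_on_add assms Suc.IH) (auto intro: Ck_on_Suc_imp)
  qed (auto simp: frechet_derivative_eqI[OF D])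
  then show ?case using D by (auto simp: differentiable_def)
qed

lemma Ck_on_sum:
  assumes "open S" "\<And>i. i \<in> I \<Longrightarrow> Ck_on k S (f i)"
  shows "Ck_on k S (\<lambda>x. \<Sum>i\<in>I. f i x)"
  using assms(2)
  by (induction I rule: infinite_finite_induct) (auto simp: Ck_on_const intro: Ck_on_add assms(1))

lemma frechet_derivative_Basis:
  fixes f :: "'a::euclidean_space \<Rightarrow> 'b::real_normed_vector"
  assumes "f differentiable (at x)"
  shows "fderiv f x u = (\<Sum>b\<in>Basis. (u \<bullet> b) *\<^sub>R fderiv f x b)"
proof -
  interpret linear "fderiv f x" using assms by (rule linear_frechet_derivative)
  have "fderiv f x u = fderiv f x (\<Sum>b\<in>Basis. (u \<bullet> b) *\<^sub>R b)"
    by (simp add: euclidean_representation)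
  then show ?thesis by (simp add: sum scale)
qed

text \<open>In the chain rule the direction \<open>fderiv g x v\<close> moves with \<open>x\<close>,
  whereas \<open>Ck_on\<close> controls derivatives in fixed directions only. Expanding the moving
  direction in the basis leaves products of its coefficients with \<open>fderiv f (g x) b\<close>,
  to which the induction hypothesis applies because it is general in \<open>f\<close>.\<close>

lemma Ck_on_compose:
  fixes g :: "'a::euclidean_space \<Rightarrow> 'b::euclidean_space"
  assumes "open S" "open T" "\<And>x. x \<in> S \<Longrightarrow> g x \<in> T" "Ck_on k T f" "Ck_on k S g"
  shows "Ck_on k S (\<lambda>x. f (g x))"
  using assms(4,5)
proof (induction k arbitrary: f)
  case 0
  then show ?case using assms(3) by (auto intro: continuous_on_compose2)
next
  case (Suc k)
  have D: "((\<lambda>x. f (g x)) has_derivative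
      (\<lambda>v. fderiv f (g x) (fderiv g x v))) (at x)"
    if "x \<in> S" for x
  proof -
    have "(f \<circ> g has_derivative fderiv f (g x) \<circ> fderiv g x) (at x)"
      using Suc.prems that assms(3) by (intro diff_chain_at frechet_derivative_has) auto
    then show ?thesis by (simp add: o_def)
  qed
  have "Ck_on k S (\<lambda>x. fderiv (\<lambda>x. f (g x)) x v)" for v
  proof (rule Ck_on_cong[OF assms(1)])
    show "Ck_on k S (\<lambda>x. \<Sum>b\<in>Basis. (fderiv g x v \<bullet> b) *\<^sub>R
        fderiv f (g x) b)"
      using Suc.prems
      by (intro Ck_on_sum Ck_on_bilinear[OF _ bounded_bilinear_scaleR] Suc.IH assms(1)
          Ck_on_bounded_linear[OF _ bounded_linear_inner_left]) (auto intro: Ck_on_Suc_imp)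
    show "(\<Sum>b\<in>Basis. (fderiv g x v \<bullet> b) *\<^sub>R fderiv f (g x) b) =
        fderiv (\<lambda>x. f (g x)) x v" if "x \<in> S" for x
      using Suc.prems assms(3) that
      by (simp add: frechet_derivative_eqI[OF D[OF that]] flip: frechet_derivative_Basis)
  qed
  then show ?case using D by (auto simp: differentiable_def)
qed

lemma smooth_on_open: "smooth_on S f \<Longrightarrow> open S"
  by (simp add: smooth_on_def)

lemma smooth_on_Suc:
  "smooth_on S f \<longleftrightarrow> open S \<and> (\<forall>x\<in>S. f differentiable (at x)) \<and>
     (\<forall>v. smooth_on S (\<lambda>x. fderiv f x v))"
  unfolding smooth_on_def
  by (metis Ck_on.simps(2) Ck_on_Suc_imp)

lemma smooth_on_differentiable: "smooth_on S f \<Longrightarrow> x \<in> S \<Longrightarrow> f differentiable (at x)"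
  using smooth_on_Suc by blast

lemma smooth_on_continuous: "smooth_on S f \<Longrightarrow> continuous_on S f"
  unfolding smooth_on_def by (metis Ck_on.simps(1))

lemma smooth_on_has_derivative:
  "smooth_on S f \<Longrightarrow> x \<in> S \<Longrightarrow> (f has_derivative fderiv f x) (at x)"
  by (simp add: smooth_on_differentiable frechet_derivative_has)

lemma smooth_on_frechet_derivative: "smooth_on S f \<Longrightarrow> smooth_on S (\<lambda>x. fderiv f x v)"
  using smooth_on_Suc by blast

lemma smooth_on_cong:
  "smooth_on S f \<Longrightarrow> (\<And>x. x \<in> S \<Longrightarrow> f x = g x) \<Longrightarrow> smooth_on S g"
  unfolding smooth_on_def using Ck_on_cong by blast

lemma smooth_on_subset: "smooth_on S f \<Longrightarrow> open T \<Longrightarrow> T \<subseteq> S \<Longrightarrow> smooth_on T f"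
  unfolding smooth_on_def using Ck_on_subset by blast

lemma smooth_on_local:
  assumes "open S" "\<And>x. x \<in> S \<Longrightarrow> \<exists>N. x \<in> N \<and> smooth_on N f"
  shows "smooth_on S f"
  unfolding smooth_on_def
proof (intro conjI allI Ck_on_local assms(1))
  fix k x assume "x \<in> S"
  then obtain N where "x \<in> N" "smooth_on N f" using assms(2) by blast
  then show "\<exists>N. open N \<and> x \<in> N \<and> Ck_on k N f" unfolding smooth_on_def by blast
qed

lemma smooth_on_const: "open S \<Longrightarrow> smooth_on S (\<lambda>x. c)"
  by (simp add: smooth_on_def Ck_on_const)

lemma smooth_on_linear: "open S \<Longrightarrow> bounded_linear L \<Longrightarrow> smooth_on S L"
  by (simp add: smooth_on_def Ck_on_linear)

lemma smooth_on_bounded_linear: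
  "bounded_linear L \<Longrightarrow> smooth_on S f \<Longrightarrow> smooth_on S (\<lambda>x. L (f x))"
  by (simp add: smooth_on_def Ck_on_bounded_linear)

lemma smooth_on_ident: "open S \<Longrightarrow> smooth_on S (\<lambda>x. x)"
  by (simp add: smooth_on_linear bounded_linear_ident)

lemma smooth_on_add: "smooth_on S f \<Longrightarrow> smooth_on S g \<Longrightarrow> smooth_on S (\<lambda>x. f x + g x)"
  by (simp add: smooth_on_def Ck_on_add)

lemma smooth_on_sum:
  "open S \<Longrightarrow> (\<And>i. i \<in> I \<Longrightarrow> smooth_on S (f i)) \<Longrightarrow> smooth_on S (\<lambda>x. \<Sum>i\<in>I. f i x)"
  by (simp add: smooth_on_def Ck_on_sum)

lemma smooth_on_minus: "smooth_on S f \<Longrightarrow> smooth_on S (\<lambda>x. - f x)"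
  by (rule smooth_on_bounded_linear[OF bounded_linear_minus[OF bounded_linear_ident]])

lemma smooth_on_diff: "smooth_on S f \<Longrightarrow> smooth_on S g \<Longrightarrow> smooth_on S (\<lambda>x. f x - g x)"
  using smooth_on_add[OF _ smooth_on_minus, of S f g] by simp

lemma smooth_on_bilinear:
  "bounded_bilinear B \<Longrightarrow> smooth_on S f \<Longrightarrow> smooth_on S g \<Longrightarrow> smooth_on S (\<lambda>x. B (f x) (g x))"
  by (simp add: smooth_on_def Ck_on_bilinear)

lemmas smooth_on_scaleR = smooth_on_bilinear[OF bounded_bilinear_scaleR]
lemmas smooth_on_inner = smooth_on_bilinear[OF bounded_bilinear_inner]

lemma smooth_on_mult:
  fixes f g :: "_ \<Rightarrow> 'a::real_normed_algebra"
  shows "smooth_on S f \<Longrightarrow> smooth_on S g \<Longrightarrow> smooth_on S (\<lambda>x. f x * g x)"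
  by (rule smooth_on_bilinear[OF bounded_bilinear_mult])

lemma smooth_on_power:
  fixes f :: "_ \<Rightarrow> 'a::real_normed_algebra_1"
  shows "smooth_on S f \<Longrightarrow> smooth_on S (\<lambda>x. f x ^ n)"
  by (induction n) (auto intro: smooth_on_mult smooth_on_const smooth_on_open)

lemma smooth_on_compose:
  fixes g :: "'a::euclidean_space \<Rightarrow> 'b::euclidean_space"
  assumes "smooth_on T f" "smooth_on S g" "\<And>x. x \<in> S \<Longrightarrow> g x \<in> T"
  shows "smooth_on S (\<lambda>x. f (g x))"
  using assms unfolding smooth_on_def by (auto intro: Ck_on_compose)

lemma smooth_on_Pair:
  "smooth_on S f \<Longrightarrow> smooth_on S g \<Longrightarrow> smooth_on S (\<lambda>x. (f x, g x))"
proof -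
  assume "smooth_on S f" "smooth_on S g"
  then have "smooth_on S (\<lambda>x. (f x, 0) + (0, g x))"
    by (intro smooth_on_add smooth_on_bounded_linear[where L = "\<lambda>x. (x, 0)"]
        smooth_on_bounded_linear[where L = "\<lambda>x. (0, x)"] bounded_linear_intros)
  then show ?thesis by simp
qed

text \<open>Bootstrapping: if \<open>f'\<close> inherits every class C^k from \<open>f\<close>, then
  each class of \<open>f\<close> gives the next one. The derivatives of \<open>inverse\<close>,
  \<open>exp\<close> and \<open>sqrt\<close> are expressions in these functions themselves; that of
  \<open>ln\<close> is smooth outright.\<close>

lemma smooth_on_realI:
  fixes f :: "real \<Rightarrow> real"
  assumes "open S" "\<And>x. x \<in> S \<Longrightarrow> (f has_field_derivative f' x) (at x)"
    "\<And>k. Ck_on k S f \<Longrightarrow> Ck_on k S f'"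
  shows "smooth_on S f"
proof -
  have D: "(f has_derivative (\<lambda>v. f' x * v)) (at x)" if "x \<in> S" for x
    using assms(2)[OF that] by (simp add: has_field_derivative_def)
  have "Ck_on k S f" for k
  proof (induction k)
    case 0
    show ?case using D by (auto intro!: continuous_at_imp_continuous_on has_derivative_continuous)
  next
    case (Suc k)
    have "Ck_on k S (\<lambda>x. fderiv f x v)" for v
    proof (rule Ck_on_cong[OF assms(1)])
      show "Ck_on k S (\<lambda>x. f' x * v)"
        using assms(3)[OF Suc] assms(1)
        by (intro Ck_on_bilinear[OF _ bounded_bilinear_mult] Ck_on_const)
    qed (auto simp: frechet_derivative_eqI[OF D])
    then show ?case using D by (auto simp: differentiable_def)
  qed
  then show ?thesis using assms(1) by (simp add: smooth_on_def)
qed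

lemma smooth_on_real_inverse: "smooth_on (- {0}) (inverse :: real \<Rightarrow> real)"
proof (rule smooth_on_realI)
  show "(inverse has_field_derivative - (inverse x * inverse x)) (at x)" if "x \<in> - {0}" for x :: real
    using that DERIV_inverse[of x UNIV] by (simp add: power2_eq_square)
  show "Ck_on k (- {0}) (\<lambda>x::real. - (inverse x * inverse x))"
    if "Ck_on k (- {0}) (inverse :: real \<Rightarrow> real)" for k
    using Ck_on_bounded_linear[OF _ bounded_linear_minus[OF bounded_linear_ident]
        Ck_on_bilinear[OF _ bounded_bilinear_mult that that]] open_Compl[OF closed_singleton[of "0::real"]] by simp
qed auto

lemma smooth_on_exp_real: "smooth_on UNIV (exp :: real \<Rightarrow> real)"
  by (rule smooth_on_realI) (auto intro: DERIV_exp)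

lemma smooth_on_ln_real: "smooth_on {0<..} (ln :: real \<Rightarrow> real)"
proof (rule smooth_on_realI)
  show "(ln has_field_derivative inverse x) (at x)" if "x \<in> {0<..}" for x :: real
    using that by (auto intro: DERIV_ln)
  show "Ck_on k {0<..} (inverse :: real \<Rightarrow> real)" for k
    using smooth_on_real_inverse by (auto simp: smooth_on_def intro: Ck_on_subset)
qed auto

lemma smooth_on_sqrt_real: "smooth_on {0<..} (sqrt :: real \<Rightarrow> real)"
proof (rule smooth_on_realI)
  show "(sqrt has_field_derivative inverse (sqrt x) / 2) (at x)" if "x \<in> {0<..}" for x :: real
    using that by (auto intro: DERIV_real_sqrt)
  show "Ck_on k {0<..} (\<lambda>x. inverse (sqrt x) / 2)" if "Ck_on k {0<..} (sqrt :: real \<Rightarrow> real)" for k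
    using that smooth_on_real_inverse
    by (intro Ck_on_bounded_linear[OF _ bounded_linear_divide[of 2]]
        Ck_on_compose[where T = "- {0}" and f = inverse and g = sqrt])
      (auto simp: smooth_on_def)
qed auto

lemma smooth_on_inverse:
  fixes f :: "_ \<Rightarrow> real"
  shows "smooth_on S f \<Longrightarrow> (\<And>x. x \<in> S \<Longrightarrow> f x \<noteq> 0) \<Longrightarrow> smooth_on S (\<lambda>x. inverse (f x))"
  by (rule smooth_on_compose[OF smooth_on_real_inverse]) auto

lemma smooth_on_divide:
  fixes f :: "_ \<Rightarrow> real"
  shows "smooth_on S f \<Longrightarrow> smooth_on S g \<Longrightarrow> (\<And>x. x \<in> S \<Longrightarrow> g x \<noteq> 0) \<Longrightarrow> smooth_on S (\<lambda>x. f x / g x)"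
  unfolding divide_inverse by (intro smooth_on_mult smooth_on_inverse)

lemma smooth_on_exp:
  fixes f :: "_ \<Rightarrow> real"
  shows "smooth_on S f \<Longrightarrow> smooth_on S (\<lambda>x. exp (f x))"
  by (rule smooth_on_compose[OF smooth_on_exp_real]) auto

lemma smooth_on_ln:
  fixes f :: "_ \<Rightarrow> real"
  shows "smooth_on S f \<Longrightarrow> (\<And>x. x \<in> S \<Longrightarrow> f x > 0) \<Longrightarrow> smooth_on S (\<lambda>x. ln (f x))"
  by (rule smooth_on_compose[OF smooth_on_ln_real]) auto

lemma smooth_on_sqrt:
  fixes f :: "_ \<Rightarrow> real"
  shows "smooth_on S f \<Longrightarrow> (\<And>x. x \<in> S \<Longrightarrow> f x > 0) \<Longrightarrow> smooth_on S (\<lambda>x. sqrt (f x))"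
  by (rule smooth_on_compose[OF smooth_on_sqrt_real]) auto

section \<open>Symmetry of second derivatives\<close>

lemma second_difference_mean_value:
  fixes f :: "'a::euclidean_space \<Rightarrow> real"
  assumes f: "smooth_on S f" and "0 < h"
    and S: "\<And>s t. 0 \<le> s \<Longrightarrow> s \<le> h \<Longrightarrow> 0 \<le> t \<Longrightarrow> t \<le> h \<Longrightarrow> x + s *\<^sub>R u + t *\<^sub>R v \<in> S"
  shows "\<exists>s t. 0 < s \<and> s < h \<and> 0 < t \<and> t < h \<and>
    f (x + h *\<^sub>R u + h *\<^sub>R v) - f (x + h *\<^sub>R u) - f (x + h *\<^sub>R v) + f x =
    h * h * fderiv (\<lambda>y. fderiv f y u) (x + s *\<^sub>R u + t *\<^sub>R v) v"
proof -
  have D: "((\<lambda>s. g (a + s *\<^sub>R w)) has_field_derivative fderiv g (a + s *\<^sub>R w) w) (at s)"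
    if "smooth_on S g" "a + s *\<^sub>R w \<in> S" for g :: "'a \<Rightarrow> real" and a w s
  proof -
    let ?D = "fderiv g (a + s *\<^sub>R w)"
    have "((\<lambda>s. a + s *\<^sub>R w) has_derivative (\<lambda>r. r *\<^sub>R w)) (at s)"
      by (auto intro!: derivative_eq_intros)
    then have "(g \<circ> (\<lambda>s. a + s *\<^sub>R w) has_derivative ?D \<circ> (\<lambda>r. r *\<^sub>R w)) (at s)"
      by (rule diff_chain_at) (rule smooth_on_has_derivative[OF that])
    moreover have "?D (r *\<^sub>R w) = ?D w * r" for r
      using linear_scale[OF linear_frechet_derivative[OF smooth_on_differentiable[OF that]]] by simp
    ultimately show ?thesis by (simp add: has_field_derivative_def o_def)
  qed
  \<comment> \<open>The mean value theorem is used twice: along \<open>u\<close> for this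
    difference, then along \<open>v\<close> for the derivative of \<open>f\<close> in direction
    \<open>u\<close>.\<close>
  let ?Q = "\<lambda>s. f (x + h *\<^sub>R v + s *\<^sub>R u) - f (x + s *\<^sub>R u)"
  let ?F = "\<lambda>y. fderiv f y u"
  have "\<exists>s. 0 < s \<and> s < h \<and> ?Q h - ?Q 0 = (h - 0) * (?F (x + h *\<^sub>R v + s *\<^sub>R u) - ?F (x + s *\<^sub>R u))"
  proof (rule MVT2[OF \<open>0 < h\<close>])
    fix s assume s: "0 \<le> s" "s \<le> h"
    show "(?Q has_field_derivative (?F (x + h *\<^sub>R v + s *\<^sub>R u) - ?F (x + s *\<^sub>R u))) (at s)"
      using S[of s h] S[of s 0] s \<open>0 < h\<close>
      by (intro DERIV_diff D f) (auto simp: algebra_simps)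
  qed
  then obtain s where s: "0 < s" "s < h"
    "?Q h - ?Q 0 = h * (?F (x + h *\<^sub>R v + s *\<^sub>R u) - ?F (x + s *\<^sub>R u))" by auto
  have "\<exists>t. 0 < t \<and> t < h \<and> ?F (x + s *\<^sub>R u + h *\<^sub>R v) - ?F (x + s *\<^sub>R u + 0 *\<^sub>R v) =
    (h - 0) * fderiv ?F (x + s *\<^sub>R u + t *\<^sub>R v) v"
    using S s by (intro MVT2[OF \<open>0 < h\<close>] D smooth_on_frechet_derivative f) auto
  then obtain t where t: "0 < t" "t < h"
    "?F (x + s *\<^sub>R u + h *\<^sub>R v) - ?F (x + s *\<^sub>R u) =
      h * fderiv ?F (x + s *\<^sub>R u + t *\<^sub>R v) v" by auto
  show ?thesis
  proof (intro exI conjI)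
    show "f (x + h *\<^sub>R u + h *\<^sub>R v) - f (x + h *\<^sub>R u) - f (x + h *\<^sub>R v) + f x =
      h * h * fderiv ?F (x + s *\<^sub>R u + t *\<^sub>R v) v"
      using s(3) t(3) by (simp add: algebra_simps)
  qed (use s t in auto)
qed

text \<open>The second difference over the parallelogram spanned by \<open>h u\<close> and
  \<open>h v\<close> is symmetric in \<open>u\<close> and \<open>v\<close>, and for either order it
  is h^2 times the mixed derivative at some point of the parallelogram. As the mixed derivatives are
  continuous, a gap between their values at \<open>x\<close> is impossible for small
  \<open>h\<close>.\<close>

lemma frechet_derivative_symmetric_real:
  fixes f :: "'a::euclidean_space \<Rightarrow> real"
  assumes f: "smooth_on S f" and x: "x \<in> S"
  shows "fderiv (\<lambda>y. fderiv f y u) x v =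
    fderiv (\<lambda>y. fderiv f y v) x u" (is "?A x = ?B x")
proof (rule ccontr)
  assume neq: "?A x \<noteq> ?B x"
  \<comment> \<open>Half the gap: a number closer than this to \<open>?A x\<close> cannot also be
    closer than this to \<open>?B x\<close>.\<close>
  let ?e = "\<bar>?A x - ?B x\<bar> / 2"
  have e: "?e > 0" using neq by simp
  have "continuous_on S ?A" "continuous_on S ?B"
    by (intro smooth_on_continuous smooth_on_frechet_derivative f)+
  then have "isCont ?A x" "isCont ?B x"
    using x smooth_on_open[OF f] by (auto simp: continuous_on_eq_continuous_at)
  then obtain d1 d2 where d: "d1 > 0" "d2 > 0"
    "\<And>y. dist y x < d1 \<Longrightarrow> dist (?A y) (?A x) < ?e" "\<And>y. dist y x < d2 \<Longrightarrow> dist (?B y) (?B x) < ?e"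
    using e unfolding continuous_at_eps_delta by metis
  obtain d3 where d3: "d3 > 0" "\<And>y. dist y x < d3 \<Longrightarrow> y \<in> S"
    using smooth_on_open[OF f] x unfolding open_dist by blast
  define d where "d = min d1 (min d2 d3)"
  have "d > 0" using d d3 by (simp add: d_def)
  \<comment> \<open>Every point of the parallelogram then lies within d/2 of \<open>x\<close>. The
    summand 1 keeps the denominator positive when \<open>u\<close> and \<open>v\<close>
    vanish.\<close>
  define h where "h = d / (2 * (norm u + norm v + 1))"
  have pos: "norm u + norm v + 1 > 0" by (simp add: add_nonneg_pos)
  have "h > 0" using \<open>d > 0\<close> pos by (simp add: h_def)
  have near: "dist (x + s *\<^sub>R u + t *\<^sub>R v) x < d" if "0 \<le> s" "s \<le> h" "0 \<le> t" "t \<le> h" for s t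
  proof -
    have "dist (x + s *\<^sub>R u + t *\<^sub>R v) x = norm (s *\<^sub>R u + t *\<^sub>R v)" by (simp add: dist_norm algebra_simps)
    also have "\<dots> \<le> s * norm u + t * norm v"
      using norm_triangle_ineq[of "s *\<^sub>R u" "t *\<^sub>R v"] that by simp
    also have "\<dots> \<le> h * norm u + h * norm v"
      using that by (intro add_mono mult_right_mono) auto
    also have "\<dots> \<le> h * (norm u + norm v + 1)" using \<open>h > 0\<close> by (simp add: algebra_simps)
    also have "\<dots> = d / 2" using pos by (simp add: h_def field_simps)
    also have "\<dots> < d" using \<open>d > 0\<close> by simp
    finally show ?thesis .
  qed
  obtain s t where st: "0 < s" "s < h" "0 < t" "t < h"
    "f (x + h *\<^sub>R u + h *\<^sub>R v) - f (x + h *\<^sub>R u) - f (x + h *\<^sub>R v) + f x = h * h * ?A (x + s *\<^sub>R u + t *\<^sub>R v)"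
    using second_difference_mean_value[OF f \<open>h > 0\<close>, of x u v] near d3 d_def by (metis min_less_iff_conj)
  obtain s' t' where st': "0 < s'" "s' < h" "0 < t'" "t' < h"
    "f (x + h *\<^sub>R v + h *\<^sub>R u) - f (x + h *\<^sub>R v) - f (x + h *\<^sub>R u) + f x = h * h * ?B (x + s' *\<^sub>R v + t' *\<^sub>R u)"
  proof -
    have "x + s *\<^sub>R v + t *\<^sub>R u \<in> S" if "0 \<le> s" "s \<le> h" "0 \<le> t" "t \<le> h" for s t
      using near[OF that(3,4,1,2)] d3 by (simp add: d_def ac_simps)
    then show ?thesis
      using second_difference_mean_value[OF f \<open>h > 0\<close>, of x v u] that by metis
  qed
  have "h * h * ?A (x + s *\<^sub>R u + t *\<^sub>R v) = h * h * ?B (x + s' *\<^sub>R v + t' *\<^sub>R u)"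
    using st(5) st'(5) by (simp add: algebra_simps)
  then have "?A (x + s *\<^sub>R u + t *\<^sub>R v) = ?B (x + s' *\<^sub>R v + t' *\<^sub>R u)" using \<open>h > 0\<close> by simp
  moreover have "dist (?A (x + s *\<^sub>R u + t *\<^sub>R v)) (?A x) < ?e"
    using near[of s t] st by (intro d(3)) (simp add: d_def)
  moreover have "dist (?B (x + s' *\<^sub>R v + t' *\<^sub>R u)) (?B x) < ?e"
    using near[of t' s'] st' by (intro d(4)) (simp add: d_def add.assoc add.commute[of "s' *\<^sub>R v"])
  ultimately show False unfolding dist_real_def by (simp add: abs_if split: if_splits)
qed

lemma frechet_derivative_bounded_linear:
  "bounded_linear L \<Longrightarrow> f differentiable (at x) \<Longrightarrow>
    fderiv (\<lambda>x. L (f x)) x v = L (fderiv f x v)"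
  using frechet_derivative_eqI[OF bounded_linear.has_derivative[OF _ frechet_derivative_has]] by metis

lemma frechet_derivative_symmetric:
  fixes f :: "'a::euclidean_space \<Rightarrow> 'b::euclidean_space"
  assumes f: "smooth_on S f" and x: "x \<in> S"
  shows "fderiv (\<lambda>y. fderiv f y u) x v =
    fderiv (\<lambda>y. fderiv f y v) x u"
proof (rule euclidean_eqI)
  fix b :: 'b
  have fb: "smooth_on S (\<lambda>x. f x \<bullet> b)"
    by (rule smooth_on_bounded_linear[OF bounded_linear_inner_left f])
  have *: "fderiv (\<lambda>y. fderiv f y u) x v \<bullet> b =
    fderiv (\<lambda>y. fderiv (\<lambda>y. f y \<bullet> b) y u) x v" for u v
  proof -
    have "fderiv (\<lambda>y. fderiv f y u) x v \<bullet> b =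
      fderiv (\<lambda>y. fderiv f y u \<bullet> b) x v"
      using frechet_derivative_bounded_linear[OF bounded_linear_inner_left
          smooth_on_differentiable[OF smooth_on_frechet_derivative[OF f] x]] by simp
    also have "\<dots> = fderiv (\<lambda>y. fderiv (\<lambda>y. f y \<bullet> b) y u) x v"
      using frechet_derivative_eq_on_open[OF smooth_on_open[OF f] x, of
          "\<lambda>y. fderiv f y u \<bullet> b" "\<lambda>y. fderiv (\<lambda>y. f y \<bullet> b) y u"]
        frechet_derivative_bounded_linear[OF bounded_linear_inner_left smooth_on_differentiable[OF f]]
      by simp
    finally show ?thesis .
  qed
  show "fderiv (\<lambda>y. fderiv f y u) x v \<bullet> b =
    fderiv (\<lambda>y. fderiv f y v) x u \<bullet> b"
    unfolding * by (rule frechet_derivative_symmetric_real[OF fb x])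
qed

section \<open>Bilinear families and integrals depending on a parameter\<close>

lemma bilinear_basis:
  fixes B :: "'a::euclidean_space \<Rightarrow> 'b::euclidean_space \<Rightarrow> 'c::real_normed_vector"
  assumes "bilinear B"
  shows "B u v = (\<Sum>b\<in>Basis. \<Sum>c\<in>Basis. ((u \<bullet> b) * (v \<bullet> c)) *\<^sub>R B b c)"
proof -
  have "B u v = B (\<Sum>b\<in>Basis. (u \<bullet> b) *\<^sub>R b) (\<Sum>c\<in>Basis. (v \<bullet> c) *\<^sub>R c)"
    by (simp only: euclidean_representation)
  also have "\<dots> = (\<Sum>(b, c)\<in>Basis \<times> Basis. B ((u \<bullet> b) *\<^sub>R b) ((v \<bullet> c) *\<^sub>R c))"
    by (rule bilinear_sum[OF assms])
  also have "\<dots> = (\<Sum>b\<in>Basis. \<Sum>c\<in>Basis. B ((u \<bullet> b) *\<^sub>R b) ((v \<bullet> c) *\<^sub>R c))"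
    by (simp add: sum.cartesian_product)
  finally show ?thesis by (simp add: bilinear_lmul[OF assms] bilinear_rmul[OF assms] mult.commute)
qed

text \<open>Families such as a metric in coordinates are known to be smooth only for fixed
  arguments. In a basis they are finite sums of such values, with coefficients read off from
  \<open>g\<close> and \<open>h\<close>, so moving arguments do no harm.\<close>

lemma smooth_on_bilinear_family:
  fixes A :: "'a::euclidean_space \<Rightarrow> 'b::euclidean_space \<Rightarrow> 'c::euclidean_space \<Rightarrow> 'd::real_normed_vector"
    and f :: "'e::euclidean_space \<Rightarrow> 'a"
  assumes "\<And>x. x \<in> T \<Longrightarrow> bilinear (A x)" "\<And>v y. smooth_on T (\<lambda>x. A x v y)"
    "\<And>x. x \<in> S \<Longrightarrow> f x \<in> T" "smooth_on S f" "smooth_on S g" "smooth_on S h"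
  shows "smooth_on S (\<lambda>x. A (f x) (g x) (h x))"
proof (rule smooth_on_cong)
  have 1: "smooth_on S (\<lambda>x. A (f x) b c)" for b c
    by (rule smooth_on_compose[OF assms(2,4,3)])
  have 2: "open S" using smooth_on_open[OF assms(4)] .
  show "smooth_on S (\<lambda>x. \<Sum>b\<in>Basis. \<Sum>c\<in>Basis. ((g x \<bullet> b) * (h x \<bullet> c)) *\<^sub>R A (f x) b c)"
    by (intro smooth_on_sum 1 2 smooth_on_scaleR smooth_on_mult assms(5,6)
        smooth_on_bounded_linear[OF bounded_linear_inner_left])
  show "(\<Sum>b\<in>Basis. \<Sum>c\<in>Basis. ((g x \<bullet> b) * (h x \<bullet> c)) *\<^sub>R A (f x) b c) = A (f x) (g x) (h x)"
    if "x \<in> S" for x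
    by (rule bilinear_basis[OF assms(1)[OF assms(3)[OF that]], symmetric])
qed

text \<open>Product rule with three moving places. The first term freezes both vector arguments and
  differentiates the coefficients; it is again reached through the expansion over the bases.\<close>

lemma has_derivative_bilinear_family:
  fixes A :: "'a::euclidean_space \<Rightarrow> 'b::euclidean_space \<Rightarrow> 'c::euclidean_space \<Rightarrow> 'd::real_normed_vector"
    and f :: "'e::euclidean_space \<Rightarrow> 'a"
  assumes bil: "\<And>x. x \<in> T \<Longrightarrow> bilinear (A x)" and sm: "\<And>v y. smooth_on T (\<lambda>x. A x v y)"
    and x: "f x \<in> T"
    and f: "(f has_derivative f') (at x)" and g: "(g has_derivative g') (at x)"
    and h: "(h has_derivative h') (at x)"
  shows "((\<lambda>x. A (f x) (g x) (h x)) has_derivative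
    (\<lambda>v. fderiv (\<lambda>z. A z (g x) (h x)) (f x) (f' v) +
      A (f x) (g' v) (h x) + A (f x) (g x) (h' v))) (at x)"
proof -
  let ?D = "\<lambda>b c. fderiv (\<lambda>z. A z b c) (f x)"
  have D: "((\<lambda>z. A z b c) has_derivative ?D b c) (at (f x))" for b c
    by (rule smooth_on_has_derivative[OF sm x])
  have comp: "((\<lambda>x. A (f x) b c) has_derivative (\<lambda>v. ?D b c (f' v))) (at x)" for b c
    using diff_chain_at[OF f D] by (simp add: o_def)
  have 1: "((\<lambda>x. \<Sum>b\<in>Basis. \<Sum>c\<in>Basis. ((g x \<bullet> b) * (h x \<bullet> c)) *\<^sub>R A (f x) b c) has_derivative
    (\<lambda>v. \<Sum>b\<in>Basis. \<Sum>c\<in>Basis. ((g x \<bullet> b) * (h x \<bullet> c)) *\<^sub>R ?D b c (f' v) +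
      ((g x \<bullet> b) * (h' v \<bullet> c) + (g' v \<bullet> b) * (h x \<bullet> c)) *\<^sub>R A (f x) b c)) (at x)"
    by (intro has_derivative_sum has_derivative_scaleR has_derivative_mult has_derivative_inner_left
        f g h comp)
  have 2: "((\<lambda>z. \<Sum>b\<in>Basis. \<Sum>c\<in>Basis. ((g x \<bullet> b) * (h x \<bullet> c)) *\<^sub>R A z b c) has_derivative
    (\<lambda>v. \<Sum>b\<in>Basis. \<Sum>c\<in>Basis. ((g x \<bullet> b) * (h x \<bullet> c)) *\<^sub>R ?D b c v)) (at (f x))"
    by (intro has_derivative_sum has_derivative_scaleR_right D)
  obtain e where e: "e > 0" "ball (f x) e \<subseteq> T"
    using smooth_on_open[OF sm] x open_contains_ball by blast
  have 3: "fderiv (\<lambda>z. A z (g x) (h x)) (f x) =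
    (\<lambda>v. \<Sum>b\<in>Basis. \<Sum>c\<in>Basis. ((g x \<bullet> b) * (h x \<bullet> c)) *\<^sub>R ?D b c v)"
  proof (rule frechet_derivative_eqI, rule has_derivative_transform_within_open[OF 2 open_ball[of "f x" e]])
    show "(\<Sum>b\<in>Basis. \<Sum>c\<in>Basis. ((g x \<bullet> b) * (h x \<bullet> c)) *\<^sub>R A z b c) = A z (g x) (h x)"
      if "z \<in> ball (f x) e" for z
      by (rule bilinear_basis[OF bil, symmetric]) (use that e in auto)
  qed (use e in auto)
  have "isCont f x" using f has_derivative_continuous by blast
  then obtain d where d: "d > 0" "\<And>y. dist y x < d \<Longrightarrow> dist (f y) (f x) < e"
    using e unfolding continuous_at_eps_delta by blast
  have 4: "((\<lambda>x. A (f x) (g x) (h x)) has_derivative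
    (\<lambda>v. \<Sum>b\<in>Basis. \<Sum>c\<in>Basis. ((g x \<bullet> b) * (h x \<bullet> c)) *\<^sub>R ?D b c (f' v) +
      ((g x \<bullet> b) * (h' v \<bullet> c) + (g' v \<bullet> b) * (h x \<bullet> c)) *\<^sub>R A (f x) b c)) (at x)"
  proof (rule has_derivative_transform_within_open[OF 1 open_ball[of x d]])
    show "(\<Sum>b\<in>Basis. \<Sum>c\<in>Basis. ((g y \<bullet> b) * (h y \<bullet> c)) *\<^sub>R A (f y) b c) = A (f y) (g y) (h y)"
      if "y \<in> ball x d" for y
    proof -
      have "f y \<in> T" using d(2)[of y] that e by (auto simp: dist_commute subset_iff)
      then show ?thesis by (rule bilinear_basis[OF bil, symmetric])
    qed
  qed (use d in auto)
  have 5: "(\<lambda>v. \<Sum>b\<in>Basis. \<Sum>c\<in>Basis. ((g x \<bullet> b) * (h x \<bullet> c)) *\<^sub>R ?D b c (f' v) +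
      ((g x \<bullet> b) * (h' v \<bullet> c) + (g' v \<bullet> b) * (h x \<bullet> c)) *\<^sub>R A (f x) b c) =
    (\<lambda>v. fderiv (\<lambda>z. A z (g x) (h x)) (f x) (f' v) +
      A (f x) (g' v) (h x) + A (f x) (g x) (h' v))"
    unfolding 3 bilinear_basis[OF bil[OF x], of "g' _" "h x"] bilinear_basis[OF bil[OF x], of "g x" "h' _"]
    by (simp add: sum.distrib scaleR_add_left ac_simps)
  show ?thesis using 4 unfolding 5 .
qed

section \<open>Differentiation under the integral sign\<close>

lemma has_derivative_integral_parameter:
  fixes F :: "'a::euclidean_space \<times> real \<Rightarrow> 'b::euclidean_space"
  assumes F: "smooth_on W F" and U: "open U" "U \<times> {0..1} \<subseteq> W" and x: "x \<in> U"
  shows "((\<lambda>x. integral {0..1} (\<lambda>s. F (x, s))) has_derivative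
    (\<lambda>v. integral {0..1} (\<lambda>s. fderiv F (x, s) (v, 0)))) (at x)"
proof -
  obtain e where e: "e > 0" "ball x e \<subseteq> U" using U(1) x open_contains_ball by blast
  let ?B = "ball x e"
  \<comment> \<open>\<open>leibniz_rule\<close> takes the partial derivative as a continuous family
    of bounded linear maps. In finite dimension its continuity can be checked on basis
    vectors.\<close>
  let ?f' = "\<lambda>x s. Blinfun (\<lambda>v. fderiv F (x, s) (v, 0))"
  have W: "(y, s) \<in> W" if "y \<in> ?B" "s \<in> {0..1}" for y s
    using that e(2) U(2) by (meson SigmaI subsetD)
  have pair: "((\<lambda>y. (y, s)) has_derivative (\<lambda>v. (v, 0))) (at y)" for y :: 'a and s :: real
    by (auto intro!: derivative_eq_intros)
  have D: "((\<lambda>y. F (y, s)) has_derivative (\<lambda>v. fderiv F (y, s) (v, 0))) (at y)"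
    if "y \<in> ?B" "s \<in> {0..1}" for y s
    using diff_chain_at[OF pair smooth_on_has_derivative[OF F W[OF that]]] by (simp add: o_def)
  have app: "blinfun_apply (?f' y s) v = fderiv F (y, s) (v, 0)"
    if "y \<in> ?B" "s \<in> {0..1}" for y s v
    using bounded_linear_Blinfun_apply[OF has_derivative_bounded_linear[OF D[OF that]]] by simp
  have cont: "continuous_on (?B \<times> cbox 0 1) (\<lambda>(y, s). ?f' y s)"
  proof (rule continuous_on_blinfun_componentwise)
    fix i :: 'a
    have "continuous_on (?B \<times> cbox 0 1) (\<lambda>z. fderiv F z (i, 0))"
      using smooth_on_continuous[OF smooth_on_frechet_derivative[OF F]] by (rule continuous_on_subset) (use W in auto)
    then show "continuous_on (?B \<times> cbox 0 1) (\<lambda>z. blinfun_apply (case z of (y, s) \<Rightarrow> ?f' y s) i)"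
      by (rule continuous_on_eq) (auto simp: app)
  qed
  have int: "(\<lambda>s. F (y, s)) integrable_on cbox 0 1" if "y \<in> ?B" for y
    by (rule integrable_continuous, rule continuous_on_compose2[OF smooth_on_continuous[OF F]])
      (use that W in \<open>auto intro!: continuous_intros\<close>)
  have "((\<lambda>y. integral (cbox 0 1) (\<lambda>s. F (y, s))) has_derivative blinfun_apply (integral (cbox 0 1) (?f' x)))
      (at x within ?B)"
  proof (rule leibniz_rule[OF _ int cont])
    show "((\<lambda>y. F (y, s)) has_derivative blinfun_apply (?f' y s)) (at y within ?B)"
      if "y \<in> ?B" "s \<in> cbox 0 1" for y s
    proof -
      have "blinfun_apply (?f' y s) = (\<lambda>v. fderiv F (y, s) (v, 0))"
        using app that by auto
      then show ?thesis using has_derivative_at_withinI[OF D] that by simp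
    qed
  qed (use e in auto)
  then have D1: "((\<lambda>y. integral {0..1} (\<lambda>s. F (y, s))) has_derivative blinfun_apply (integral {0..1} (?f' x))) (at x)"
    using at_within_open[OF _ open_ball, of x x e] e(1) unfolding cbox_interval by simp
  have "continuous_on (cbox 0 1) (?f' x)"
  proof -
    have 1: "continuous_on (cbox 0 1) (\<lambda>s::real. (x, s))" by (intro continuous_intros)
    have 2: "(\<lambda>s. (x, s)) ` cbox 0 1 \<subseteq> ball x e \<times> cbox (0::real) 1" using e(1) by auto
    show ?thesis using continuous_on_compose2[OF cont 1 2] by simp
  qed
  then have "?f' x integrable_on cbox 0 1" by (rule integrable_continuous)
  then have "blinfun_apply (integral {0..1} (?f' x)) v = integral {0..1} (\<lambda>s. blinfun_apply (?f' x s) v)" for v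
    by (simp add: blinfun_apply_integral)
  moreover have "integral {0..1} (\<lambda>s. blinfun_apply (?f' x s) v) =
      integral {0..1} (\<lambda>s. fderiv F (x, s) (v, 0))" for v
    using e by (intro integral_cong app) auto
  ultimately have "blinfun_apply (integral {0..1} (?f' x)) = (\<lambda>v. integral {0..1} (\<lambda>s. fderiv F (x, s) (v, 0)))"
    by auto
  then show ?thesis using D1 by simp
qed

text \<open>Differentiating in direction \<open>v\<close> gives the integral of the derivative of
  \<open>F\<close> in direction \<open>(v, 0)\<close>, an integral of the same kind; this is why the
  induction is general in \<open>F\<close>.\<close>

lemma smooth_on_integral_parameter:
  fixes F :: "'a::euclidean_space \<times> real \<Rightarrow> 'b::euclidean_space"
  assumes "smooth_on W F" "open U" "U \<times> {0..1} \<subseteq> W"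
  shows "smooth_on U (\<lambda>x. integral {0..1} (\<lambda>s. F (x, s)))"
proof -
  have "Ck_on k U (\<lambda>x. integral {0..1} (\<lambda>s. F (x, s)))" for k
    using assms(1)
  proof (induction k arbitrary: F)
    case 0
    have "isCont (\<lambda>x. integral {0..1} (\<lambda>s. F (x, s))) x" if "x \<in> U" for x
      using has_derivative_integral_parameter[OF 0 assms(2,3) that] has_derivative_continuous by blast
    then show ?case by (simp add: continuous_at_imp_continuous_on)
  next
    case (Suc k)
    note D = has_derivative_integral_parameter[OF Suc.prems assms(2,3)]
    have "Ck_on k U (\<lambda>x. fderiv (\<lambda>x. integral {0..1} (\<lambda>s. F (x, s))) x v)" for v
      by (rule Ck_on_cong[OF assms(2) _ Suc.IH[OF smooth_on_frechet_derivative[OF Suc.prems], of "(v, 0)"]])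
        (simp add: frechet_derivative_eqI[OF D])
    then show ?case using D by (auto simp: differentiable_def)
  qed
  then show ?thesis using assms(2) by (simp add: smooth_on_def)
qed

lemma bilinear_family_bound:
  fixes A :: "'a::euclidean_space \<Rightarrow> 'b::euclidean_space \<Rightarrow> 'c::euclidean_space \<Rightarrow> 'd::real_normed_vector"
  assumes "compact S" "\<And>x. x \<in> S \<Longrightarrow> bilinear (A x)" "\<And>v y. continuous_on S (\<lambda>x. A x v y)"
  shows "\<exists>C>0. \<forall>x\<in>S. \<forall>v y. norm (A x v y) \<le> C * norm v * norm y"
proof -
  have "\<exists>C. \<forall>x\<in>S. norm (A x b c) \<le> C" for b c
    using compact_imp_bounded[OF compact_continuous_image[OF assms(3,1)]]
    unfolding bounded_iff by (metis imageI)
  then obtain C where C: "\<And>x b c. x \<in> S \<Longrightarrow> norm (A x b c) \<le> C b c" by metis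
  \<comment> \<open>The summand 1 makes the constant strictly positive, so that it can be divided by
    when a radius is chosen.\<close>
  define C' where "C' = (\<Sum>b\<in>Basis. \<Sum>c\<in>Basis. \<bar>C b c\<bar>) + 1"
  have "norm (A x v y) \<le> C' * norm v * norm y" if "x \<in> S" for x v y
  proof -
    have "norm (A x v y) = norm (\<Sum>b\<in>Basis. \<Sum>c\<in>Basis. ((v \<bullet> b) * (y \<bullet> c)) *\<^sub>R A x b c)"
      using bilinear_basis[OF assms(2)[OF that], of v y] by (rule arg_cong)
    also have "\<dots> \<le> (\<Sum>b\<in>Basis. \<Sum>c\<in>Basis. norm (((v \<bullet> b) * (y \<bullet> c)) *\<^sub>R A x b c))"
      by (intro order_trans[OF norm_sum] sum_mono order_refl)
    also have "\<dots> \<le> (\<Sum>b\<in>Basis. \<Sum>c\<in>Basis. (norm v * norm y) * \<bar>C b c\<bar>)"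
    proof (intro sum_mono)
      fix b :: 'b and c :: 'c assume b: "b \<in> Basis" "c \<in> Basis"
      have "\<bar>v \<bullet> b\<bar> * \<bar>y \<bullet> c\<bar> * norm (A x b c) \<le> (norm v * norm y) * \<bar>C b c\<bar>"
        using Basis_le_norm[OF b(1), of v] Basis_le_norm[OF b(2), of y] C[OF that, of b c]
        by (intro mult_mono) auto
      then show "norm (((v \<bullet> b) * (y \<bullet> c)) *\<^sub>R A x b c) \<le> (norm v * norm y) * \<bar>C b c\<bar>"
        by (simp add: abs_mult)
    qed
    also have "\<dots> = (norm v * norm y) * (C' - 1)" by (simp add: C'_def sum_distrib_left)
    also have "\<dots> \<le> C' * norm v * norm y" by (simp add: algebra_simps)
    finally show ?thesis .
  qed
  moreover have "C' > 0" unfolding C'_def by (intro add_nonneg_pos sum_nonneg) auto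
  ultimately show ?thesis by blast
qed

section \<open>Flat linear systems of partial differential equations\<close>

lemma integral_norm_bound_unit:
  fixes f :: "real \<Rightarrow> 'b::euclidean_space"
  assumes "continuous_on {0..1} f" "\<And>s. s \<in> {0..1} \<Longrightarrow> norm (f s) \<le> B"
  shows "norm (integral {0..1} f) \<le> B"
  using integral_bound[of 0 1 f B] assms by auto

text \<open>Picard iterates along the rays from \<open>x0\<close>. Since \<open>A\<close> is flat, the defect
  \<open>D(P\<^sub>n\<^sub>+\<^sub>1)(v) - A(v) P\<^sub>n\<close> satisfies a contracting recursion, so the limit solves the system.\<close>

locale flat_linear_system =
  fixes A :: "'a::euclidean_space \<Rightarrow> 'a \<Rightarrow> 'b::euclidean_space \<Rightarrow> 'b"
    and S :: "'a set" and x0 :: 'a and r C :: real and y0 :: 'b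
  assumes bil: "\<And>x. x \<in> S \<Longrightarrow> bilinear (A x)"
    and sm: "\<And>v y. smooth_on S (\<lambda>x. A x v y)"
    and flat: "\<And>x v w y. x \<in> S \<Longrightarrow>
      fderiv (\<lambda>x. A x w y) x v + A x w (A x v y) =
      fderiv (\<lambda>x. A x v y) x w + A x v (A x w y)"
    and r: "r > 0" "ball x0 r \<subseteq> S"
    and C: "C > 0" "C * r \<le> 1 / 4"
    and bound: "\<And>x v y. x \<in> ball x0 r \<Longrightarrow> norm (A x v y) \<le> C * norm v * norm y"
begin

abbreviation "U \<equiv> ball x0 r"

definition ray :: "'a \<Rightarrow> real \<Rightarrow> 'a" where
  "ray x s = x0 + s *\<^sub>R (x - x0)"

text \<open>Starting at 0 and not at \<open>y0\<close> makes the initial iterate satisfy the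
  differential equation exactly, so the recursion for the defects starts at zero. The initial value
  is reached with \<open>P 1\<close>.\<close>

primrec P :: "nat \<Rightarrow> 'a \<Rightarrow> 'b" where
  "P 0 = (\<lambda>x. 0)"
| "P (Suc n) = (\<lambda>x. y0 + integral {0..1} (\<lambda>s. A (ray x s) (x - x0) (P n (ray x s))))"

lemma ray_in: "x \<in> U \<Longrightarrow> s \<in> {0..1} \<Longrightarrow> ray x s \<in> U"
proof -
  assume x: "x \<in> U" and s: "s \<in> {0..1}"
  have "dist x0 (ray x s) = s * norm (x - x0)" using s by (simp add: ray_def dist_norm)
  also have "\<dots> \<le> 1 * norm (x - x0)" using s by (intro mult_right_mono) auto
  also have "\<dots> < r" using x by (simp add: dist_norm norm_minus_commute)
  finally show ?thesis by simp
qed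

lemma ray_in_S: "x \<in> U \<Longrightarrow> s \<in> {0..1} \<Longrightarrow> ray x s \<in> S"
  using ray_in r by blast

text \<open>An open neighbourhood of \<open>U \<times> {0..1}\<close>: smoothness is defined on open
  sets, so the parameter of the ray must be allowed to leave the unit interval.\<close>

definition "W = {(x, s). x \<in> U \<and> ray x s \<in> U}"

lemma W: "smooth_on W (\<lambda>z. ray (fst z) (snd z))" "U \<times> {0..1} \<subseteq> W" "open W"
proof -
  have c: "continuous_on UNIV (\<lambda>z. ray (fst z) (snd z))"
    unfolding ray_def by (intro continuous_intros)
  have "W = fst -` U \<inter> (\<lambda>z. ray (fst z) (snd z)) -` U" by (auto simp: W_def)
  then show W: "open W"
    using open_Int[OF open_vimage[OF open_ball continuous_on_fst[OF continuous_on_id]] open_vimage[OF open_ball c]]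
    by simp
  show "smooth_on W (\<lambda>z. ray (fst z) (snd z))"
    unfolding ray_def
    by (intro smooth_on_add smooth_on_const W smooth_on_scaleR smooth_on_diff
        smooth_on_linear bounded_linear_fst bounded_linear_snd)
  show "U \<times> {0..1} \<subseteq> W" using ray_in by (auto simp: W_def)
qed

lemma smooth_integrand:
  assumes "smooth_on U p"
  shows "smooth_on W (\<lambda>z. A (ray (fst z) (snd z)) (fst z - x0) (p (ray (fst z) (snd z))))"
proof (rule smooth_on_bilinear_family[where T = S and A = A, OF bil sm _ W(1)])
  show "ray (fst z) (snd z) \<in> S" if "z \<in> W" for z
    using that r(2) by (auto simp: W_def)
  show "smooth_on W (\<lambda>z. fst z - x0)"
    by (intro smooth_on_diff smooth_on_const W smooth_on_linear bounded_linear_fst)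
  show "smooth_on W (\<lambda>z. p (ray (fst z) (snd z)))"
    by (rule smooth_on_compose[OF assms W(1)]) (auto simp: W_def)
qed

lemma smooth_P: "smooth_on U (P n)"
proof (induction n)
  case 0
  show ?case by (simp add: smooth_on_const)
next
  case (Suc n)
  show ?case
    using smooth_on_add[OF smooth_on_const[OF open_ball]
        smooth_on_integral_parameter[OF smooth_integrand[OF Suc] open_ball W(2)], of y0] by simp
qed

abbreviation DP :: "nat \<Rightarrow> 'a \<Rightarrow> 'a \<Rightarrow> 'b" where
  "DP n x \<equiv> fderiv (P n) x"

abbreviation DA :: "'a \<Rightarrow> 'a \<Rightarrow> 'a \<Rightarrow> 'b \<Rightarrow> 'b" where
  "DA x v w y \<equiv> fderiv (\<lambda>z. A z w y) x v"

lemma ray_derivatives: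
  "((\<lambda>x. ray x s) has_derivative (\<lambda>v. s *\<^sub>R v)) (at x)"
  "((\<lambda>s. ray x s) has_derivative (\<lambda>t. t *\<^sub>R (x - x0))) (at s)"
  unfolding ray_def by (auto intro!: derivative_eq_intros)

lemma DP_linear: "x \<in> U \<Longrightarrow> linear (DP n x)"
  by (rule linear_frechet_derivative[OF smooth_on_differentiable[OF smooth_P]])

lemma DA_linear: "x \<in> S \<Longrightarrow> linear (\<lambda>v. DA x v w y)"
  by (rule linear_frechet_derivative[OF smooth_on_differentiable[OF sm]])

lemma DP_has: "x \<in> U \<Longrightarrow> (P n has_derivative DP n x) (at x)"
  by (rule smooth_on_has_derivative[OF smooth_P])

lemma DP_ray: "((\<lambda>x. P n (ray x s)) has_derivative (\<lambda>v. s *\<^sub>R DP n (ray x s) v)) (at x)"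
  "((\<lambda>s. P n (ray x s)) has_derivative (\<lambda>t. t *\<^sub>R DP n (ray x s) (x - x0))) (at s)"
  if "x \<in> U" "s \<in> {0..1}"
proof -
  note l = linear_scale[OF DP_linear[OF ray_in[OF that]]]
  show "((\<lambda>x. P n (ray x s)) has_derivative (\<lambda>v. s *\<^sub>R DP n (ray x s) v)) (at x)"
    using diff_chain_at[OF ray_derivatives(1) DP_has[OF ray_in[OF that]]] by (simp add: o_def l)
  show "((\<lambda>s. P n (ray x s)) has_derivative (\<lambda>t. t *\<^sub>R DP n (ray x s) (x - x0))) (at s)"
    using diff_chain_at[OF ray_derivatives(2) DP_has[OF ray_in[OF that]]] by (simp add: o_def l)
qed

text \<open>The three terms differentiate the coefficients, the radial vector \<open>x - x0\<close>
  and the previous iterate. The factors \<open>s\<close> are the inner derivative of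
  \<open>ray x s\<close>.\<close>

lemma DP_Suc:
  assumes x: "x \<in> U"
  shows "(P (Suc n) has_derivative (\<lambda>v. integral {0..1} (\<lambda>s.
      s *\<^sub>R DA (ray x s) v (x - x0) (P n (ray x s)) + A (ray x s) v (P n (ray x s)) +
      s *\<^sub>R A (ray x s) (x - x0) (DP n (ray x s) v)))) (at x)"
proof -
  let ?F = "\<lambda>z. A (ray (fst z) (snd z)) (fst z - x0) (P n (ray (fst z) (snd z)))"
  have 1: "fderiv ?F (x, s) (v, 0) =
      s *\<^sub>R DA (ray x s) v (x - x0) (P n (ray x s)) + A (ray x s) v (P n (ray x s)) +
      s *\<^sub>R A (ray x s) (x - x0) (DP n (ray x s) v)" if s: "s \<in> {0..1}" for s v
  proof -
    note xs = ray_in_S[OF x s]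
    have pair: "((\<lambda>y. (y, s)) has_derivative (\<lambda>v. (v, 0))) (at x)"
      by (auto intro!: derivative_eq_intros)
    have "(x, s) \<in> W" using W(2) x s by auto
    then have "((\<lambda>y. ?F (y, s)) has_derivative (\<lambda>v. fderiv ?F (x, s) (v, 0))) (at x)"
      using diff_chain_at[OF pair smooth_on_has_derivative[OF smooth_integrand[OF smooth_P]]]
      by (simp add: o_def)
    moreover have "((\<lambda>y. ?F (y, s)) has_derivative (\<lambda>v. DA (ray x s) (s *\<^sub>R v) (x - x0) (P n (ray x s)) +
      A (ray x s) v (P n (ray x s)) + A (ray x s) (x - x0) (s *\<^sub>R DP n (ray x s) v))) (at x)"
      unfolding fst_conv snd_conv
      by (rule has_derivative_bilinear_family[OF bil sm xs ray_derivatives(1) _ DP_ray(1)[OF x s]])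
        (auto intro!: derivative_eq_intros)
    ultimately show ?thesis
      by (simp add: has_derivative_unique[of "\<lambda>y. ?F (y, s)"] linear_scale[OF DA_linear[OF xs]] bilinear_rmul[OF bil[OF xs]]
        has_derivative_unique fun_eq_iff) (metis (no_types, lifting) has_derivative_unique)
  qed
  have "((\<lambda>x. integral {0..1} (\<lambda>s. ?F (x, s))) has_derivative
    (\<lambda>v. integral {0..1} (\<lambda>s. fderiv ?F (x, s) (v, 0)))) (at x)"
    by (rule has_derivative_integral_parameter[OF smooth_integrand[OF smooth_P] open_ball W(2) x])
  then have "(P (Suc n) has_derivative
    (\<lambda>v. integral {0..1} (\<lambda>s. fderiv ?F (x, s) (v, 0)))) (at x)"
    by (auto intro!: derivative_eq_intros)
  moreover have "integral {0..1} (\<lambda>s. fderiv ?F (x, s) (v, 0)) =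
    integral {0..1} (\<lambda>s. s *\<^sub>R DA (ray x s) v (x - x0) (P n (ray x s)) + A (ray x s) v (P n (ray x s)) +
      s *\<^sub>R A (ray x s) (x - x0) (DP n (ray x s) v))" for v
    by (intro integral_cong 1)
  ultimately show ?thesis by simp
qed

text \<open>Fundamental theorem of calculus for
  \<open>s *\<^sub>R A (ray x s) v (P n (ray x s))\<close>, which vanishes at s = 0 and ends at
  \<open>A x v (P n x)\<close>. This writes the second half of the defect as an integral over the
  same ray, ready to be subtracted from \<open>DP_Suc\<close>.\<close>

lemma A_radial:
  assumes x: "x \<in> U"
  shows "((\<lambda>s. A (ray x s) v (P n (ray x s)) + s *\<^sub>R DA (ray x s) (x - x0) v (P n (ray x s)) +
      s *\<^sub>R A (ray x s) v (DP n (ray x s) (x - x0))) has_integral A x v (P n x)) {0..1}"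
proof -
  let ?k = "\<lambda>s. s *\<^sub>R A (ray x s) v (P n (ray x s))"
  have "(?k has_vector_derivative A (ray x s) v (P n (ray x s)) +
      s *\<^sub>R DA (ray x s) (x - x0) v (P n (ray x s)) +
      s *\<^sub>R A (ray x s) v (DP n (ray x s) (x - x0))) (at s within {0..1})"
    if s: "s \<in> {0..1}" for s
  proof -
    note xs = ray_in_S[OF x s]
    have "((\<lambda>s. A (ray x s) v (P n (ray x s))) has_derivative (\<lambda>t. DA (ray x s) (t *\<^sub>R (x - x0)) v (P n (ray x s)) +
      A (ray x s) 0 (P n (ray x s)) + A (ray x s) v (t *\<^sub>R DP n (ray x s) (x - x0)))) (at s)"
      by (rule has_derivative_bilinear_family[OF bil sm xs ray_derivatives(2) _ DP_ray(2)[OF x s]])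
        (auto intro!: derivative_eq_intros)
    then have "((\<lambda>s. A (ray x s) v (P n (ray x s))) has_vector_derivative
      DA (ray x s) (x - x0) v (P n (ray x s)) + A (ray x s) v (DP n (ray x s) (x - x0))) (at s)"
      by (simp add: has_vector_derivative_def linear_scale[OF DA_linear[OF xs]]
        bilinear_rmul[OF bil[OF xs]] bilinear_lzero[OF bil[OF xs]] scaleR_add_right)
    then have "(?k has_vector_derivative s *\<^sub>R (DA (ray x s) (x - x0) v (P n (ray x s)) +
       A (ray x s) v (DP n (ray x s) (x - x0))) + 1 *\<^sub>R A (ray x s) v (P n (ray x s))) (at s)"
      by (intro has_vector_derivative_scaleR) auto
    then show ?thesis
      using has_vector_derivative_at_within by (fastforce simp: algebra_simps)
  qed
  then have "((\<lambda>s. A (ray x s) v (P n (ray x s)) +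
      s *\<^sub>R DA (ray x s) (x - x0) v (P n (ray x s)) +
      s *\<^sub>R A (ray x s) v (DP n (ray x s) (x - x0))) has_integral ?k 1 - ?k 0) {0..1}"
    by (intro fundamental_theorem_of_calculus) auto
  then show ?thesis by (simp add: ray_def)
qed

lemma continuous_on_ray:
  assumes "smooth_on U f" "x \<in> U"
  shows "continuous_on {0..1} (\<lambda>s. f (ray x s))"
proof (rule continuous_on_compose2[OF smooth_on_continuous[OF assms(1)]])
  show "continuous_on {0..1} (ray x)" unfolding ray_def by (intro continuous_intros)
qed (use ray_in[OF assms(2)] in auto)

lemma smooth_A_U:
  assumes "smooth_on U f" "smooth_on U g" shows "smooth_on U (\<lambda>x. A x (f x) (g x))"
  by (rule smooth_on_bilinear_family[where f = "\<lambda>x. x", OF bil sm _ smooth_on_ident[OF open_ball] assms])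
    (use r in auto)

text \<open>Two defects of the equation DY = A Y. \<open>E\<close> compares consecutive iterates and
  is the one that has to tend to zero; \<open>e\<close> stays with one iterate and is what appears
  in the integral formula for \<open>E\<close>. They are linked by
  \<open>P (Suc n) - P n\<close>.\<close>

definition E :: "nat \<Rightarrow> 'a \<Rightarrow> 'a \<Rightarrow> 'b" where
  "E n x v = DP (Suc n) x v - A x v (P n x)"

definition e :: "nat \<Rightarrow> 'a \<Rightarrow> 'a \<Rightarrow> 'b" where
  "e n x v = DP n x v - A x v (P n x)"

text \<open>By the product rule this is the derivative of \<open>A x v (p x)\<close> minus the term
  that differentiates \<open>p\<close>, and both of these are smooth.\<close>

lemma smooth_DA_U: "smooth_on U p \<Longrightarrow> smooth_on U (\<lambda>x. DA x w v (p x))"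
proof -
  assume p: "smooth_on U p"
  have "fderiv (\<lambda>x. A x v (p x)) x w = DA x w v (p x) + A x v (fderiv p x w)"
    if x: "x \<in> U" for x
  proof -
    have xS: "x \<in> S" using x r by auto
    have "((\<lambda>x. A x v (p x)) has_derivative (\<lambda>w. DA x w v (p x) +
      A x 0 (p x) + A x v (fderiv p x w))) (at x)"
      by (rule has_derivative_bilinear_family[where f = "\<lambda>x. x", OF bil sm xS _ _ smooth_on_has_derivative[OF p x]])
        (auto intro!: derivative_eq_intros)
    then show ?thesis
      using frechet_derivative_eqI bilinear_lzero[OF bil[OF xS]] by fastforce
  qed
  note D = this
  have "smooth_on U (\<lambda>x. fderiv (\<lambda>x. A x v (p x)) x w - A x v (fderiv p x w))"
    by (intro smooth_on_diff smooth_A_U smooth_on_frechet_derivative smooth_on_const open_ball p)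
  then show ?thesis by (rule smooth_on_cong) (simp add: D)
qed

text \<open>\<open>A_radial\<close> is subtracted from \<open>DP_Suc\<close> under the integral.
  Flatness exchanges the two derivatives of \<open>A\<close> at the cost of products of the form A A
  P, and these are exactly what turns \<open>DP n\<close> into \<open>e n\<close>.\<close>

lemma E_integral:
  assumes x: "x \<in> U"
  shows "E n x v = integral {0..1} (\<lambda>s. s *\<^sub>R
    (A (ray x s) (x - x0) (e n (ray x s) v) - A (ray x s) v (e n (ray x s) (x - x0))))"
proof -
  let ?f = "\<lambda>s. s *\<^sub>R DA (ray x s) v (x - x0) (P n (ray x s)) + A (ray x s) v (P n (ray x s)) +
      s *\<^sub>R A (ray x s) (x - x0) (DP n (ray x s) v)"
  let ?g = "\<lambda>s. A (ray x s) v (P n (ray x s)) + s *\<^sub>R DA (ray x s) (x - x0) v (P n (ray x s)) +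
      s *\<^sub>R A (ray x s) v (DP n (ray x s) (x - x0))"
  have "continuous_on {0..1} ?f"
    by (intro continuous_on_add continuous_on_scaleR continuous_on_id
        continuous_on_ray[OF smooth_DA_U[OF smooth_P] x]
        continuous_on_ray[OF smooth_A_U[OF smooth_on_const[OF open_ball] smooth_P] x]
        continuous_on_ray[OF smooth_A_U[OF smooth_on_const[OF open_ball] smooth_on_frechet_derivative[OF smooth_P]] x])
  then have f: "?f integrable_on {0..1}" by (rule integrable_continuous_interval)
  have "DP (Suc n) x v = integral {0..1} ?f"
    using frechet_derivative_eqI[OF DP_Suc[OF x]] by metis
  then have "E n x v = integral {0..1} ?f - integral {0..1} ?g"
    unfolding E_def using integral_unique[OF A_radial[OF x]] by metis
  also have "\<dots> = integral {0..1} (\<lambda>s. ?f s - ?g s)"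
    using A_radial[OF x] by (intro integral_diff[symmetric] f) auto
  also have "\<dots> = integral {0..1} (\<lambda>s. s *\<^sub>R
    (A (ray x s) (x - x0) (e n (ray x s) v) - A (ray x s) v (e n (ray x s) (x - x0))))"
  proof (rule integral_cong)
    fix s :: real assume s: "s \<in> {0..1}"
    note xs = ray_in_S[OF x s]
    let ?z = "ray x s" let ?w = "x - x0" let ?p = "P n (ray x s)"
    have "DA ?z v ?w ?p + A ?z ?w (A ?z v ?p) = DA ?z ?w v ?p + A ?z v (A ?z ?w ?p)"
      by (rule flat[OF xs])
    then have D: "DA ?z v ?w ?p = DA ?z ?w v ?p + A ?z v (A ?z ?w ?p) - A ?z ?w (A ?z v ?p)"
      by (simp add: algebra_simps)
    show "?f s - ?g s = s *\<^sub>R (A ?z ?w (e n ?z v) - A ?z v (e n ?z ?w))"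
      unfolding D by (simp add: e_def bilinear_rsub[OF bil[OF xs]] algebra_simps)
  qed
  finally show ?thesis .
qed

text \<open>On \<open>U\<close> the coefficient in the radial direction has norm at most C r \<le>
  1/4, which is the contraction factor. The first difference is \<open>y0\<close>, since the
  iteration starts at 0.\<close>

lemma P_diff_bound: "x \<in> U \<Longrightarrow> norm (P (Suc n) x - P n x) \<le> norm y0 * (1 / 4) ^ n"
proof (induction n arbitrary: x)
  case 0
  have "integral {0..1} (\<lambda>s. A (ray x s) (x - x0) 0) = integral {0..1} (\<lambda>s::real. 0)"
    by (intro integral_cong bilinear_rzero bil ray_in_S[OF 0])
  then show ?case by simp
next
  case (Suc n)
  note x = Suc.prems
  let ?f = "\<lambda>m s. A (ray x s) (x - x0) (P m (ray x s))"
  have c: "continuous_on {0..1} (?f m)" for m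
    by (rule continuous_on_ray[OF smooth_A_U[OF smooth_on_const[OF open_ball] smooth_P] x])
  have "P (Suc (Suc n)) x - P (Suc n) x = integral {0..1} (?f (Suc n)) - integral {0..1} (?f n)"
    by simp
  also have "\<dots> = integral {0..1} (\<lambda>s. ?f (Suc n) s - ?f n s)"
    by (intro integral_diff[symmetric] integrable_continuous_interval c)
  finally have *: "P (Suc (Suc n)) x - P (Suc n) x = integral {0..1} (\<lambda>s. ?f (Suc n) s - ?f n s)" .
  show ?case
    unfolding *
  proof (rule integral_norm_bound_unit)
    show "continuous_on {0..1} (\<lambda>s. ?f (Suc n) s - ?f n s)"
      by (intro continuous_on_diff c)
    fix s :: real assume s: "s \<in> {0..1}"
    have "norm (?f (Suc n) s - ?f n s) = norm (A (ray x s) (x - x0) (P (Suc n) (ray x s) - P n (ray x s)))"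
      by (simp only: bilinear_rsub[OF bil[OF ray_in_S[OF x s]]])
    also have "\<dots> \<le> C * norm (x - x0) * norm (P (Suc n) (ray x s) - P n (ray x s))"
      by (rule bound[OF ray_in[OF x s]])
    also have "\<dots> \<le> (C * r) * (norm y0 * (1 / 4) ^ n)"
      using Suc.IH[OF ray_in[OF x s]] x C(1) r(1)
      by (intro mult_mono) (auto simp: dist_norm norm_minus_commute)
    also have "\<dots> \<le> (1 / 4) * (norm y0 * (1 / 4) ^ n)"
      using C by (intro mult_right_mono) auto
    finally show "norm (?f (Suc n) s - ?f n s) \<le> norm y0 * (1 / 4) ^ Suc n" by simp
  qed
qed

lemma E_radial: "x \<in> U \<Longrightarrow> E n x (x - x0) = 0"
  by (simp add: E_integral)

text \<open>The radial vector at \<open>ray x s\<close> is \<open>s\<close> times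
  \<open>x - x0\<close>. Keeping the factor \<open>s\<close> avoids dividing by it at s = 0, and the
  integrand of \<open>E_integral\<close> provides it.\<close>

lemma E_radial_ray:
  assumes "x \<in> U" "s \<in> {0..1}"
  shows "s *\<^sub>R E n (ray x s) (x - x0) = 0"
proof -
  note z = ray_in[OF assms]
  have "s *\<^sub>R E n (ray x s) (x - x0) = E n (ray x s) (s *\<^sub>R (x - x0))"
    unfolding E_def linear_scale[OF DP_linear[OF z]] bilinear_lmul[OF bil[OF ray_in_S[OF assms]]]
    by (simp only: scaleR_diff_right)
  also have "s *\<^sub>R (x - x0) = ray x s - x0" by (simp add: ray_def)
  finally show ?thesis using E_radial[OF z] by simp
qed

text \<open>In \<open>E_integral\<close> each \<open>e (Suc n)\<close> splits into
  \<open>E n\<close> and \<open>A\<close> applied to the difference of two iterates. The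
  \<open>E n\<close> in radial direction drops out by \<open>E_radial_ray\<close>, the other one is
  contracted by 1/4, and the differences are of order 4^-n. The constant 4 closes the induction:
  (1/4) 4 + 1/2 \<le> 4 (1/2).\<close>

lemma E_bound: "x \<in> U \<Longrightarrow> norm (E n x v) \<le> 4 * C * norm y0 * norm v * (1 / 2) ^ n"
proof (induction n arbitrary: x v)
  case 0
  have "e 0 z w = 0" if "z \<in> U" for z w
    using that bilinear_rzero[OF bil] r(2) by (auto simp: e_def)
  then have "integral {0..1} (\<lambda>s. s *\<^sub>R
    (A (ray x s) (x - x0) (e 0 (ray x s) v) - A (ray x s) v (e 0 (ray x s) (x - x0)))) = integral {0..1} (\<lambda>s::real. 0)"
    using ray_in[OF 0] bilinear_rzero[OF bil[OF ray_in_S[OF 0]]] by (intro integral_cong) simp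
  then show ?case using C(1) by (simp add: E_integral[OF 0])
next
  case (Suc n)
  note x = Suc.prems
  have e: "e (Suc n) z w = E n z w - A z w (P (Suc n) z - P n z)" if "z \<in> U" for z w
    using that r(2) bilinear_rsub[OF bil, of z] by (auto simp: e_def E_def simp del: P.simps)
  have se: "smooth_on U (\<lambda>z. e m z w)" for m w
    unfolding e_def
    by (intro smooth_on_diff smooth_on_frechet_derivative smooth_P smooth_A_U smooth_on_const open_ball)
  show ?case
    unfolding E_integral[OF x]
  proof (rule integral_norm_bound_unit)
    show "continuous_on {0..1} (\<lambda>s. s *\<^sub>R
      (A (ray x s) (x - x0) (e (Suc n) (ray x s) v) - A (ray x s) v (e (Suc n) (ray x s) (x - x0))))"
      by (intro continuous_on_scaleR continuous_on_id continuous_on_diff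
          continuous_on_ray[OF smooth_A_U[OF smooth_on_const[OF open_ball] se] x])
    fix s :: real assume s: "s \<in> {0..1}"
    let ?z = "ray x s" let ?w = "x - x0" let ?d = "P (Suc n) ?z - P n ?z"
    note z = ray_in[OF x s] note bz = bil[OF ray_in_S[OF x s]]
    have w: "norm ?w \<le> r" using x by (simp add: dist_norm norm_minus_commute)
    have d: "norm ?d \<le> norm y0 * (1 / 4) ^ n" by (rule P_diff_bound[OF z])
    have "C * norm ?w \<le> C * r" using w C(1) by simp
    then have Cw: "C * norm ?w \<le> 1 / 4" using C(2) by simp
    have A_w: "norm (A ?z ?w y) \<le> (1 / 4) * norm y" for y
      using order_trans[OF bound[OF z] mult_right_mono[OF Cw norm_ge_zero]] .
    have "s *\<^sub>R A ?z v (e (Suc n) ?z ?w) = A ?z v (s *\<^sub>R E n ?z ?w) - s *\<^sub>R A ?z v (A ?z ?w ?d)"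
      unfolding e[OF z] by (simp only: bilinear_rsub[OF bz] bilinear_rmul[OF bz] scaleR_diff_right)
    also have "\<dots> = - s *\<^sub>R A ?z v (A ?z ?w ?d)"
      unfolding E_radial_ray[OF x s] by (simp add: bilinear_rzero[OF bz])
    finally have *: "s *\<^sub>R (A ?z ?w (e (Suc n) ?z v) - A ?z v (e (Suc n) ?z ?w)) =
      s *\<^sub>R (A ?z ?w (E n ?z v) - A ?z ?w (A ?z v ?d) + A ?z v (A ?z ?w ?d))"
      unfolding scaleR_diff_right[of s "A ?z ?w _"] e[OF z] bilinear_rsub[OF bz] by (simp add: algebra_simps)
    have 1: "norm (A ?z ?w (E n ?z v)) \<le> C * norm y0 * norm v * (1 / 2) ^ n"
      using A_w[of "E n ?z v"] Suc.IH[OF z, of v] by simp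
    have dC: "C * norm v * norm ?d \<le> C * norm v * (norm y0 * (1 / 4) ^ n)"
      using d C(1) by (intro mult_left_mono) auto
    have 2: "norm (A ?z ?w (A ?z v ?d)) \<le> (1 / 4) * (C * norm v * (norm y0 * (1 / 4) ^ n))"
      using A_w[of "A ?z v ?d"] bound[OF z, of v ?d] dC by linarith
    have 3: "norm (A ?z v (A ?z ?w ?d)) \<le> (1 / 4) * (C * norm v * (norm y0 * (1 / 4) ^ n))"
    proof -
      have "norm (A ?z v (A ?z ?w ?d)) \<le> C * norm v * ((1 / 4) * norm ?d)"
        using order_trans[OF bound[OF z] mult_left_mono[OF A_w]] C(1) by simp
      then show ?thesis using dC by simp
    qed
    have p: "(1 / 4 :: real) ^ n \<le> (1 / 2) ^ n" by (intro power_mono) auto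
    have "norm (s *\<^sub>R (A ?z ?w (e (Suc n) ?z v) - A ?z v (e (Suc n) ?z ?w))) \<le>
      1 * norm (A ?z ?w (E n ?z v) - A ?z ?w (A ?z v ?d) + A ?z v (A ?z ?w ?d))"
      unfolding * norm_scaleR using s by (intro mult_right_mono) auto
    also have "\<dots> \<le> norm (A ?z ?w (E n ?z v)) + norm (A ?z ?w (A ?z v ?d)) + norm (A ?z v (A ?z ?w ?d))"
      using norm_triangle_ineq[of "A ?z ?w (E n ?z v) - A ?z ?w (A ?z v ?d)" "A ?z v (A ?z ?w ?d)"]
        norm_triangle_ineq4[of "A ?z ?w (E n ?z v)" "A ?z ?w (A ?z v ?d)"] by linarith
    also have "\<dots> \<le> C * norm y0 * norm v * (1 / 2) ^ n + (1 / 2) * (C * norm y0 * norm v) * (1 / 4) ^ n"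
      using 1 2 3 by (simp add: algebra_simps)
    also have "\<dots> \<le> C * norm y0 * norm v * (1 / 2) ^ n + (1 / 2) * (C * norm y0 * norm v) * (1 / 2) ^ n"
      using p C(1) by (intro add_left_mono mult_left_mono) auto
    also have "\<dots> \<le> 4 * C * norm y0 * norm v * (1 / 2) ^ Suc n"
      using C(1) by simp
    finally show "norm (s *\<^sub>R (A ?z ?w (e (Suc n) ?z v) - A ?z v (e (Suc n) ?z ?w)))
      \<le> 4 * C * norm y0 * norm v * (1 / 2) ^ Suc n" .
  qed
qed

definition Y :: "'a \<Rightarrow> 'b" where "Y x = (\<Sum>n. P (Suc n) x - P n x)"

lemma P_uniform: "uniform_limit U P Y sequentially"
proof -
  have "uniform_limit U (\<lambda>n x. \<Sum>i<n. P (Suc i) x - P i x) Y sequentially"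
    unfolding Y_def
    by (rule Weierstrass_m_test[OF P_diff_bound]) (auto intro!: summable_mult summable_geometric)
  \<comment> \<open>The sum telescopes, and its lower end \<open>P 0 x\<close> is zero.\<close>
  moreover have "(\<Sum>i<n. P (Suc i) x - P i x) = P n x" for n x
    using sum_lessThan_telescope[of "\<lambda>i. P i x" n] by (simp del: P.simps(2))
  ultimately show ?thesis by (simp del: P.simps(2))
qed

text \<open>\<open>DP (Suc n)\<close> differs from the claimed derivative by \<open>E n\<close> and
  by \<open>A\<close> applied to \<open>P n - Y\<close>. Both tend to zero uniformly on
  \<open>U\<close>, relative to the norm of the direction, so limit and derivative may be
  interchanged.\<close>

lemma Y_has_derivative: "x \<in> U \<Longrightarrow> (Y has_derivative (\<lambda>v. A x v (Y x))) (at x)"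
proof -
  assume x: "x \<in> U"
  have lim: "(\<lambda>n. P n z) \<longlonglongrightarrow> Y z" if "z \<in> U" for z
    using tendsto_uniform_limitI[OF P_uniform that] .
  have "\<exists>g. \<forall>z\<in>U. (\<lambda>n. P (Suc n) z) \<longlonglongrightarrow> g z \<and> (g has_derivative (\<lambda>v. A z v (Y z))) (at z within U)"
  proof (rule has_derivative_sequence[OF convex_ball])
    show "(P (Suc n) has_derivative DP (Suc n) z) (at z within U)" if "z \<in> U" for n z
      using DP_has[OF that] by (rule has_derivative_at_withinI)
    show "x0 \<in> U" "(\<lambda>n. P (Suc n) x0) \<longlonglongrightarrow> Y x0"
      using r(1) lim[of x0] LIMSEQ_Suc by (auto simp del: P.simps(2))
    fix \<epsilon> :: real assume \<epsilon>: "\<epsilon> > 0"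
    have "\<forall>\<^sub>F n in sequentially. \<forall>z\<in>U. dist (P n z) (Y z) < \<epsilon> / (2 * C)"
      using P_uniform \<epsilon> C(1) by (intro uniform_limitD) auto
    moreover have "(\<lambda>n. 4 * C * norm y0 * (1 / 2) ^ n) \<longlonglongrightarrow> 4 * C * norm y0 * 0"
      by (intro tendsto_mult tendsto_const LIMSEQ_realpow_zero) auto
    then have "\<forall>\<^sub>F n in sequentially. 4 * C * norm y0 * (1 / 2) ^ n < \<epsilon> / 2"
      using \<epsilon> by (intro order_tendstoD(2)) auto
    ultimately show "\<forall>\<^sub>F n in sequentially. \<forall>z\<in>U. \<forall>h. norm (DP (Suc n) z h - A z h (Y z)) \<le> \<epsilon> * norm h"
    proof eventually_elim
      case (elim n)
      show ?case
      proof (intro ballI allI)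
        fix z h assume z: "z \<in> U"
        have "DP (Suc n) z h - A z h (Y z) = E n z h + A z h (P n z - Y z)"
          using bilinear_rsub[OF bil, of z h "P n z" "Y z"] z r(2) by (auto simp: E_def simp del: P.simps(2))
        then have "norm (DP (Suc n) z h - A z h (Y z)) \<le> norm (E n z h) + norm (A z h (P n z - Y z))"
          using norm_triangle_ineq by metis
        also have "\<dots> \<le> 4 * C * norm y0 * norm h * (1 / 2) ^ n + C * norm h * norm (P n z - Y z)"
          by (intro add_mono E_bound bound z)
        also have "\<dots> = norm h * (4 * C * norm y0 * (1 / 2) ^ n + C * norm (P n z - Y z))"
          by (simp add: algebra_simps)
        also have "\<dots> \<le> norm h * (\<epsilon> / 2 + C * (\<epsilon> / (2 * C)))"
          using elim z C(1) by (intro mult_left_mono add_mono) (auto simp: dist_norm less_imp_le)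
        also have "\<dots> = \<epsilon> * norm h" using C(1) by simp
        finally show "norm (DP (Suc n) z h - A z h (Y z)) \<le> \<epsilon> * norm h" .
      qed
    qed
  qed
  then obtain g where g: "\<And>z. z \<in> U \<Longrightarrow> (\<lambda>n. P (Suc n) z) \<longlonglongrightarrow> g z"
    "\<And>z. z \<in> U \<Longrightarrow> (g has_derivative (\<lambda>v. A z v (Y z))) (at z within U)" by blast
  have "g z = Y z" if "z \<in> U" for z
    using LIMSEQ_unique[OF g(1)[OF that] LIMSEQ_Suc[OF lim[OF that]]] .
  moreover have "(g has_derivative (\<lambda>v. A x v (Y x))) (at x)"
    using g(2)[OF x] at_within_open[OF x open_ball] by simp
  ultimately show ?thesis
    using has_derivative_transform_within_open[OF _ open_ball x] by blast
qed

lemma Y_x0: "Y x0 = y0"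
proof -
  have "P (Suc n) x0 = y0" for n
  proof -
    have "integral {0..1} (\<lambda>s. A (ray x0 s) (x0 - x0) (P n (ray x0 s))) = integral {0..1} (\<lambda>s::real. 0)"
      using r by (intro integral_cong) (simp add: bilinear_lzero[OF bil[OF ray_in_S]])
    then show ?thesis by simp
  qed
  moreover have "(\<lambda>n. P (Suc n) x0) \<longlonglongrightarrow> Y x0"
    using LIMSEQ_Suc[OF tendsto_uniform_limitI[OF P_uniform, of x0]] r(1) by simp
  ultimately show ?thesis by (simp add: LIMSEQ_const_iff del: P.simps)
qed

text \<open>Bootstrapping: the derivative \<open>A x v (Y x)\<close> is of class C^k as soon as
  \<open>Y\<close> is.\<close>

lemma Y_smooth: "smooth_on U Y"
proof -
  have D: "fderiv Y x v = A x v (Y x)" if "x \<in> U" for x v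
    using frechet_derivative_eqI[OF Y_has_derivative[OF that]] by simp
  have "Ck_on k U Y" for k
  proof (induction k)
    case 0
    show ?case
      using has_derivative_continuous[OF Y_has_derivative] by (simp add: continuous_at_imp_continuous_on)
  next
    case (Suc k)
    have "Ck_on k U (\<lambda>x. A x v (Y x))" for v
    proof (rule Ck_on_cong[OF open_ball])
      have "Ck_on k U (\<lambda>x. A x b c)" for b c
        using sm r(2) by (meson Ck_on_subset smooth_on_def)
      then show "Ck_on k U (\<lambda>x. \<Sum>b\<in>Basis. \<Sum>c\<in>Basis. ((v \<bullet> b) * (Y x \<bullet> c)) *\<^sub>R A x b c)"
        by (intro Ck_on_sum open_ball Ck_on_bilinear[OF _ bounded_bilinear_scaleR]
            Ck_on_bilinear[OF _ bounded_bilinear_mult] Ck_on_const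
            Ck_on_bounded_linear[OF _ bounded_linear_inner_left] Suc)
      show "(\<Sum>b\<in>Basis. \<Sum>c\<in>Basis. ((v \<bullet> b) * (Y x \<bullet> c)) *\<^sub>R A x b c) = A x v (Y x)"
        if "x \<in> U" for x
        by (rule bilinear_basis[OF bil, symmetric]) (use that r in auto)
    qed
    then have "Ck_on k U (\<lambda>x. fderiv Y x v)" for v
      by (rule Ck_on_cong[OF open_ball, rotated]) (simp add: D)
    then show ?case using Derivative.differentiableI[OF Y_has_derivative] by simp
  qed
  then show ?thesis by (simp add: smooth_on_def)
qed

end

text \<open>\<open>flat\<close> equates the two mixed second derivatives that a solution with the
  value \<open>y\<close> at \<open>x\<close> must have. The bound on \<open>A\<close> is taken on a
  compact ball first; the radius is shrunk afterwards, which keeps the bound and makes C r \<le>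
  1/4.\<close>

theorem linear_frobenius:
  fixes A :: "'a::euclidean_space \<Rightarrow> 'a \<Rightarrow> 'b::euclidean_space \<Rightarrow> 'b"
  assumes "x0 \<in> S"
    and bil: "\<And>x. x \<in> S \<Longrightarrow> bilinear (A x)"
    and sm: "\<And>v y. smooth_on S (\<lambda>x. A x v y)"
    and flat: "\<And>x v w y. x \<in> S \<Longrightarrow>
      fderiv (\<lambda>x. A x w y) x v + A x w (A x v y) =
      fderiv (\<lambda>x. A x v y) x w + A x v (A x w y)"
  obtains r Y where "r > 0" "ball x0 r \<subseteq> S" "smooth_on (ball x0 r) Y" "Y x0 = y0"
    "\<And>x. x \<in> ball x0 r \<Longrightarrow> (Y has_derivative (\<lambda>v. A x v (Y x))) (at x)"
proof -
  obtain R where R: "R > 0" "cball x0 R \<subseteq> S"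
    using smooth_on_open[OF sm] assms(1) open_contains_cball by blast
  obtain C where C: "C > 0" "\<And>x v y. x \<in> cball x0 R \<Longrightarrow> norm (A x v y) \<le> C * norm v * norm y"
    using bilinear_family_bound[OF compact_cball[of x0 R], of A] bil R(2)
      continuous_on_subset[OF smooth_on_continuous[OF sm] R(2)] by (meson subsetD)
  define r where "r = min R (1 / (4 * C))"
  have "C * r \<le> C * (1 / (4 * C))" using C(1) unfolding r_def by (intro mult_left_mono) auto
  then interpret flat_linear_system A S x0 r C y0
    using C R by unfold_locales (auto simp: bil sm flat r_def)
  show ?thesis using that r Y_smooth Y_x0 Y_has_derivative by blast
qed

section \<open>Curvature in an orthonormal frame\<close>

text \<open>The derivative along the vector field \<open>X\<close>. Applied to a vector field
  \<open>Y\<close> in the same coordinates it is not invariant, but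
  \<open>der X Y x - der Y X x\<close> is the Lie bracket [X, Y].\<close>

definition der :: "('e::euclidean_space \<Rightarrow> 'e) \<Rightarrow> ('e \<Rightarrow> 'b::real_normed_vector) \<Rightarrow> 'e \<Rightarrow> 'b" where
  "der X f x = fderiv f x (X x)"

lemma der_eqI: "(f has_derivative f') (at x) \<Longrightarrow> der X f x = f' (X x)"
  by (simp add: der_def frechet_derivative_eqI)

lemma der_cong:
  assumes "open S" "x \<in> S" "\<And>y. y \<in> S \<Longrightarrow> f y = g y"
  shows "der X f x = der X g x"
  unfolding der_def using frechet_derivative_eq_on_open[OF assms] by simp

lemma smooth_on_der:
  assumes "smooth_on S X" "smooth_on S f"
  shows "smooth_on S (der X f)"
proof (rule smooth_on_cong)
  show "smooth_on S (\<lambda>x. \<Sum>b\<in>Basis. (X x \<bullet> b) *\<^sub>R fderiv f x b)"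
    using smooth_on_open[OF assms(1)]
    by (intro smooth_on_sum smooth_on_scaleR smooth_on_frechet_derivative assms
        smooth_on_bounded_linear[OF bounded_linear_inner_left])
qed (simp add: der_def frechet_derivative_Basis[OF smooth_on_differentiable[OF assms(2)], symmetric])

lemma der_const: "der X (\<lambda>x. c) x = 0"
  by (simp add: der_def)

lemma der_add:
  "f differentiable (at x) \<Longrightarrow> g differentiable (at x) \<Longrightarrow>
    der X (\<lambda>x. f x + g x) x = der X f x + der X g x"
  by (rule trans[OF der_eqI[OF has_derivative_add[OF frechet_derivative_has frechet_derivative_has]]])
    (auto simp: der_def)

lemma der_diff:
  "f differentiable (at x) \<Longrightarrow> g differentiable (at x) \<Longrightarrow>
    der X (\<lambda>x. f x - g x) x = der X f x - der X g x"
  by (rule trans[OF der_eqI[OF has_derivative_diff[OF frechet_derivative_has frechet_derivative_has]]])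
    (auto simp: der_def)

lemma der_minus: "f differentiable (at x) \<Longrightarrow> der X (\<lambda>x. - f x) x = - der X f x"
  by (rule trans[OF der_eqI[OF has_derivative_minus[OF frechet_derivative_has]]]) (auto simp: der_def)

lemma der_scaleR:
  "f differentiable (at x) \<Longrightarrow> g differentiable (at x) \<Longrightarrow>
    der X (\<lambda>x. f x *\<^sub>R g x) x = der X f x *\<^sub>R g x + f x *\<^sub>R der X g x"
  by (rule trans[OF der_eqI[OF has_derivative_scaleR[OF frechet_derivative_has frechet_derivative_has]]])
    (auto simp: der_def)

lemma der_mult:
  fixes f g :: "_ \<Rightarrow> real"
  shows "f differentiable (at x) \<Longrightarrow> g differentiable (at x) \<Longrightarrow>
    der X (\<lambda>x. f x * g x) x = der X f x * g x + f x * der X g x"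
  using der_scaleR[of f x g X] by simp

lemma der_sum:
  "(\<And>i. i \<in> I \<Longrightarrow> f i differentiable (at x)) \<Longrightarrow>
    der X (\<lambda>x. \<Sum>i\<in>I. f i x) x = (\<Sum>i\<in>I. der X (f i) x)"
  by (rule trans[OF der_eqI[OF has_derivative_sum[OF frechet_derivative_has]]]) (auto simp: der_def)

lemma der_compose:
  assumes "g differentiable (at x)" "f differentiable (at (g x))"
  shows "der X (\<lambda>x. f (g x)) x = fderiv f (g x) (der X g x)"
proof -
  have "(f \<circ> g has_derivative fderiv f (g x) \<circ> fderiv g x) (at x)"
    by (rule diff_chain_at[OF frechet_derivative_has[OF assms(1)] frechet_derivative_has[OF assms(2)]])
  then show ?thesis using der_eqI[of "f \<circ> g"] by (simp add: o_def der_def)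
qed

lemma der_der:
  assumes "smooth_on S X" "smooth_on S Y" "smooth_on S f" "x \<in> S"
  shows "der X (der Y f) x = fderiv f x (der X Y x) +
    fderiv (\<lambda>y. fderiv f y (Y x)) x (X x)"
proof -
  have S: "open S" using assms(1) by (rule smooth_on_open)
  have Y: "Y differentiable (at x)" by (rule smooth_on_differentiable[OF assms(2,4)])
  have f: "(\<lambda>y. fderiv f y b) differentiable (at x)" for b
    by (rule smooth_on_differentiable[OF smooth_on_frechet_derivative[OF assms(3)] assms(4)])
  have Yb: "(\<lambda>x. Y x \<bullet> b) differentiable (at x)" for b
    by (rule smooth_on_differentiable[OF smooth_on_bounded_linear[OF bounded_linear_inner_left assms(2)] assms(4)])
  have dYb: "der X (\<lambda>x. Y x \<bullet> b) x = der X Y x \<bullet> b" for b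
    unfolding der_def by (rule frechet_derivative_bounded_linear[OF bounded_linear_inner_left Y])
  have "der X (der Y f) x = der X (\<lambda>x. \<Sum>b\<in>Basis. (Y x \<bullet> b) *\<^sub>R fderiv f x b) x"
    using frechet_derivative_Basis[OF smooth_on_differentiable[OF assms(3)]]
    by (intro der_cong[OF S assms(4)]) (simp add: der_def)
  also have "\<dots> = (\<Sum>b\<in>Basis. der X (\<lambda>x. (Y x \<bullet> b) *\<^sub>R fderiv f x b) x)"
    using Yb f by (intro der_sum) simp
  also have "\<dots> = (\<Sum>b\<in>Basis. (der X Y x \<bullet> b) *\<^sub>R fderiv f x b) +
    (\<Sum>b\<in>Basis. (Y x \<bullet> b) *\<^sub>R der X (\<lambda>x. fderiv f x b) x)"
    by (simp add: der_scaleR[OF Yb f] dYb sum.distrib)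
  also have "(\<Sum>b\<in>Basis. (der X Y x \<bullet> b) *\<^sub>R fderiv f x b) = fderiv f x (der X Y x)"
    by (rule frechet_derivative_Basis[OF smooth_on_differentiable[OF assms(3,4)], symmetric])
  also have "(\<Sum>b\<in>Basis. (Y x \<bullet> b) *\<^sub>R der X (\<lambda>x. fderiv f x b) x) =
      der X (\<lambda>y. \<Sum>b\<in>Basis. (Y x \<bullet> b) *\<^sub>R fderiv f y b) x"
    using f by (simp add: der_sum der_scaleR der_const)
  also have "\<dots> = der X (\<lambda>y. fderiv f y (Y x)) x"
    using frechet_derivative_Basis[OF smooth_on_differentiable[OF assms(3)]]
    by (intro der_cong[OF S assms(4)]) simp
  finally show ?thesis by (simp add: der_def[of X "\<lambda>y. fderiv f y (Y x)"])
qed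

text \<open>The second derivatives cancel by symmetry. Vector-valued \<open>f\<close> are allowed on
  purpose: with a coordinate change or a projection for \<open>f\<close> this says that brackets of
  related fields are related.\<close>

lemma der_commute:
  fixes f :: "'e::euclidean_space \<Rightarrow> 'b::euclidean_space"
  assumes "smooth_on S X" "smooth_on S Y" "smooth_on S f" "x \<in> S"
  shows "der X (der Y f) x - der Y (der X f) x = fderiv f x (der X Y x - der Y X x)"
  unfolding der_der[OF assms] der_der[OF assms(2,1,3,4)]
    frechet_derivative_symmetric[OF assms(3,4), of "Y x" "X x"]
  using linear_diff[OF linear_frechet_derivative[OF smooth_on_differentiable[OF assms(3,4)]]] by simp

section \<open>Levi-Civita connection and curvature in coordinates\<close>

definition chr :: "('e::euclidean_space \<Rightarrow> 'e \<Rightarrow> 'e \<Rightarrow> real) \<Rightarrow> 'e \<Rightarrow> 'e \<Rightarrow> 'e \<Rightarrow> 'e" where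
  "chr G x u v = (THE w. \<forall>z. 2 * G x w z =
     fderiv (\<lambda>y. G y v z) x u + fderiv (\<lambda>y. G y u z) x v -
     fderiv (\<lambda>y. G y u v) x z)"

definition cov :: "('e::euclidean_space \<Rightarrow> 'e \<Rightarrow> 'e \<Rightarrow> real) \<Rightarrow> ('e \<Rightarrow> 'e) \<Rightarrow> ('e \<Rightarrow> 'e) \<Rightarrow> 'e \<Rightarrow> 'e" where
  "cov G X Y x = der X Y x + chr G x (X x) (Y x)"

text \<open>For constant fields both covariant derivatives in \<open>riemann\<close> are expressible
  by \<open>chr\<close>; \<open>riemann_chart\<close> identifies the two notions.\<close>

definition riem :: "('e::euclidean_space \<Rightarrow> 'e \<Rightarrow> 'e \<Rightarrow> real) \<Rightarrow> 'e \<Rightarrow> 'e \<Rightarrow> 'e \<Rightarrow> 'e \<Rightarrow> 'e" where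
  "riem G x u v w = fderiv (\<lambda>y. chr G y v w) x u + chr G x u (chr G x v w) -
     (fderiv (\<lambda>y. chr G y u w) x v + chr G x v (chr G x u w))"

lemma frechet_derivative_add:
  fixes f g :: "'e::euclidean_space \<Rightarrow> 'b::real_normed_vector"
  shows
  "f differentiable (at x) \<Longrightarrow> g differentiable (at x) \<Longrightarrow>
    fderiv (\<lambda>x. f x + g x) x v = fderiv f x v + fderiv g x v"
  using der_add[of f x g "\<lambda>_. v"] by (simp add: der_def)

lemma frechet_derivative_scaleR_right:
  fixes f :: "'e::euclidean_space \<Rightarrow> 'b::real_normed_vector"
  shows
  "f differentiable (at x) \<Longrightarrow>
    fderiv (\<lambda>x. c *\<^sub>R f x) x v = c *\<^sub>R fderiv f x v"
  using der_scaleR[of "\<lambda>_. c" x f "\<lambda>_. v"] by (simp add: der_def)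

lemma bilinear_frechet_derivative:
  assumes "open S" "x \<in> S" and bil: "\<And>x. x \<in> S \<Longrightarrow> bilinear (B x)" and "\<And>v w. smooth_on S (\<lambda>x. B x v w)"
  shows "bilinear (\<lambda>v w. fderiv (\<lambda>x. B x v w) x u)"
proof -
  note d = smooth_on_differentiable[OF assms(4,2)]
  note c = frechet_derivative_eq_on_open[OF assms(1,2)]
  have 1: "fderiv (\<lambda>x. B x (v + v') w) x = fderiv (\<lambda>x. B x v w + B x v' w) x"
    and 2: "fderiv (\<lambda>x. B x v (w + w')) x = fderiv (\<lambda>x. B x v w + B x v w') x"
    and 3: "fderiv (\<lambda>x. B x (k *\<^sub>R v) w) x = fderiv (\<lambda>x. k *\<^sub>R B x v w) x"
    and 4: "fderiv (\<lambda>x. B x v (k *\<^sub>R w)) x = fderiv (\<lambda>x. k *\<^sub>R B x v w) x"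
    for v v' w w' k
    by (rule c, simp add: bilinear_ladd[OF bil] bilinear_radd[OF bil] bilinear_lmul[OF bil] bilinear_rmul[OF bil])+
  show ?thesis
    unfolding bilinear_def
    by (intro conjI allI linearI)
      (simp_all only: 1 2 3 4 frechet_derivative_add[OF d d] frechet_derivative_scaleR_right[OF d])
qed

text \<open>Completeness is stated as the expansion \<open>span\<close>, which also yields that
  \<open>G\<close> is positive definite: \<open>G x u u\<close> becomes the sum of the squares of
  the coefficients. The index type is arbitrary, so the locale serves the base and the total
  space.\<close>

locale orthonormal_frame =
  fixes V :: "'e::euclidean_space set" and G :: "'e \<Rightarrow> 'e \<Rightarrow> 'e \<Rightarrow> real"
    and E :: "'i::finite \<Rightarrow> 'e \<Rightarrow> 'e"
  assumes open_V: "open V"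
    and bil: "\<And>x. x \<in> V \<Longrightarrow> bilinear (G x)"
    and sym: "\<And>x u v. x \<in> V \<Longrightarrow> G x u v = G x v u"
    and smooth_G: "\<And>u v. smooth_on V (\<lambda>x. G x u v)"
    and smooth_E: "\<And>i. smooth_on V (E i)"
    and orth: "\<And>x i j. x \<in> V \<Longrightarrow> G x (E i x) (E j x) = of_bool (i = j)"
    and span: "\<And>x u. x \<in> V \<Longrightarrow> (\<Sum>i\<in>UNIV. G x u (E i x) *\<^sub>R E i x) = u"
begin

lemma G_sum_left: "x \<in> V \<Longrightarrow> G x (\<Sum>i\<in>I. f i *\<^sub>R e i) z = (\<Sum>i\<in>I. f i * G x (e i) z)"
proof -
  assume x: "x \<in> V"
  interpret linear "\<lambda>u. G x u z" using bil[OF x] by (simp add: bilinear_def)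
  show ?thesis by (simp add: sum scale)
qed

lemma G_frame_sum: "x \<in> V \<Longrightarrow> G x (\<Sum>i\<in>UNIV. f i *\<^sub>R E i x) (E j x) = f j"
  by (simp add: G_sum_left orth)

lemma frame_eqI:
  assumes "x \<in> V" "\<And>i. G x u (E i x) = G x v (E i x)"
  shows "u = v"
proof -
  have "(\<Sum>i\<in>UNIV. G x u (E i x) *\<^sub>R E i x) = (\<Sum>i\<in>UNIV. G x v (E i x) *\<^sub>R E i x)"
    by (simp only: assms(2))
  then show ?thesis by (simp only: span[OF assms(1)])
qed

definition koszul :: "'e \<Rightarrow> 'e \<Rightarrow> 'e \<Rightarrow> 'e \<Rightarrow> real" where
  "koszul x u v z = fderiv (\<lambda>y. G y v z) x u +
     fderiv (\<lambda>y. G y u z) x v - fderiv (\<lambda>y. G y u v) x z"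

lemma linear_DG: "x \<in> V \<Longrightarrow> linear (fderiv (\<lambda>y. G y u v) x)"
  by (rule linear_frechet_derivative[OF smooth_on_differentiable[OF smooth_G]])

lemma bilinear_DG: "x \<in> V \<Longrightarrow> bilinear (\<lambda>v w. fderiv (\<lambda>y. G y v w) x u)"
  by (rule bilinear_frechet_derivative[OF open_V _ bil smooth_G])

text \<open>The Koszul expression is linear in its last argument, so an orthonormal frame represents
  it by a unique vector. This resolves the \<open>THE\<close> in \<open>chr\<close>.\<close>

lemma chr_eq:
  assumes x: "x \<in> V"
  shows "chr G x u v = (\<Sum>i\<in>UNIV. (koszul x u v (E i x) / 2) *\<^sub>R E i x)"
proof -
  let ?w = "\<Sum>i\<in>UNIV. (koszul x u v (E i x) / 2) *\<^sub>R E i x"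
  note b = bilinear_radd[OF bilinear_DG[OF x]] bilinear_rmul[OF bilinear_DG[OF x]]
    linear_add[OF linear_DG[OF x]] linear_scale[OF linear_DG[OF x]]
  have lin: "linear (koszul x u v)"
    by (rule linearI) (simp_all add: koszul_def b algebra_simps)
  have "2 * G x ?w z = koszul x u v z" for z
  proof -
    have "koszul x u v z = koszul x u v (\<Sum>i\<in>UNIV. G x z (E i x) *\<^sub>R E i x)" using span[OF x] by simp
    also have "\<dots> = (\<Sum>i\<in>UNIV. G x z (E i x) * koszul x u v (E i x))"
      by (simp add: linear_sum[OF lin] linear_scale[OF lin])
    also have "\<dots> = 2 * G x ?w z"
      by (simp add: G_sum_left[OF x] sum_distrib_left sym[OF x, of z] mult.commute)
    finally show ?thesis by simp
  qed
  moreover have "w = ?w" if "\<forall>z. 2 * G x w z = koszul x u v z" for w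
    using that calculation by (intro frame_eqI[OF x]) (metis mult_left_cancel zero_neq_numeral)
  ultimately show ?thesis
    unfolding chr_def by (fold koszul_def) (rule the_equality, auto)
qed

lemma G_chr:
  assumes x: "x \<in> V"
  shows "2 * G x (chr G x u v) z = koszul x u v z"
proof -
  note b = bilinear_radd[OF bilinear_DG[OF x]] bilinear_rmul[OF bilinear_DG[OF x]]
    linear_add[OF linear_DG[OF x]] linear_scale[OF linear_DG[OF x]]
  have lin: "linear (koszul x u v)"
    by (rule linearI) (simp_all add: koszul_def b algebra_simps)
  have "koszul x u v z = koszul x u v (\<Sum>i\<in>UNIV. G x z (E i x) *\<^sub>R E i x)" using span[OF x] by simp
  also have "\<dots> = (\<Sum>i\<in>UNIV. G x z (E i x) * koszul x u v (E i x))"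
    by (simp add: linear_sum[OF lin] linear_scale[OF lin])
  also have "\<dots> = 2 * G x (chr G x u v) z"
    by (simp add: chr_eq[OF x] G_sum_left[OF x] sum_distrib_left sym[OF x, of z] mult.commute)
  finally show ?thesis by simp
qed

lemma koszul_sym: "x \<in> V \<Longrightarrow> koszul x u v z = koszul x v u z"
proof -
  assume x: "x \<in> V"
  have "fderiv (\<lambda>y. G y u v) x = fderiv (\<lambda>y. G y v u) x"
    by (rule frechet_derivative_eq_on_open[OF open_V x sym])
  then show ?thesis by (simp add: koszul_def)
qed

lemma chr_sym: "x \<in> V \<Longrightarrow> chr G x u v = chr G x v u"
  by (simp add: chr_eq koszul_sym[of x u v])

lemma bilinear_koszul: "x \<in> V \<Longrightarrow> bilinear (\<lambda>u v. koszul x u v z)"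
proof -
  assume x: "x \<in> V"
  note b = bilinear_ladd[OF bilinear_DG[OF x]] bilinear_lmul[OF bilinear_DG[OF x]]
    bilinear_radd[OF bilinear_DG[OF x]] bilinear_rmul[OF bilinear_DG[OF x]]
    linear_add[OF linear_DG[OF x]] linear_scale[OF linear_DG[OF x]]
  show ?thesis
    unfolding bilinear_def by (intro conjI allI linearI) (simp_all add: koszul_def b algebra_simps)
qed

lemma bilinear_chr: "x \<in> V \<Longrightarrow> bilinear (chr G x)"
proof -
  assume x: "x \<in> V"
  note b = bilinear_ladd[OF bilinear_koszul[OF x]] bilinear_lmul[OF bilinear_koszul[OF x]]
    bilinear_radd[OF bilinear_koszul[OF x]] bilinear_rmul[OF bilinear_koszul[OF x]]
  show ?thesis
    unfolding bilinear_def by (intro conjI allI linearI)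
      (simp_all add: chr_eq[OF x] b scaleR_sum_right add_divide_distrib scaleR_add_left sum.distrib)
qed

lemma smooth_G_fields: "smooth_on V X \<Longrightarrow> smooth_on V Y \<Longrightarrow> smooth_on V (\<lambda>x. G x (X x) (Y x))"
  by (rule smooth_on_bilinear_family[where f = "\<lambda>x. x", OF bil smooth_G _ smooth_on_ident[OF open_V]])

lemma smooth_chr: "smooth_on V (\<lambda>x. chr G x u v)"
proof (rule smooth_on_cong)
  have DG: "smooth_on V (\<lambda>x. fderiv (\<lambda>y. G y v (E i x)) x u)" for u v i
    by (rule smooth_on_bilinear_family[where f = "\<lambda>x. x" and g = "\<lambda>_. v"
          and A = "\<lambda>x v w. fderiv (\<lambda>y. G y v w) x u",
          OF bilinear_DG smooth_on_frechet_derivative[OF smooth_G] _ smooth_on_ident[OF open_V]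
            smooth_on_const[OF open_V] smooth_E])
  show "smooth_on V (\<lambda>x. \<Sum>i\<in>UNIV. (koszul x u v (E i x) / 2) *\<^sub>R E i x)"
    unfolding koszul_def
    by (intro smooth_on_sum open_V smooth_on_scaleR smooth_E smooth_on_bounded_linear[OF bounded_linear_divide]
       smooth_on_add smooth_on_diff DG smooth_on_der[OF smooth_E smooth_G, unfolded der_def])
qed (simp add: chr_eq)

lemma smooth_chr_fields:
  "smooth_on V X \<Longrightarrow> smooth_on V Y \<Longrightarrow> smooth_on V (\<lambda>x. chr G x (X x) (Y x))"
  by (rule smooth_on_bilinear_family[where f = "\<lambda>x. x", OF bilinear_chr smooth_chr _ smooth_on_ident[OF open_V]])

text \<open>The connection is metric: in the sum of the Koszul expressions for (X, Y; Z) and (X, Z;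
  Y) all terms cancel except the derivative of \<open>G\<close> along \<open>X\<close>, which occurs
  twice.\<close>

lemma der_G:
  assumes x: "x \<in> V" and Y: "smooth_on V Y" and Z: "smooth_on V Z"
  shows "der X (\<lambda>x. G x (Y x) (Z x)) x = G x (cov G X Y x) (Z x) + G x (Y x) (cov G X Z x)"
proof -
  have "der X (\<lambda>x. G x (Y x) (Z x)) x = fderiv (\<lambda>y. G y (Y x) (Z x)) x (X x) +
     G x (der X Y x) (Z x) + G x (Y x) (der X Z x)"
    unfolding der_def[of X Y] der_def[of X Z]
    by (rule der_eqI, rule has_derivative_bilinear_family[where f = "\<lambda>x. x", OF bil smooth_G x
        has_derivative_ident smooth_on_has_derivative[OF Y x] smooth_on_has_derivative[OF Z x]])
  moreover have "fderiv (\<lambda>y. G y (Y x) (Z x)) x (X x) =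
      G x (chr G x (X x) (Y x)) (Z x) + G x (chr G x (X x) (Z x)) (Y x)"
  proof -
    have "fderiv (\<lambda>y. G y (Z x) (Y x)) x = fderiv (\<lambda>y. G y (Y x) (Z x)) x"
      by (rule frechet_derivative_eq_on_open[OF open_V x sym])
    then show ?thesis
      using G_chr[OF x, of "X x" "Y x" "Z x"] G_chr[OF x, of "X x" "Z x" "Y x"]
      by (simp add: koszul_def)
  qed
  ultimately show ?thesis
    by (simp add: cov_def bilinear_ladd[OF bil[OF x]] bilinear_radd[OF bil[OF x]] sym[OF x, of "Y x"])
qed

text \<open>Structure functions of the frame. The \<open>gam\<close> that follow are its connection
  coefficients; their formula is Koszul's, in which the derivatives of the inner products vanish
  because the frame is orthonormal.\<close>

definition str :: "'i \<Rightarrow> 'i \<Rightarrow> 'i \<Rightarrow> 'e \<Rightarrow> real" where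
  "str i j k x = G x (der (E i) (E j) x - der (E j) (E i) x) (E k x)"

definition gam :: "'i \<Rightarrow> 'i \<Rightarrow> 'i \<Rightarrow> 'e \<Rightarrow> real" where
  "gam i j k x = (str i j k x - str j k i x + str k i j x) / 2"

lemma smooth_str: "smooth_on V (str i j k)"
  unfolding str_def by (intro smooth_G_fields smooth_on_diff smooth_on_der smooth_E)

lemma smooth_gam: "smooth_on V (gam i j k)"
  unfolding gam_def
  by (intro smooth_on_bounded_linear[OF bounded_linear_divide] smooth_on_diff smooth_on_add smooth_str)

lemma bracket_frame:
  "x \<in> V \<Longrightarrow> der (E i) (E j) x - der (E j) (E i) x = (\<Sum>k\<in>UNIV. str i j k x *\<^sub>R E k x)"
  by (simp add: str_def span)

text \<open>\<open>anti\<close> expresses that the connection is metric and \<open>tor\<close> that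
  it is torsion free. These two identities determine the coefficients, by the usual permutation of
  the three indices.\<close>

lemma cov_frame:
  assumes x: "x \<in> V"
  shows "cov G (E i) (E j) x = (\<Sum>k\<in>UNIV. gam i j k x *\<^sub>R E k x)"
proof -
  let ?g = "\<lambda>i j k. G x (cov G (E i) (E j) x) (E k x)"
  have anti: "?g i j k + ?g i k j = 0" for i j k
  proof -
    have "der (E i) (\<lambda>x. G x (E j x) (E k x)) x = der (E i) (\<lambda>x. of_bool (j = k)) x"
      by (rule der_cong[OF open_V x orth])
    then show ?thesis using der_G[OF x smooth_E smooth_E] by (simp add: der_const sym[OF x, of "E j x"])
  qed
  have tor: "?g i j k - ?g j i k = str i j k x" for i j k
    using chr_sym[OF x, of "E i x" "E j x"]
    by (simp add: str_def cov_def bilinear_ladd[OF bil[OF x]] bilinear_lsub[OF bil[OF x]])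
  have "?g i j k = gam i j k x" for k
    unfolding gam_def tor[symmetric]
    using anti[of i j k] anti[of j i k] anti[of k i j] by (simp add: field_simps)
  then have "(\<Sum>k\<in>UNIV. gam i j k x *\<^sub>R E k x) = (\<Sum>k\<in>UNIV. ?g i j k *\<^sub>R E k x)" by simp
  then show ?thesis by (simp only: span[OF x])
qed

text \<open>The definition of \<open>riem\<close> freezes its arguments as constant fields. For
  moving fields the derivatives of \<open>Z\<close> cancel up to \<open>der_commute\<close>, which
  supplies the derivative part of the bracket term; torsion-like leftovers of \<open>chr\<close>
  supply the rest of it.\<close>

lemma curvature_fields:
  assumes x: "x \<in> V" and X: "smooth_on V X" and Y: "smooth_on V Y" and Z: "smooth_on V Z"
  shows "cov G X (cov G Y Z) x - cov G Y (cov G X Z) x -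
      cov G (\<lambda>x. der X Y x - der Y X x) Z x = riem G x (X x) (Y x) (Z x)"
proof -
  have D: "der X (cov G Y Z) x = der X (der Y Z) x +
      (fderiv (\<lambda>y. chr G y (Y x) (Z x)) x (X x) +
       chr G x (der X Y x) (Z x) + chr G x (Y x) (der X Z x))"
    if Y: "smooth_on V Y" for X Y
  proof -
    have "der X (\<lambda>x. chr G x (Y x) (Z x)) x = fderiv (\<lambda>y. chr G y (Y x) (Z x)) x (X x) +
       chr G x (der X Y x) (Z x) + chr G x (Y x) (der X Z x)"
      unfolding der_def[of X Y] der_def[of X Z]
      by (rule der_eqI, rule has_derivative_bilinear_family[where f = "\<lambda>x. x", OF bilinear_chr smooth_chr x
          has_derivative_ident smooth_on_has_derivative[OF Y x] smooth_on_has_derivative[OF Z x]])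
    moreover have "der X (cov G Y Z) x = der X (der Y Z) x + der X (\<lambda>x. chr G x (Y x) (Z x)) x"
      unfolding cov_def
      by (intro der_add smooth_on_differentiable[OF _ x] smooth_on_der smooth_chr_fields Y Z)
    ultimately show ?thesis by simp
  qed
  note b = bilinear_radd[OF bilinear_chr[OF x]] bilinear_lsub[OF bilinear_chr[OF x]]
  have "cov G X (cov G Y Z) x - cov G Y (cov G X Z) x =
      (der X (der Y Z) x - der Y (der X Z) x) + chr G x (der X Y x - der Y X x) (Z x) + riem G x (X x) (Y x) (Z x)"
    unfolding cov_def[of G X "cov G Y Z"] cov_def[of G Y "cov G X Z"] D[OF X] D[OF Y]
      cov_def[of G Y Z x] cov_def[of G X Z x] b riem_def
    by (simp add: algebra_simps)
  then show ?thesis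
    unfolding der_commute[OF X Y Z x] by (simp add: cov_def der_def)
qed

text \<open>The component \<open>G (R(E i, E j) E k) (E l)\<close> of the curvature, a function of
  \<open>str\<close> and its frame derivatives alone.\<close>

definition curv :: "'i \<Rightarrow> 'i \<Rightarrow> 'i \<Rightarrow> 'i \<Rightarrow> 'e \<Rightarrow> real" where
  "curv i j k l x = der (E i) (gam j k l) x - der (E j) (gam i k l) x +
     (\<Sum>m\<in>UNIV. gam j k m x * gam i m l x - gam i k m x * gam j m l x - str i j m x * gam m k l x)"

lemma cov_sum:
  assumes x: "x \<in> V" and f: "\<And>k. smooth_on V (f k)"
  shows "cov G X (\<lambda>x. \<Sum>k\<in>UNIV. f k x *\<^sub>R E k x) x =
    (\<Sum>k\<in>UNIV. der X (f k) x *\<^sub>R E k x + f k x *\<^sub>R cov G X (E k) x)"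
proof -
  have d: "f k differentiable (at x)" "E k differentiable (at x)" for k
    using smooth_on_differentiable[OF f x] smooth_on_differentiable[OF smooth_E x] by auto
  interpret linear "chr G x (X x)" using bilinear_chr[OF x] by (simp add: bilinear_def)
  have "der X (\<lambda>x. \<Sum>k\<in>UNIV. f k x *\<^sub>R E k x) x = (\<Sum>k\<in>UNIV. der X (\<lambda>x. f k x *\<^sub>R E k x) x)"
    using d by (intro der_sum) auto
  then show ?thesis
    by (simp add: cov_def der_scaleR[OF d] sum scale scaleR_add_right sum.distrib add.assoc)
qed

lemma cov_cong:
  "x \<in> V \<Longrightarrow> (\<And>y. y \<in> V \<Longrightarrow> Y y = Z y) \<Longrightarrow> cov G X Y x = cov G X Z x"
  unfolding cov_def using der_cong[OF open_V] by metis

lemma riem_frame: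
  assumes x: "x \<in> V"
  shows "riem G x (E i x) (E j x) (E k x) = (\<Sum>l\<in>UNIV. curv i j k l x *\<^sub>R E l x)"
proof -
  have 1: "cov G (E i) (cov G (E j) (E k)) x =
    (\<Sum>l\<in>UNIV. (der (E i) (gam j k l) x + (\<Sum>m\<in>UNIV. gam j k m x * gam i m l x)) *\<^sub>R E l x)" for i j
  proof -
    have "cov G (E i) (cov G (E j) (E k)) x = cov G (E i) (\<lambda>x. \<Sum>m\<in>UNIV. gam j k m x *\<^sub>R E m x) x"
      by (rule cov_cong[OF x cov_frame])
    also have "\<dots> = (\<Sum>m\<in>UNIV. der (E i) (gam j k m) x *\<^sub>R E m x) +
        (\<Sum>m\<in>UNIV. \<Sum>l\<in>UNIV. (gam j k m x * gam i m l x) *\<^sub>R E l x)"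
      by (simp add: cov_sum[OF x smooth_gam] cov_frame[OF x] sum.distrib scaleR_sum_right)
    also have "(\<Sum>m\<in>UNIV. \<Sum>l\<in>UNIV. (gam j k m x * gam i m l x) *\<^sub>R E l x) =
        (\<Sum>l\<in>UNIV. \<Sum>m\<in>UNIV. (gam j k m x * gam i m l x) *\<^sub>R E l x)"
      by (rule sum.swap)
    finally show ?thesis by (simp add: scaleR_add_left sum.distrib scaleR_sum_left)
  qed
  have 2: "cov G (\<lambda>x. der (E i) (E j) x - der (E j) (E i) x) (E k) x =
      (\<Sum>l\<in>UNIV. (\<Sum>m\<in>UNIV. str i j m x * gam m k l x) *\<^sub>R E l x)"
  proof -
    let ?w = "der (E i) (E j) x - der (E j) (E i) x"
    interpret D: linear "fderiv (E k) x"
      by (rule linear_frechet_derivative[OF smooth_on_differentiable[OF smooth_E x]])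
    interpret c: linear "\<lambda>u. chr G x u (E k x)" using bilinear_chr[OF x] by (simp add: bilinear_def)
    have "cov G (\<lambda>x. der (E i) (E j) x - der (E j) (E i) x) (E k) x =
        fderiv (E k) x ?w + chr G x ?w (E k x)"
      by (simp add: cov_def der_def[of _ "E k"])
    also have "\<dots> = (\<Sum>m\<in>UNIV. str i j m x *\<^sub>R cov G (E m) (E k) x)"
      unfolding bracket_frame[OF x]
      by (simp add: D.sum D.scale c.sum c.scale cov_def der_def[of _ "E k"] scaleR_add_right sum.distrib)
    also have "\<dots> = (\<Sum>m\<in>UNIV. \<Sum>l\<in>UNIV. (str i j m x * gam m k l x) *\<^sub>R E l x)"
      by (simp add: cov_frame[OF x] scaleR_sum_right)
    also have "\<dots> = (\<Sum>l\<in>UNIV. \<Sum>m\<in>UNIV. (str i j m x * gam m k l x) *\<^sub>R E l x)"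
      by (rule sum.swap)
    finally show ?thesis by (simp add: scaleR_sum_left)
  qed
  have "riem G x (E i x) (E j x) (E k x) = cov G (E i) (cov G (E j) (E k)) x -
      cov G (E j) (cov G (E i) (E k)) x - cov G (\<lambda>x. der (E i) (E j) x - der (E j) (E i) x) (E k) x"
    by (rule curvature_fields[OF x smooth_E smooth_E smooth_E, symmetric])
  also have "\<dots> = (\<Sum>l\<in>UNIV. curv i j k l x *\<^sub>R E l x)"
    unfolding 1 2 sum_subtractf[symmetric] scaleR_diff_left[symmetric] curv_def
    by (simp add: sum_subtractf sum.distrib algebra_simps)
  finally show ?thesis .
qed

lemma G_riem_frame: "x \<in> V \<Longrightarrow> G x (riem G x (E i x) (E j x) (E k x)) (E l x) = curv i j k l x"
  by (simp add: riem_frame G_frame_sum)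

lemma riem_linear:
  assumes x: "x \<in> V"
  shows "linear (\<lambda>u. riem G x u v w)" "linear (\<lambda>v. riem G x u v w)" "linear (\<lambda>w. riem G x u v w)"
proof -
  have D: "linear (fderiv (\<lambda>y. chr G y v w) x)" for v w
    by (rule linear_frechet_derivative[OF smooth_on_differentiable[OF smooth_chr x]])
  have B: "bilinear (\<lambda>v w. fderiv (\<lambda>y. chr G y v w) x u)" for u
    by (rule bilinear_frechet_derivative[OF open_V x bilinear_chr smooth_chr])
  note b = linear_add[OF D] linear_scale[OF D] bilinear_ladd[OF B] bilinear_radd[OF B]
    bilinear_lmul[OF B] bilinear_rmul[OF B] bilinear_ladd[OF bilinear_chr[OF x]]
    bilinear_radd[OF bilinear_chr[OF x]] bilinear_lmul[OF bilinear_chr[OF x]] bilinear_rmul[OF bilinear_chr[OF x]]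
  show "linear (\<lambda>u. riem G x u v w)" "linear (\<lambda>v. riem G x u v w)" "linear (\<lambda>w. riem G x u v w)"
    by (rule linearI; simp add: riem_def b algebra_simps)+
qed

lemma flat_iff_curv:
  assumes x: "x \<in> V"
  shows "(\<forall>u v w. riem G x u v w = 0) \<longleftrightarrow> (\<forall>i j k l. curv i j k l x = 0)"
proof
  assume "\<forall>u v w. riem G x u v w = 0"
  then show "\<forall>i j k l. curv i j k l x = 0"
    using G_riem_frame[OF x] bilinear_lzero[OF bil[OF x]] by metis
next
  assume 0: "\<forall>i j k l. curv i j k l x = 0"
  have ext: "L u = 0" if "linear L" "\<And>i. L (E i x) = 0" for L :: "'e \<Rightarrow> 'e" and u
  proof -
    have "L u = L (\<Sum>i\<in>UNIV. G x u (E i x) *\<^sub>R E i x)" by (simp add: span[OF x])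
    also have "\<dots> = 0" by (simp add: linear_sum[OF that(1)] linear_scale[OF that(1)] that(2))
    finally show ?thesis .
  qed
  have 1: "riem G x (E i x) (E j x) (E k x) = 0" for i j k
    by (simp add: riem_frame[OF x] 0)
  have 2: "riem G x (E i x) (E j x) w = 0" for i j w
    by (rule ext[OF riem_linear(3)[OF x] 1])
  have 3: "riem G x (E i x) v w = 0" for i v w
    by (rule ext[OF riem_linear(2)[OF x] 2])
  show "\<forall>u v w. riem G x u v w = 0"
    using ext[OF riem_linear(1)[OF x] 3] by blast
qed

lemma restrict_frame: "open V' \<Longrightarrow> V' \<subseteq> V \<Longrightarrow> orthonormal_frame V' G E"
  by unfold_locales (use bil sym orth span smooth_on_subset[OF smooth_G] smooth_on_subset[OF smooth_E] in auto)

lemma der_commute_frame: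
  fixes f :: "'e \<Rightarrow> real"
  assumes f: "smooth_on V f" and x: "x \<in> V"
  shows "der (E i) (der (E j) f) x - der (E j) (der (E i) f) x = (\<Sum>k\<in>UNIV. str i j k x * der (E k) f x)"
proof -
  interpret linear "fderiv f x"
    by (rule linear_frechet_derivative[OF smooth_on_differentiable[OF f x]])
  show ?thesis
    unfolding der_commute[OF smooth_E smooth_E f x] bracket_frame[OF x]
    by (simp add: sum scale der_def)
qed

text \<open>Flatness is invariant under isometries. Instead of a transformation law for
  \<open>riem\<close>, the frame is transported: \<open>\<tau>\<close>-related fields have
  \<open>\<tau>\<close>-related brackets by \<open>der_commute\<close>, an isometry then preserves
  \<open>str\<close>, and \<open>str\<close> determines \<open>curv\<close>.\<close>

lemma push_forward_flat:
  fixes G' :: "'e \<Rightarrow> 'e \<Rightarrow> 'e \<Rightarrow> real"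
  assumes \<tau>: "smooth_on V \<tau>" "\<And>x. x \<in> V \<Longrightarrow> \<tau> x \<in> V'" "\<And>x. x \<in> V \<Longrightarrow> \<sigma> (\<tau> x) = x"
    and \<sigma>: "smooth_on V' \<sigma>" "\<And>y. y \<in> V' \<Longrightarrow> \<sigma> y \<in> V" "\<And>y. y \<in> V' \<Longrightarrow> \<tau> (\<sigma> y) = y"
    and G': "\<And>y. y \<in> V' \<Longrightarrow> bilinear (G' y)" "\<And>y u v. y \<in> V' \<Longrightarrow> G' y u v = G' y v u"
      "\<And>u v. smooth_on V' (\<lambda>y. G' y u v)"
    and iso: "\<And>x u v. x \<in> V \<Longrightarrow>
      G' (\<tau> x) (fderiv \<tau> x u) (fderiv \<tau> x v) = G x u v"
    and flat: "\<And>x u v w. x \<in> V \<Longrightarrow> riem G x u v w = 0"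
    and y: "y \<in> V'"
  shows "riem G' y u v w = 0"
proof -
  define E' where "E' i y = der (E i) \<tau> (\<sigma> y)" for i y
  note V' = smooth_on_open[OF \<sigma>(1)]
  have d\<tau>: "\<tau> differentiable (at x)" if "x \<in> V" for x by (rule smooth_on_differentiable[OF \<tau>(1) that])
  have d\<sigma>: "\<sigma> differentiable (at y)" if "y \<in> V'" for y by (rule smooth_on_differentiable[OF \<sigma>(1) that])
  have inv1: "fderiv \<sigma> (\<tau> x) (fderiv \<tau> x u) = u" if "x \<in> V" for x u
  proof -
    have "der (\<lambda>_. u) (\<lambda>x. \<sigma> (\<tau> x)) x = der (\<lambda>_. u) (\<lambda>x. x) x"
      by (rule der_cong[OF open_V that \<tau>(3)])
    then show ?thesis
      using der_compose[OF d\<tau>[OF that] d\<sigma>[OF \<tau>(2)[OF that]], of "\<lambda>_. u"] by (simp add: der_def)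
  qed
  have inv2: "fderiv \<tau> (\<sigma> y) (fderiv \<sigma> y u) = u" if "y \<in> V'" for y u
  proof -
    have "der (\<lambda>_. u) (\<lambda>y. \<tau> (\<sigma> y)) y = der (\<lambda>_. u) (\<lambda>y. y) y"
      by (rule der_cong[OF V' that \<sigma>(3)])
    then show ?thesis
      using der_compose[OF d\<sigma>[OF that] d\<tau>[OF \<sigma>(2)[OF that]], of "\<lambda>_. u"] by (simp add: der_def)
  qed
  have iso': "G' y u v = G (\<sigma> y) (fderiv \<sigma> y u) (fderiv \<sigma> y v)"
    if "y \<in> V'" for y u v
    using iso[OF \<sigma>(2)[OF that], of "fderiv \<sigma> y u" "fderiv \<sigma> y v"]
    by (simp add: inv2[OF that] \<sigma>(3)[OF that])
  have \<sigma>E': "fderiv \<sigma> y (E' i y) = E i (\<sigma> y)" if "y \<in> V'" for i y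
    using inv1[OF \<sigma>(2)[OF that], of "E i (\<sigma> y)"] by (simp add: E'_def der_def \<sigma>(3)[OF that])
  have smooth_E': "smooth_on V' (E' i)" for i
    unfolding E'_def by (rule smooth_on_compose[OF smooth_on_der[OF smooth_E \<tau>(1)] \<sigma>(1,2)])
  have der': "der (E' i) (\<lambda>y. f (\<sigma> y)) y = der (E i) f (\<sigma> y)"
    if "smooth_on V f" "y \<in> V'" for i y and f :: "'e \<Rightarrow> 'c::real_normed_vector"
    unfolding der_compose[OF d\<sigma>[OF that(2)] smooth_on_differentiable[OF that(1) \<sigma>(2)[OF that(2)]]]
    by (simp add: der_def \<sigma>E'[OF that(2)])
  interpret F: orthonormal_frame V' G' E'
  proof
    show "(\<Sum>i\<in>UNIV. G' y u (E' i y) *\<^sub>R E' i y) = u" if "y \<in> V'" for y u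
    proof -
      interpret linear "fderiv \<tau> (\<sigma> y)"
        by (rule linear_frechet_derivative[OF d\<tau>[OF \<sigma>(2)[OF that]]])
      have "(\<Sum>i\<in>UNIV. G' y u (E' i y) *\<^sub>R E' i y) = fderiv \<tau> (\<sigma> y)
        (\<Sum>i\<in>UNIV. G (\<sigma> y) (fderiv \<sigma> y u) (E i (\<sigma> y)) *\<^sub>R E i (\<sigma> y))"
        by (simp add: sum scale iso'[OF that] \<sigma>E'[OF that]) (simp add: E'_def der_def)
      then show ?thesis by (simp only: span[OF \<sigma>(2)[OF that]] inv2[OF that])
    qed
  qed (use V' G' smooth_E' orth \<sigma>(2) in \<open>auto simp: iso' \<sigma>E'\<close>)
  have str': "F.str i j k y = str i j k (\<sigma> y)" if y: "y \<in> V'" for i j k y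
  proof -
    note \<sigma>y = \<sigma>(2)[OF y]
    have "der (E' i) (E' j) y - der (E' j) (E' i) y =
        der (E i) (der (E j) \<tau>) (\<sigma> y) - der (E j) (der (E i) \<tau>) (\<sigma> y)"
      unfolding E'_def[of i, abs_def] E'_def[of j, abs_def]
      using der'[OF smooth_on_der[OF smooth_E \<tau>(1)] y] by (simp add: E'_def[abs_def])
    also have "\<dots> = fderiv \<tau> (\<sigma> y) (der (E i) (E j) (\<sigma> y) - der (E j) (E i) (\<sigma> y))"
      by (rule der_commute[OF smooth_E smooth_E \<tau>(1) \<sigma>y])
    finally have "fderiv \<sigma> y (der (E' i) (E' j) y - der (E' j) (E' i) y) =
        der (E i) (E j) (\<sigma> y) - der (E j) (E i) (\<sigma> y)"
      using inv1[OF \<sigma>y] \<sigma>(3)[OF y] by simp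
    then show ?thesis by (simp add: F.str_def str_def iso'[OF y] \<sigma>E'[OF y])
  qed
  have gam': "F.gam i j k y = gam i j k (\<sigma> y)" if "y \<in> V'" for i j k y
    by (simp add: F.gam_def gam_def str' that)
  have "F.curv i j k l y = curv i j k l (\<sigma> y)" for i j k l
  proof -
    have "der (E' i) (F.gam j k l) y = der (E i) (gam j k l) (\<sigma> y)" for i j k l
      using der_cong[OF V' y, of "F.gam j k l" "\<lambda>y. gam j k l (\<sigma> y)" "E' i"] gam' der'[OF smooth_gam y] by simp
    then show ?thesis unfolding F.curv_def curv_def by (simp add: gam' str' y)
  qed
  moreover have "curv i j k l (\<sigma> y) = 0" for i j k l
    using flat_iff_curv[OF \<sigma>(2)[OF y]] flat[OF \<sigma>(2)[OF y]] by simp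
  ultimately show ?thesis using F.flat_iff_curv[OF y] by simp
qed

lemma conformal_frame:
  assumes "smooth_on V lam"
  shows "orthonormal_frame V (\<lambda>x u v. exp (2 * lam x) * G x u v) (\<lambda>i x. exp (- lam x) *\<^sub>R E i x)"
proof
  have e: "exp (2 * lam x) * (exp (- lam x) * exp (- lam x)) = 1" for x
    by (simp add: exp_add[symmetric])
  show "bilinear (\<lambda>u v. exp (2 * lam x) * G x u v)" if "x \<in> V" for x
    using bilinear_ladd[OF bil[OF that]] bilinear_radd[OF bil[OF that]]
      bilinear_lmul[OF bil[OF that]] bilinear_rmul[OF bil[OF that]]
    unfolding bilinear_def by (intro conjI allI linearI) (simp_all add: algebra_simps)
  show "smooth_on V (\<lambda>x. exp (2 * lam x) * G x u v)" for u v
    by (intro smooth_on_mult smooth_on_exp smooth_on_const open_V assms smooth_G)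
  show "smooth_on V (\<lambda>x. exp (- lam x) *\<^sub>R E i x)" for i
    by (intro smooth_on_scaleR smooth_on_exp smooth_on_minus assms smooth_E)
  show "exp (2 * lam x) * G x (exp (- lam x) *\<^sub>R E i x) (exp (- lam x) *\<^sub>R E j x) = of_bool (i = j)"
    if "x \<in> V" for x i j
    using e[of x] by (simp add: bilinear_lmul[OF bil[OF that]] bilinear_rmul[OF bil[OF that]] orth[OF that])
  show "(\<Sum>i\<in>UNIV. (exp (2 * lam x) * G x u (exp (- lam x) *\<^sub>R E i x)) *\<^sub>R exp (- lam x) *\<^sub>R E i x) = u"
    if "x \<in> V" for x u
  proof -
    have "(exp (2 * lam x) * G x u (exp (- lam x) *\<^sub>R E i x)) *\<^sub>R exp (- lam x) *\<^sub>R E i x =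
        (exp (2 * lam x) * (exp (- lam x) * exp (- lam x)) * G x u (E i x)) *\<^sub>R E i x" for i
      by (simp add: bilinear_rmul[OF bil[OF that]] ac_simps)
    then show ?thesis by (simp only: e mult_1 span[OF that])
  qed
qed (simp_all add: open_V sym)

text \<open>The frame rescaled by \<open>s = exp (- lam)\<close> has structure functions
  \<open>c\<close> and connection coefficients \<open>g\<close>; \<open>dg\<close> are the
  derivatives of the latter along the original frame. All are linear in \<open>s\<close> and its
  derivatives, so the curvature is a polynomial in these.\<close>

lemma conformal_curv:
  fixes lam s m
  assumes lam: "smooth_on V lam" and x: "x \<in> V"
  defines "s \<equiv> \<lambda>x. exp (- lam x)" and "m \<equiv> \<lambda>i. der (E i) (\<lambda>x. exp (- lam x))"
  defines "g \<equiv> \<lambda>i j k. s x * gam i j k x - m j x * of_bool (i = k) + m k x * of_bool (i = j)"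
  defines "dg \<equiv> \<lambda>i j k l. m i x * gam j k l x + s x * der (E i) (gam j k l) x -
      der (E i) (m k) x * of_bool (j = l) + der (E i) (m l) x * of_bool (j = k)"
  defines "c \<equiv> \<lambda>i j k. m i x * of_bool (j = k) - m j x * of_bool (i = k) + s x * str i j k x"
  shows "orthonormal_frame.curv (\<lambda>x u v. exp (2 * lam x) * G x u v) (\<lambda>i x. exp (- lam x) *\<^sub>R E i x) i j k l x =
    s x * dg i j k l - s x * dg j i k l +
    (\<Sum>n\<in>UNIV. g j k n * g i n l - g i k n * g j n l - c i j n * g n k l)"
proof -
  let ?E = "\<lambda>i x. s x *\<^sub>R E i x" and ?G = "\<lambda>x u v. exp (2 * lam x) * G x u v"
  interpret F: orthonormal_frame V ?G ?E
    unfolding s_def by (rule conformal_frame[OF lam])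
  have e: "exp (2 * lam x) * (s x * s x) = 1" for x
    by (simp add: s_def exp_add[symmetric])
  have s: "smooth_on V s" unfolding s_def by (intro smooth_on_exp smooth_on_minus lam)
  have m: "m i x = der (E i) s x" for i x by (simp add: m_def s_def)
  have sm: "smooth_on V (m i)" for i
    unfolding m_def using smooth_on_der[OF smooth_E s] by (simp add: s_def)
  note ds = smooth_on_differentiable[OF s] and dE = smooth_on_differentiable[OF smooth_E]
    and dm = smooth_on_differentiable[OF sm] and dgam = smooth_on_differentiable[OF smooth_gam]
  have der_E: "der (?E i) f x = s x *\<^sub>R der (E i) f x"
    if "f differentiable (at x)" for i x and f :: "'e \<Rightarrow> 'c::real_normed_vector"
    using linear_scale[OF linear_frechet_derivative[OF that]] by (simp add: der_def)
  have str: "F.str i j k x = m i x * of_bool (j = k) - m j x * of_bool (i = k) + s x * str i j k x"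
    if x: "x \<in> V" for i j k x
  proof -
    have "der (?E i) (?E j) x = s x *\<^sub>R (m i x *\<^sub>R E j x + s x *\<^sub>R der (E i) (E j) x)" for i j
    proof -
      have "der (?E i) (?E j) x = s x *\<^sub>R der (E i) (?E j) x"
        by (intro der_E differentiable_scaleR ds dE x)
      then show ?thesis by (simp add: der_scaleR[OF ds[OF x] dE[OF x]] m)
    qed
    then have "der (?E i) (?E j) x - der (?E j) (?E i) x = s x *\<^sub>R (m i x *\<^sub>R E j x - m j x *\<^sub>R E i x +
        s x *\<^sub>R (der (E i) (E j) x - der (E j) (E i) x))"
      by (simp add: algebra_simps)
    then have "F.str i j k x = exp (2 * lam x) * (s x * s x) * (m i x * G x (E j x) (E k x) -
        m j x * G x (E i x) (E k x) + s x * str i j k x)"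
      unfolding F.str_def str_def
      by (simp add: bilinear_lmul[OF bil[OF x]] bilinear_rmul[OF bil[OF x]]
          bilinear_ladd[OF bil[OF x]] bilinear_lsub[OF bil[OF x]])
    then show ?thesis by (simp add: e orth[OF x])
  qed
  have gam: "F.gam i j k x = s x * gam i j k x - m j x * of_bool (i = k) + m k x * of_bool (i = j)"
    if "x \<in> V" for i j k x
    unfolding F.gam_def gam_def str[OF that] by (auto simp: field_simps of_bool_def)
  have dgam': "der (?E i) (F.gam j k l) x = s x * dg i j k l" for i j k l
  proof -
    have "der (?E i) (F.gam j k l) x = s x * der (E i) (F.gam j k l) x"
      using der_E[OF smooth_on_differentiable[OF F.smooth_gam x]] by simp
    also have "der (E i) (F.gam j k l) x =
        der (E i) (\<lambda>x. s x * gam j k l x - m k x * of_bool (j = l) + m l x * of_bool (j = k)) x"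
      by (rule der_cong[OF open_V x gam])
    also have "\<dots> = dg i j k l"
      unfolding dg_def m[of i]
      by (simp add: der_add der_diff der_mult der_const ds[OF x] dm[OF x] dgam[OF x])
    finally show ?thesis .
  qed
  have "F.curv i j k l x = s x * dg i j k l - s x * dg j i k l +
    (\<Sum>n\<in>UNIV. g j k n * g i n l - g i k n * g j n l - c i j n * g n k l)"
    unfolding F.curv_def dgam' gam[OF x] str[OF x] g_def c_def ..
  then show ?thesis by (simp only: s_def)
qed

end

section \<open>The frame of a circle bundle\<close>

lemma distinct_3: "(1::3) \<noteq> 2" "(1::3) \<noteq> 3" "(2::3) \<noteq> 3" "(2::3) \<noteq> 1" "(3::3) \<noteq> 1" "(3::3) \<noteq> 2"
  by simp_all

lemma der_cdivide:
  fixes f :: "_ \<Rightarrow> real"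
  shows "f differentiable (at x) \<Longrightarrow> der X (\<lambda>x. f x / c) x = der X f x / c"
  using der_mult[of f x "\<lambda>_. inverse c" X] by (simp add: der_const divide_inverse)

text \<open>\<open>E 1\<close> and \<open>E 2\<close> are horizontal lifts of a frame of the base with bracket \<open>a E\<^sub>1 + b E\<^sub>2\<close>, and \<open>E 3\<close> is
  vertical; \<open>a\<close>, \<open>b\<close>, \<open>H\<close>, \<open>K\<close> are pulled back from the base.\<close>

locale circle_frame = orthonormal_frame V G E
  for V :: "'e::euclidean_space set" and G :: "'e \<Rightarrow> 'e \<Rightarrow> 'e \<Rightarrow> real" and E :: "3 \<Rightarrow> 'e \<Rightarrow> 'e" +
  fixes a b H K :: "'e \<Rightarrow> real"
  assumes smooth_coeff: "smooth_on V a" "smooth_on V b" "smooth_on V H" "smooth_on V K"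
    and bracket_horizontal: "\<And>x. x \<in> V \<Longrightarrow>
      der (E 1) (E 2) x - der (E 2) (E 1) x = a x *\<^sub>R E 1 x + b x *\<^sub>R E 2 x - H x *\<^sub>R E 3 x"
    and bracket_vertical: "\<And>x. x \<in> V \<Longrightarrow> der (E 1) (E 3) x = der (E 3) (E 1) x"
      "\<And>x. x \<in> V \<Longrightarrow> der (E 2) (E 3) x = der (E 3) (E 2) x"
    and basic: "\<And>x. x \<in> V \<Longrightarrow> der (E 3) a x = 0" "\<And>x. x \<in> V \<Longrightarrow> der (E 3) b x = 0"
      "\<And>x. x \<in> V \<Longrightarrow> der (E 3) H x = 0" "\<And>x. x \<in> V \<Longrightarrow> der (E 3) K x = 0"
    and gauss: "\<And>x. x \<in> V \<Longrightarrow> K x = der (E 1) b x - der (E 2) a x - (a x)\<^sup>2 - (b x)\<^sup>2"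
begin

abbreviation D :: "3 \<Rightarrow> ('e \<Rightarrow> real) \<Rightarrow> 'e \<Rightarrow> real" where
  "D i \<equiv> der (E i)"

lemma str_values:
  assumes x: "x \<in> V"
  shows "str i i k x = 0"
    "str 1 2 1 x = a x" "str 1 2 2 x = b x" "str 1 2 3 x = - H x"
    "str 2 1 1 x = - a x" "str 2 1 2 x = - b x" "str 2 1 3 x = H x"
    "str 1 3 k x = 0" "str 3 1 k x = 0" "str 2 3 k x = 0" "str 3 2 k x = 0"
proof -
  note b = bilinear_ladd[OF bil[OF x]] bilinear_lsub[OF bil[OF x]] bilinear_lmul[OF bil[OF x]]
    bilinear_lzero[OF bil[OF x]]
  have anti: "str j i k x = - str i j k x" for i j k
    by (simp add: str_def b)
  show 12: "str 1 2 1 x = a x" "str 1 2 2 x = b x" "str 1 2 3 x = - H x"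
    by (simp_all add: str_def bracket_horizontal[OF x] b orth[OF x])
  show "str 2 1 1 x = - a x" "str 2 1 2 x = - b x" "str 2 1 3 x = H x"
    using 12 anti[of 2 1] by simp_all
  show 13: "str 1 3 k x = 0" "str 2 3 k x = 0"
    by (simp_all add: str_def bracket_vertical[OF x] b)
  show "str 3 1 k x = 0" "str 3 2 k x = 0" "str i i k x = 0"
    using 13 anti[of 3 1] anti[of 3 2] by (simp_all add: str_def b)
qed

text \<open>The entries with H/2 are half the vertical part of [E 1, E 2], O'Neill's tensor of the
  submersion. They also occur with 3 in the first place because the vertical field commutes with the
  lifts. The zeros of \<open>gam 3 3\<close> say that the fibres are geodesics.\<close>

lemma gam_values:
  assumes x: "x \<in> V"
  shows "gam 1 1 1 x = 0" "gam 1 1 2 x = - a x" "gam 1 1 3 x = 0"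
    "gam 1 2 1 x = a x" "gam 1 2 2 x = 0" "gam 1 2 3 x = - (1/2) * H x"
    "gam 1 3 1 x = 0" "gam 1 3 2 x = (1/2) * H x" "gam 1 3 3 x = 0"
    "gam 2 1 1 x = 0" "gam 2 1 2 x = - b x" "gam 2 1 3 x = (1/2) * H x"
    "gam 2 2 1 x = b x" "gam 2 2 2 x = 0" "gam 2 2 3 x = 0"
    "gam 2 3 1 x = - (1/2) * H x" "gam 2 3 2 x = 0" "gam 2 3 3 x = 0"
    "gam 3 1 1 x = 0" "gam 3 1 2 x = (1/2) * H x" "gam 3 1 3 x = 0"
    "gam 3 2 1 x = - (1/2) * H x" "gam 3 2 2 x = 0" "gam 3 2 3 x = 0"
    "gam 3 3 1 x = 0" "gam 3 3 2 x = 0" "gam 3 3 3 x = 0"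
  by (simp_all add: gam_def str_values[OF x])

lemma D_cong: "x \<in> V \<Longrightarrow> (\<And>y. y \<in> V \<Longrightarrow> f y = g y) \<Longrightarrow> D i f x = D i g x"
  by (rule der_cong[OF open_V])

lemma D_linear:
  "f differentiable (at x) \<Longrightarrow> D i (\<lambda>x. - f x) x = - D i f x"
  "f differentiable (at x) \<Longrightarrow> D i (\<lambda>x. c * f x) x = c * D i f x"
  by (simp_all add: der_minus der_mult der_const)

lemma coeff_differentiable:
  assumes x: "x \<in> V"
  shows "a differentiable (at x)" "b differentiable (at x)" "H differentiable (at x)" "K differentiable (at x)"
    "D i H differentiable (at x)"
  using smooth_coeff smooth_on_der[OF smooth_E smooth_coeff(3)] smooth_on_differentiable x by blast+

lemma D_gam:
  assumes x: "x \<in> V"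
  shows "D i (gam 1 1 1) x = 0" "D i (gam 1 1 2) x = - D i a x" "D i (gam 1 1 3) x = 0"
    "D i (gam 1 2 1) x = D i a x" "D i (gam 1 2 2) x = 0" "D i (gam 1 2 3) x = - (1/2) * D i H x"
    "D i (gam 1 3 1) x = 0" "D i (gam 1 3 2) x = (1/2) * D i H x" "D i (gam 1 3 3) x = 0"
    "D i (gam 2 1 1) x = 0" "D i (gam 2 1 2) x = - D i b x" "D i (gam 2 1 3) x = (1/2) * D i H x"
    "D i (gam 2 2 1) x = D i b x" "D i (gam 2 2 2) x = 0" "D i (gam 2 2 3) x = 0"
    "D i (gam 2 3 1) x = - (1/2) * D i H x" "D i (gam 2 3 2) x = 0" "D i (gam 2 3 3) x = 0"
    "D i (gam 3 1 1) x = 0" "D i (gam 3 1 2) x = (1/2) * D i H x" "D i (gam 3 1 3) x = 0"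
    "D i (gam 3 2 1) x = - (1/2) * D i H x" "D i (gam 3 2 2) x = 0" "D i (gam 3 2 3) x = 0"
    "D i (gam 3 3 1) x = 0" "D i (gam 3 3 2) x = 0" "D i (gam 3 3 3) x = 0"
  using D_cong[OF x gam_values(1)] D_cong[OF x gam_values(2)] D_cong[OF x gam_values(3)]
    D_cong[OF x gam_values(4)] D_cong[OF x gam_values(5)] D_cong[OF x gam_values(6)]
    D_cong[OF x gam_values(7)] D_cong[OF x gam_values(8)] D_cong[OF x gam_values(9)]
    D_cong[OF x gam_values(10)] D_cong[OF x gam_values(11)] D_cong[OF x gam_values(12)]
    D_cong[OF x gam_values(13)] D_cong[OF x gam_values(14)] D_cong[OF x gam_values(15)]
    D_cong[OF x gam_values(16)] D_cong[OF x gam_values(17)] D_cong[OF x gam_values(18)]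
    D_cong[OF x gam_values(19)] D_cong[OF x gam_values(20)] D_cong[OF x gam_values(21)]
    D_cong[OF x gam_values(22)] D_cong[OF x gam_values(23)] D_cong[OF x gam_values(24)]
    D_cong[OF x gam_values(25)] D_cong[OF x gam_values(26)] D_cong[OF x gam_values(27)]
  by (simp_all only: der_const D_linear coeff_differentiable[OF x])

section \<open>From conformal flatness to the equations\<close>

lemma D_vertical_commute:
  assumes "smooth_on V f" "x \<in> V"
  shows "D 1 (D 3 f) x = D 3 (D 1 f) x" "D 2 (D 3 f) x = D 3 (D 2 f) x"
  using der_commute_frame[OF assms, of 1 3] der_commute_frame[OF assms, of 2 3]
  by (simp_all add: str_values[OF assms(2)])

lemma D_vertical_DH:
  assumes x: "x \<in> V"
  shows "D 3 (D 1 H) x = 0" "D 3 (D 2 H) x = 0"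
  using D_vertical_commute[OF smooth_coeff(3) x] D_cong[OF x basic(3)] by (simp_all add: der_const)

text \<open>Each claim is one component of the vanishing curvature. Two different coordinate planes
  of the frame yield an off-diagonal entry of the Hessian of \<open>s\<close>, and a factor
  \<open>s\<close> cancels. A plane paired with itself yields the sum of two diagonal entries; its
  sectional curvature, K - 3H^2/4 or H^2/4, appears on the right.\<close>

lemma second_derivatives_of_flat:
  fixes lam
  assumes lam: "smooth_on V lam"
    and flat: "\<forall>x\<in>V. \<forall>u v w. riem (\<lambda>x u v. exp (2 * lam x) * G x u v) x u v w = 0"
    and x: "x \<in> V"
  defines "s \<equiv> \<lambda>x. exp (- lam x)"
  shows "D 1 (D 2 s) x = a x * D 1 s x - (1/2) * H x * D 3 s x"
    "D 2 (D 1 s) x = (1/2) * H x * D 3 s x - b x * D 2 s x"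
    "D 1 (D 3 s) x = (1/2) * H x * D 2 s x - (1/2) * D 2 H x * s x"
    "D 3 (D 1 s) x = (1/2) * H x * D 2 s x - (1/2) * D 2 H x * s x"
    "D 2 (D 3 s) x = (1/2) * D 1 H x * s x - (1/2) * H x * D 1 s x"
    "D 3 (D 2 s) x = (1/2) * D 1 H x * s x - (1/2) * H x * D 1 s x"
    "s x * (D 1 (D 1 s) x + D 2 (D 2 s) x + a x * D 2 s x - b x * D 1 s x) =
      ((3/4) * (H x)\<^sup>2 - K x) * (s x)\<^sup>2 + (D 1 s x)\<^sup>2 + (D 2 s x)\<^sup>2 + (D 3 s x)\<^sup>2"
    "s x * (D 1 (D 1 s) x + D 3 (D 3 s) x + a x * D 2 s x) =
      - (1/4) * (H x)\<^sup>2 * (s x)\<^sup>2 + (D 1 s x)\<^sup>2 + (D 2 s x)\<^sup>2 + (D 3 s x)\<^sup>2"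
    "s x * (D 2 (D 2 s) x + D 3 (D 3 s) x - b x * D 1 s x) =
      - (1/4) * (H x)\<^sup>2 * (s x)\<^sup>2 + (D 1 s x)\<^sup>2 + (D 2 s x)\<^sup>2 + (D 3 s x)\<^sup>2"
proof -
  have s: "s x \<noteq> 0" by (simp add: s_def)
  have 0: "orthonormal_frame.curv (\<lambda>x u v. exp (2 * lam x) * G x u v) (\<lambda>i x. exp (- lam x) *\<^sub>R E i x) i j k l x = 0"
    for i j k l
    using orthonormal_frame.flat_iff_curv[OF conformal_frame[OF lam] x] flat x by simp
  note c = conformal_curv[OF lam x, folded s_def, unfolded 0, symmetric]
  have s': "exp (- lam x) = s x" by (simp add: s_def)
  note simps = s' sum_3 distinct_3 gam_values[OF x] str_values[OF x] D_gam[OF x] basic[OF x] gauss[OF x]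
    power2_eq_square algebra_simps
  have "s x * (D 1 (D 2 s) x - (a x * D 1 s x - (1/2) * H x * D 3 s x)) = 0"
    using c[of 1 3 2 3] by (simp add: simps)
  then show "D 1 (D 2 s) x = a x * D 1 s x - (1/2) * H x * D 3 s x" using s by simp
  have "s x * (D 2 (D 1 s) x - ((1/2) * H x * D 3 s x - b x * D 2 s x)) = 0"
    using c[of 2 3 1 3] by (simp add: simps)
  then show "D 2 (D 1 s) x = (1/2) * H x * D 3 s x - b x * D 2 s x" using s by simp
  have "s x * (D 1 (D 3 s) x - ((1/2) * H x * D 2 s x - (1/2) * D 2 H x * s x)) = 0"
    using c[of 1 2 2 3] by (simp add: simps)
  then show "D 1 (D 3 s) x = (1/2) * H x * D 2 s x - (1/2) * D 2 H x * s x" using s by simp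
  have "s x * (D 3 (D 1 s) x - ((1/2) * H x * D 2 s x - (1/2) * D 2 H x * s x)) = 0"
    using c[of 2 3 1 2] by (simp add: simps)
  then show "D 3 (D 1 s) x = (1/2) * H x * D 2 s x - (1/2) * D 2 H x * s x" using s by simp
  have "s x * (D 2 (D 3 s) x - ((1/2) * D 1 H x * s x - (1/2) * H x * D 1 s x)) = 0"
    using c[of 1 2 1 3] by (simp add: simps)
  then show "D 2 (D 3 s) x = (1/2) * D 1 H x * s x - (1/2) * H x * D 1 s x" using s by simp
  have "s x * (D 3 (D 2 s) x - ((1/2) * D 1 H x * s x - (1/2) * H x * D 1 s x)) = 0"
    using c[of 1 3 1 2] by (simp add: simps)
  then show "D 3 (D 2 s) x = (1/2) * D 1 H x * s x - (1/2) * H x * D 1 s x" using s by simp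
  show "s x * (D 1 (D 1 s) x + D 2 (D 2 s) x + a x * D 2 s x - b x * D 1 s x) =
      ((3/4) * (H x)\<^sup>2 - K x) * (s x)\<^sup>2 + (D 1 s x)\<^sup>2 + (D 2 s x)\<^sup>2 + (D 3 s x)\<^sup>2"
    using c[of 1 2 1 2] by (simp add: simps)
  show "s x * (D 1 (D 1 s) x + D 3 (D 3 s) x + a x * D 2 s x) =
      - (1/4) * (H x)\<^sup>2 * (s x)\<^sup>2 + (D 1 s x)\<^sup>2 + (D 2 s x)\<^sup>2 + (D 3 s x)\<^sup>2"
    using c[of 1 3 1 3] by (simp add: simps)
  show "s x * (D 2 (D 2 s) x + D 3 (D 3 s) x - b x * D 1 s x) =
      - (1/4) * (H x)\<^sup>2 * (s x)\<^sup>2 + (D 1 s x)\<^sup>2 + (D 2 s x)\<^sup>2 + (D 3 s x)\<^sup>2"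
    using c[of 2 3 2 3] by (simp add: simps)
qed

text \<open>The system for \<open>s\<close> and its first derivatives is closed by the derivatives
  of \<open>\<rho>\<close>. After that it suffices to commute the vertical field with the two
  horizontal ones: these brackets vanish, and on the three functions \<open>D i s\<close> they give
  six relations, one for each claim.\<close>

lemma equations_of_flat:
  assumes lam: "smooth_on V lam"
    and flat: "\<forall>x\<in>V. \<forall>u v w. riem (\<lambda>x u v. exp (2 * lam x) * G x u v) x u v w = 0"
    and x: "x \<in> V"
  shows "D 1 (D 1 H) x + a x * D 2 H x = H x * ((H x)\<^sup>2 - K x)"
    "D 2 (D 2 H) x - b x * D 1 H x = H x * ((H x)\<^sup>2 - K x)"
    "D 1 (D 2 H) x = a x * D 1 H x" "D 2 (D 1 H) x = - b x * D 2 H x"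
    "D 1 K x = 3 * H x * D 1 H x" "D 2 K x = 3 * H x * D 2 H x"
proof -
  define s where "s = (\<lambda>x. exp (- lam x))"
  \<comment> \<open>The quadratic constraint is solved for \<open>\<rho>\<close>, which is possible
    because \<open>s\<close> has no zeros.\<close>
  define \<rho> where "\<rho> = (\<lambda>x. - ((D 1 s x)\<^sup>2 + (D 2 s x)\<^sup>2 + (D 3 s x)\<^sup>2) / (2 * s x))"
  have s: "s x \<noteq> 0" for x by (simp add: s_def)
  have ss: "smooth_on V s" unfolding s_def by (intro smooth_on_exp smooth_on_minus lam)
  have sm: "smooth_on V (D i s)" for i by (rule smooth_on_der[OF smooth_E ss])
  have s\<rho>: "smooth_on V \<rho>"
    unfolding \<rho>_def
    by (intro smooth_on_divide smooth_on_minus smooth_on_add smooth_on_power smooth_on_mult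
        smooth_on_const[OF open_V] sm ss) (simp add: s)
  have s': "exp (- lam y) = s y" for y by (simp add: s_def)
  note e = second_derivatives_of_flat[OF lam flat, folded s_def, unfolded s']
  have null: "2 * (s y * \<rho> y) = - ((D 1 s y)\<^sup>2 + (D 2 s y)\<^sup>2 + (D 3 s y)\<^sup>2)" for y
    using s[of y] by (simp add: \<rho>_def)
  \<comment> \<open>The last three equations of \<open>e\<close> give the pairwise sums of the
    diagonal entries of the Hessian; this is their solution, with \<open>\<rho>\<close> in place of
    the squared gradient.\<close>
  have diag: "D 1 (D 1 s) y = - (a y * D 2 s y) - ((1/2) * K y - (3/8) * (H y * H y)) * s y - \<rho> y"
    "D 2 (D 2 s) y = b y * D 1 s y - ((1/2) * K y - (3/8) * (H y * H y)) * s y - \<rho> y"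
    "D 3 (D 3 s) y = - ((5/8) * (H y * H y) - (1/2) * K y) * s y - \<rho> y" if y: "y \<in> V" for y
  proof -
    have "s y * (D 1 (D 1 s) y - (- (a y * D 2 s y) - ((1/2) * K y - (3/8) * (H y * H y)) * s y - \<rho> y)) = 0"
      using e(7-9)[OF y] null[of y] by (simp add: power2_eq_square algebra_simps)
    then show "D 1 (D 1 s) y = - (a y * D 2 s y) - ((1/2) * K y - (3/8) * (H y * H y)) * s y - \<rho> y"
      using s by simp
    have "s y * (D 2 (D 2 s) y - (b y * D 1 s y - ((1/2) * K y - (3/8) * (H y * H y)) * s y - \<rho> y)) = 0"
      using e(7-9)[OF y] null[of y] by (simp add: power2_eq_square algebra_simps)
    then show "D 2 (D 2 s) y = b y * D 1 s y - ((1/2) * K y - (3/8) * (H y * H y)) * s y - \<rho> y"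
      using s by simp
    have "s y * (D 3 (D 3 s) y - (- ((5/8) * (H y * H y) - (1/2) * K y) * s y - \<rho> y)) = 0"
      using e(7-9)[OF y] null[of y] by (simp add: power2_eq_square algebra_simps)
    then show "D 3 (D 3 s) y = - ((5/8) * (H y * H y) - (1/2) * K y) * s y - \<rho> y"
      using s by simp
  qed
  note B = e(1-6)[OF x] diag[OF x]
  note d = coeff_differentiable[OF x] smooth_on_differentiable[OF ss x] smooth_on_differentiable[OF sm x]
    smooth_on_differentiable[OF s\<rho> x]
  note rules = der_cdivide der_add der_diff der_minus der_mult der_const d basic[OF x] D_vertical_DH[OF x]
  have null': "D i (\<lambda>y. 2 * (s y * \<rho> y)) x = D i (\<lambda>y. - (D 1 s y * D 1 s y + D 2 s y * D 2 s y + D 3 s y * D 3 s y)) x" for i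
    by (rule D_cong[OF x]) (simp add: null power2_eq_square)
  \<comment> \<open>The differentiated constraint. Once the second derivatives are inserted, a
    factor \<open>s\<close> cancels and d\<rho> is the Schouten tensor applied to the gradient of
    \<open>s\<close>.\<close>
  have \<rho>': "s x * D i \<rho> x = - D i s x * \<rho> x - (D 1 s x * D i (D 1 s) x + D 2 s x * D i (D 2 s) x + D 3 s x * D i (D 3 s) x)" for i
    using null'[of i] by (simp add: rules)
  have "s x * (D 3 \<rho> x - ((1/2) * D 2 H x * D 1 s x - (1/2) * D 1 H x * D 2 s x + ((5/8) * (H x * H x) - (1/2) * K x) * D 3 s x)) = 0"
    unfolding right_diff_distrib \<rho>' B by (simp add: algebra_simps)
  then have \<rho>3: "D 3 \<rho> x = (1/2) * D 2 H x * D 1 s x - (1/2) * D 1 H x * D 2 s x + ((5/8) * (H x * H x) - (1/2) * K x) * D 3 s x"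
    using s by simp
  have "s x * (D 1 \<rho> x - (((1/2) * K x - (3/8) * (H x * H x)) * D 1 s x + (1/2) * D 2 H x * D 3 s x)) = 0"
    unfolding right_diff_distrib \<rho>' B by (simp add: algebra_simps)
  then have \<rho>1: "D 1 \<rho> x = ((1/2) * K x - (3/8) * (H x * H x)) * D 1 s x + (1/2) * D 2 H x * D 3 s x"
    using s by simp
  have "s x * (D 2 \<rho> x - (((1/2) * K x - (3/8) * (H x * H x)) * D 2 s x - (1/2) * D 1 H x * D 3 s x)) = 0"
    unfolding right_diff_distrib \<rho>' B by (simp add: algebra_simps)
  then have \<rho>2: "D 2 \<rho> x = ((1/2) * K x - (3/8) * (H x * H x)) * D 2 s x - (1/2) * D 1 H x * D 3 s x"
    using s by simp
  note c = D_vertical_commute[OF sm x]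
  \<comment> \<open>Each \<open>z\<close> is the defect of one claimed equation. In the commutator
    relation everything else cancels, which leaves a multiple of \<open>s x * z\<close>.\<close>
  define z0 where "z0 = D 1 (D 2 H) x - (a x * D 1 H x)"
  then have z0: "D 1 (D 2 H) x = z0 + (a x * D 1 H x)" by simp
  have "s x * z0 = 0"
    using c(1)[of 1]
    by (simp add: D_cong[OF x, of "D 3 (D 1 s)", OF e(4)] D_cong[OF x, of "D 1 (D 1 s)", OF diag(1)]
        rules B \<rho>1 \<rho>2 \<rho>3 z0) (auto simp: power2_eq_square field_simps)
  then show "D 1 (D 2 H) x = a x * D 1 H x" using s[of x] z0 by simp
  define z1 where "z1 = D 1 (D 1 H) x - (H x * ((H x)\<^sup>2 - K x) - a x * D 2 H x)"
  then have z1: "D 1 (D 1 H) x = z1 + (H x * ((H x)\<^sup>2 - K x) - a x * D 2 H x)" by simp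
  have "s x * z1 = 0"
    using c(1)[of 2]
    by (simp add: D_cong[OF x, of "D 3 (D 2 s)", OF e(6)] D_cong[OF x, of "D 1 (D 2 s)", OF e(1)]
        rules B \<rho>1 \<rho>2 \<rho>3 z1) (auto simp: power2_eq_square field_simps)
  then show "D 1 (D 1 H) x + a x * D 2 H x = H x * ((H x)\<^sup>2 - K x)" using s[of x] z1 by simp
  define z2 where "z2 = D 2 (D 2 H) x - (H x * ((H x)\<^sup>2 - K x) + b x * D 1 H x)"
  then have z2: "D 2 (D 2 H) x = z2 + (H x * ((H x)\<^sup>2 - K x) + b x * D 1 H x)" by simp
  have "s x * z2 = 0"
    using c(2)[of 1]
    by (simp add: D_cong[OF x, of "D 3 (D 1 s)", OF e(4)] D_cong[OF x, of "D 2 (D 1 s)", OF e(2)]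
        rules B \<rho>1 \<rho>2 \<rho>3 z2) (auto simp: power2_eq_square field_simps)
  then show "D 2 (D 2 H) x - b x * D 1 H x = H x * ((H x)\<^sup>2 - K x)" using s[of x] z2 by simp
  define z3 where "z3 = D 2 (D 1 H) x - (- b x * D 2 H x)"
  then have z3: "D 2 (D 1 H) x = z3 + (- b x * D 2 H x)" by simp
  have "s x * z3 = 0"
    using c(2)[of 2]
    by (simp add: D_cong[OF x, of "D 3 (D 2 s)", OF e(6)] D_cong[OF x, of "D 2 (D 2 s)", OF diag(2)]
        rules B \<rho>1 \<rho>2 \<rho>3 z3) (auto simp: power2_eq_square field_simps)
  then show "D 2 (D 1 H) x = - b x * D 2 H x" using s[of x] z3 by simp
  define z4 where "z4 = D 1 K x - (3 * H x * D 1 H x)"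
  then have z4: "D 1 K x = z4 + (3 * H x * D 1 H x)" by simp
  have "s x * z4 = 0"
    using c(1)[of 3]
    by (simp add: D_cong[OF x, of "D 1 (D 3 s)", OF e(3)] D_cong[OF x, of "D 3 (D 3 s)", OF diag(3)]
        rules B \<rho>1 \<rho>2 \<rho>3 z4) (auto simp: power2_eq_square field_simps)
  then show "D 1 K x = 3 * H x * D 1 H x" using s[of x] z4 by simp
  define z5 where "z5 = D 2 K x - (3 * H x * D 2 H x)"
  then have z5: "D 2 K x = z5 + (3 * H x * D 2 H x)" by simp
  have "s x * z5 = 0"
    using c(2)[of 3]
    by (simp add: D_cong[OF x, of "D 2 (D 3 s)", OF e(5)] D_cong[OF x, of "D 3 (D 3 s)", OF diag(3)]
        rules B \<rho>1 \<rho>2 \<rho>3 z5) (auto simp: power2_eq_square field_simps)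
  then show "D 2 K x = 3 * H x * D 2 H x" using s[of x] z5 by simp
qed

end

section \<open>From the equations to conformal flatness: the tractor connection\<close>

lemma der_Pair:
  assumes "f differentiable (at x)" "g differentiable (at x)"
  shows "der X (\<lambda>x. (f x, g x)) x = (der X f x, der X g x)"
  using der_eqI[OF has_derivative_Pair[OF frechet_derivative_has[OF assms(1)] frechet_derivative_has[OF assms(2)]]]
  by (simp add: der_def)

context circle_frame
begin

text \<open>Converse of \<open>second_derivatives_of_flat\<close>, checked on all 81 components.
  \<open>null\<close> is solved for the square of \<open>D 3 s x\<close> so that it can serve as a
  rewrite rule; \<open>r\<close> is the value of \<rho> at the point.\<close>

lemma flat_of_second_derivatives:
  fixes lam r
  assumes lam: "smooth_on V lam" and x: "x \<in> V"
  defines "s \<equiv> \<lambda>x. exp (- lam x)"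
  defines "p \<equiv> (1/2) * K x - (3/8) * (H x * H x)"
  assumes eqs: "D 1 (D 1 s) x = - (a x * D 2 s x) - p * s x - r"
    "D 1 (D 2 s) x = a x * D 1 s x - (1/2) * H x * D 3 s x"
    "D 1 (D 3 s) x = (1/2) * H x * D 2 s x - (1/2) * D 2 H x * s x"
    "D 2 (D 1 s) x = (1/2) * H x * D 3 s x - b x * D 2 s x"
    "D 2 (D 2 s) x = b x * D 1 s x - p * s x - r"
    "D 2 (D 3 s) x = (1/2) * D 1 H x * s x - (1/2) * H x * D 1 s x"
    "D 3 (D 1 s) x = (1/2) * H x * D 2 s x - (1/2) * D 2 H x * s x"
    "D 3 (D 2 s) x = (1/2) * D 1 H x * s x - (1/2) * H x * D 1 s x"
    "D 3 (D 3 s) x = - ((5/8) * (H x * H x) - (1/2) * K x) * s x - r"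
    and null: "D 3 s x * D 3 s x = - 2 * (s x * r) - D 1 s x * D 1 s x - D 2 s x * D 2 s x"
  shows "riem (\<lambda>x u v. exp (2 * lam x) * G x u v) x u v w = 0"
proof -
  have s': "exp (- lam x) = s x" by (simp add: s_def)
  note c = conformal_curv[OF lam x, folded s_def]
  have "orthonormal_frame.curv (\<lambda>x u v. exp (2 * lam x) * G x u v) (\<lambda>i x. exp (- lam x) *\<^sub>R E i x) i j k l x = 0"
    for i j k l :: 3
    unfolding c
    using exhaust_3[of i] exhaust_3[of j] exhaust_3[of k] exhaust_3[of l]
    by (elim disjE; simp add: s' sum_3 distinct_3 gam_values[OF x] str_values[OF x] D_gam[OF x] basic[OF x] gauss[OF x]
    p_def power2_eq_square eqs null algebra_simps)
  then show ?thesis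
    using orthonormal_frame.flat_iff_curv[OF conformal_frame[OF lam] x] by simp
qed

text \<open>The covariant derivative in direction \<open>E i\<close> of \<open>(s, m1, m2, m3, r)\<close> vanishes iff its derivative is
  \<open>tractor i\<close> of it. The functions \<open>K/2 - 3H\<^sup>2/8\<close>, \<open>5H\<^sup>2/8 - K/2\<close> and \<open>\<plusminus> D H/2\<close> are the components of the
  Schouten tensor.\<close>

definition tractor :: "3 \<Rightarrow> 'e \<Rightarrow> real \<times> real \<times> real \<times> real \<times> real \<Rightarrow> real \<times> real \<times> real \<times> real \<times> real" where
  "tractor i x = (\<lambda>(s, m1, m2, m3, r).
     if i = 1 then
       (m1, - (a x * m2) - ((1/2) * K x - (3/8) * (H x * H x)) * s - r, a x * m1 - (1/2) * H x * m3,
        (1/2) * H x * m2 - (1/2) * D 2 H x * s,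
        ((1/2) * K x - (3/8) * (H x * H x)) * m1 + (1/2) * D 2 H x * m3)
     else if i = 2 then
       (m2, (1/2) * H x * m3 - b x * m2, b x * m1 - ((1/2) * K x - (3/8) * (H x * H x)) * s - r,
        (1/2) * D 1 H x * s - (1/2) * H x * m1,
        ((1/2) * K x - (3/8) * (H x * H x)) * m2 - (1/2) * D 1 H x * m3)
     else
       (m3, (1/2) * H x * m2 - (1/2) * D 2 H x * s, (1/2) * D 1 H x * s - (1/2) * H x * m1,
        - ((5/8) * (H x * H x) - (1/2) * K x) * s - r,
        (1/2) * D 2 H x * m1 - (1/2) * D 1 H x * m2 + ((5/8) * (H x * H x) - (1/2) * K x) * m3))"

lemma tractor_linear: "linear (tractor i x)"
  by (rule linearI) (auto simp: tractor_def algebra_simps add_divide_distrib diff_divide_distrib)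

lemma smooth_tractor: "smooth_on V (\<lambda>x. tractor i x y)"
proof -
  obtain s m1 m2 m3 r where y: "y = (s, m1, m2, m3, r)" by (metis prod.exhaust)
  consider "i = 1" | "i = 2" | "i = 3" using exhaust_3 by blast
  then show ?thesis
    unfolding y tractor_def prod.case
    by cases (simp_all only: distinct_3 if_True if_False refl, (intro smooth_on_Pair smooth_on_add smooth_on_diff smooth_on_minus
          smooth_on_mult smooth_on_const[OF open_V] smooth_coeff smooth_on_der[OF smooth_E])+)
qed

text \<open>The frame components assembled into a one-form on coordinate vectors, the shape in which
  \<open>linear_frobenius\<close> takes a system.\<close>

definition tractor_form :: "'e \<Rightarrow> 'e \<Rightarrow> real \<times> real \<times> real \<times> real \<times> real \<Rightarrow> real \<times> real \<times> real \<times> real \<times> real" where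
  "tractor_form x v y = (\<Sum>i\<in>UNIV. G x v (E i x) *\<^sub>R tractor i x y)"

lemma tractor_form_frame: "x \<in> V \<Longrightarrow> tractor_form x (E i x) y = tractor i x y"
  unfolding tractor_form_def by (simp add: orth if_distrib[of "\<lambda>c. c *\<^sub>R _"] of_bool_def cong: if_cong)

lemma bilinear_tractor_form: "x \<in> V \<Longrightarrow> bilinear (tractor_form x)"
  unfolding bilinear_def tractor_form_def
  by (intro conjI allI linearI)
    (simp_all add: linear_add[OF tractor_linear] linear_scale[OF tractor_linear] bilinear_ladd[OF bil]
      bilinear_lmul[OF bil] scaleR_add_left scaleR_add_right sum.distrib scaleR_sum_right mult.commute)

lemma smooth_tractor_form: "smooth_on V (\<lambda>x. tractor_form x v y)"
  unfolding tractor_form_def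
  by (intro smooth_on_sum open_V smooth_on_scaleR smooth_tractor smooth_G_fields smooth_on_const smooth_E)

text \<open>Integrability on pairs of frame fields. The sum over \<open>str\<close> is there because
  these fields do not commute. The six hypotheses make the Cotton tensor vanish, which in dimension
  three is the whole curvature of the tractor connection.\<close>

lemma tractor_flat_frame:
  assumes x: "x \<in> V"
    and hess: "D 1 (D 1 H) x = H x * (H x * H x - K x) - a x * D 2 H x"
      "D 2 (D 2 H) x = H x * (H x * H x - K x) + b x * D 1 H x"
      "D 1 (D 2 H) x = a x * D 1 H x" "D 2 (D 1 H) x = - (b x * D 2 H x)"
    and dK: "D 1 K x = 3 * H x * D 1 H x" "D 2 K x = 3 * H x * D 2 H x"
  shows "der (E i) (\<lambda>x. tractor j x y) x + tractor j x (tractor i x y) =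
    der (E j) (\<lambda>x. tractor i x y) x + tractor i x (tractor j x y) +
    (\<Sum>k\<in>UNIV. str i j k x *\<^sub>R tractor k x y)"
proof -
  obtain s m1 m2 m3 r where y: "y = (s, m1, m2, m3, r)" by (metis prod.exhaust)
  note d = coeff_differentiable[OF x]
  show ?thesis
    using exhaust_3[of i] exhaust_3[of j]
    unfolding y tractor_def prod.case
    by (elim disjE; simp add: der_Pair der_cdivide der_add der_diff der_minus der_mult der_const d basic[OF x]
      D_vertical_DH[OF x] hess dK sum_3 distinct_3 str_values[OF x] gauss[OF x] power2_eq_square; simp add: algebra_simps add_divide_distrib diff_divide_distrib)
qed

lemma restrict_circle_frame:
  assumes "open V'" "V' \<subseteq> V"
  shows "circle_frame V' G E a b H K"
proof -
  interpret F: orthonormal_frame V' G E by (rule restrict_frame[OF assms])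
  show ?thesis
    using assms(2) smooth_coeff[THEN smooth_on_subset, OF assms] bracket_horizontal bracket_vertical basic gauss
    by unfold_locales auto
qed

lemma linear_eq_0_on_frame:
  fixes L :: "'e \<Rightarrow> 'c::real_vector"
  assumes "x \<in> V" "linear L" "\<And>i. L (E i x) = 0"
  shows "L u = 0"
proof -
  have "L u = L (\<Sum>i\<in>UNIV. G x u (E i x) *\<^sub>R E i x)" by (simp add: span[OF assms(1)])
  also have "\<dots> = 0" by (simp add: linear_sum[OF assms(2)] linear_scale[OF assms(2)] assms(3))
  finally show ?thesis .
qed

lemma flat_of_equations:
  assumes hess: "\<And>x. x \<in> V \<Longrightarrow> D 1 (D 1 H) x = H x * (H x * H x - K x) - a x * D 2 H x"
      "\<And>x. x \<in> V \<Longrightarrow> D 2 (D 2 H) x = H x * (H x * H x - K x) + b x * D 1 H x"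
      "\<And>x. x \<in> V \<Longrightarrow> D 1 (D 2 H) x = a x * D 1 H x"
      "\<And>x. x \<in> V \<Longrightarrow> D 2 (D 1 H) x = - (b x * D 2 H x)"
    and dK: "\<And>x. x \<in> V \<Longrightarrow> D 1 K x = 3 * H x * D 1 H x"
      "\<And>x. x \<in> V \<Longrightarrow> D 2 K x = 3 * H x * D 2 H x"
    and x0: "x0 \<in> V"
  obtains r lam where "r > 0" "ball x0 r \<subseteq> V" "smooth_on (ball x0 r) lam"
    "\<And>x u v w. x \<in> ball x0 r \<Longrightarrow> riem (\<lambda>x u v. exp (2 * lam x) * G x u v) x u v w = 0"
proof -
  have flat: "fderiv (\<lambda>x. tractor_form x w y) x v + tractor_form x w (tractor_form x v y) =
      fderiv (\<lambda>x. tractor_form x v y) x w + tractor_form x v (tractor_form x w y)"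
    if x: "x \<in> V" for x v w y
  proof -
    note B = bilinear_tractor_form[OF x]
    \<comment> \<open>Flatness says that \<open>F\<close> is symmetric. The antisymmetric part is
      linear in each argument, so pairs of frame vectors suffice.\<close>
    define F where "F v w = fderiv (\<lambda>x. tractor_form x w y) x v +
      tractor_form x w (tractor_form x v y)" for v w
    have D: "linear (fderiv (\<lambda>x. tractor_form x w y) x)" for w
      by (rule linear_frechet_derivative[OF smooth_on_differentiable[OF smooth_tractor_form x]])
    have D2: "bilinear (\<lambda>w y. fderiv (\<lambda>x. tractor_form x w y) x v)" for v
      by (rule bilinear_frechet_derivative[OF open_V x bilinear_tractor_form smooth_tractor_form])
    have lin: "linear (\<lambda>v. F v w - F w v)" "linear (\<lambda>w. F v w - F w v)" for v w
      by (rule linearI; simp add: F_def linear_add[OF D] linear_scale[OF D] bilinear_ladd[OF D2]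
        bilinear_lmul[OF D2] bilinear_ladd[OF B] bilinear_lmul[OF B] bilinear_radd[OF B] bilinear_rmul[OF B]
        algebra_simps)+
    have frame: "F (E i x) (E j x) - F (E j x) (E i x) = 0" for i j
    proof -
      have F: "F (E i x) (E j x) = der (E i) (\<lambda>x. tractor j x y) x - tractor_form x (der (E i) (E j) x) y +
        tractor j x (tractor i x y)" for i j
      proof -
        have "((\<lambda>x. tractor_form x (E j x) y) has_derivative (\<lambda>v. fderiv (\<lambda>z. tractor_form z (E j x) y) x v +
            tractor_form x (fderiv (E j) x v) y + tractor_form x (E j x) 0)) (at x)"
          by (rule has_derivative_bilinear_family[where f = "\<lambda>x. x" and h = "\<lambda>_. y", OF bilinear_tractor_form
                smooth_tractor_form x has_derivative_ident smooth_on_has_derivative[OF smooth_E x] has_derivative_const])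
        from der_eqI[OF this, of "E i"]
        have "der (E i) (\<lambda>x. tractor_form x (E j x) y) x =
            fderiv (\<lambda>z. tractor_form z (E j x) y) x (E i x) + tractor_form x (der (E i) (E j) x) y"
          by (simp add: der_def bilinear_rzero[OF B])
        moreover have "der (E i) (\<lambda>x. tractor_form x (E j x) y) x = der (E i) (\<lambda>x. tractor j x y) x"
          by (rule der_cong[OF open_V x tractor_form_frame])
        ultimately show ?thesis by (simp add: F_def tractor_form_frame[OF x])
      qed
      have "tractor_form x (der (E i) (E j) x - der (E j) (E i) x) y = (\<Sum>k\<in>UNIV. str i j k x *\<^sub>R tractor k x y)"
      proof -
        have "linear (\<lambda>v. tractor_form x v y)" using B by (simp only: bilinear_def)
        then show ?thesis
          unfolding bracket_frame[OF x]
          by (simp only: linear_sum[of "\<lambda>v. tractor_form x v y"] linear_scale[of "\<lambda>v. tractor_form x v y"]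
            tractor_form_frame[OF x])
      qed
      then have "tractor_form x (der (E i) (E j) x) y - tractor_form x (der (E j) (E i) x) y =
          (\<Sum>k\<in>UNIV. str i j k x *\<^sub>R tractor k x y)"
        by (simp add: bilinear_lsub[OF B])
      then show ?thesis
        unfolding F using tractor_flat_frame[OF x hess[OF x] dK[OF x], of i j y] by (simp add: algebra_simps)
    qed
    have "F (E i x) w - F w (E i x) = 0" for i w
      by (rule linear_eq_0_on_frame[OF x lin(2) frame])
    from linear_eq_0_on_frame[OF x lin(1) this] show ?thesis by (simp add: F_def)
  qed
  obtain r Y where r: "r > 0" "ball x0 r \<subseteq> V" and sY: "smooth_on (ball x0 r) Y"
    and Y0: "Y x0 = (1, 0, 0, 0, 0)"
    and dY: "\<And>x. x \<in> ball x0 r \<Longrightarrow> (Y has_derivative (\<lambda>v. tractor_form x v (Y x))) (at x)"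
  proof (rule linear_frobenius[OF x0 bilinear_tractor_form smooth_tractor_form flat])
    fix r and Y :: "'e \<Rightarrow> real \<times> real \<times> real \<times> real \<times> real"
    assume "r > 0" "ball x0 r \<subseteq> V" "smooth_on (ball x0 r) Y" "Y x0 = (1, 0, 0, 0, 0)"
      "\<And>x. x \<in> ball x0 r \<Longrightarrow> (Y has_derivative (\<lambda>v. tractor_form x v (Y x))) (at x)"
    then show thesis by (rule that)
  qed
  define s where "s x = fst (Y x)" for x
  define m1 where "m1 x = fst (snd (Y x))" for x
  define m2 where "m2 x = fst (snd (snd (Y x)))" for x
  define m3 where "m3 x = fst (snd (snd (snd (Y x))))" for x
  define q where "q x = snd (snd (snd (snd (Y x))))" for x
  note defs = s_def m1_def m2_def m3_def q_def
  have Yeq: "Y x = (s x, m1 x, m2 x, m3 x, q x)" for x by (simp add: defs)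
  have comp: "(s has_derivative (\<lambda>v. fst (tractor_form x v (Y x)))) (at x)"
    "(m1 has_derivative (\<lambda>v. fst (snd (tractor_form x v (Y x))))) (at x)"
    "(m2 has_derivative (\<lambda>v. fst (snd (snd (tractor_form x v (Y x)))))) (at x)"
    "(m3 has_derivative (\<lambda>v. fst (snd (snd (snd (tractor_form x v (Y x))))))) (at x)"
    "(q has_derivative (\<lambda>v. snd (snd (snd (snd (tractor_form x v (Y x))))))) (at x)"
    if "x \<in> ball x0 r" for x
    unfolding defs[abs_def]
    by (intro has_derivative_fst has_derivative_snd dY[OF that])+
  have Dcomp: "D i s x = fst (tractor i x (Y x))" "D i m1 x = fst (snd (tractor i x (Y x)))"
    "D i m2 x = fst (snd (snd (tractor i x (Y x))))" "D i m3 x = fst (snd (snd (snd (tractor i x (Y x)))))"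
    "D i q x = snd (snd (snd (snd (tractor i x (Y x)))))"
    if x: "x \<in> ball x0 r" for i x
  proof -
    have xV: "x \<in> V" using x r(2) by auto
    show "D i s x = fst (tractor i x (Y x))" "D i m1 x = fst (snd (tractor i x (Y x)))"
      "D i m2 x = fst (snd (snd (tractor i x (Y x))))" "D i m3 x = fst (snd (snd (snd (tractor i x (Y x)))))"
      "D i q x = snd (snd (snd (snd (tractor i x (Y x)))))"
      by (simp_all add: der_eqI[OF comp(1)[OF x]] der_eqI[OF comp(2)[OF x]] der_eqI[OF comp(3)[OF x]]
        der_eqI[OF comp(4)[OF x]] der_eqI[OF comp(5)[OF x]] tractor_form_frame[OF xV])
  qed
  \<comment> \<open>This is the quadratic form of the tractor metric. Each \<open>tractor i\<close>
    is skew for it, so its derivative along every frame field vanishes.\<close>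
  have null: "2 * (s x * q x) + m1 x * m1 x + m2 x * m2 x + m3 x * m3 x = 0" if x: "x \<in> ball x0 r" for x
  proof -
    let ?N = "\<lambda>x. 2 * (s x * q x) + m1 x * m1 x + m2 x * m2 x + m3 x * m3 x"
    have "(?N has_derivative (\<lambda>v. 0)) (at z within ball x0 r)" if z: "z \<in> ball x0 r" for z
    proof -
      have zV: "z \<in> V" using z r by auto
      note d = differentiableI[OF comp(1)[OF z]] differentiableI[OF comp(2)[OF z]] differentiableI[OF comp(3)[OF z]]
        differentiableI[OF comp(4)[OF z]] differentiableI[OF comp(5)[OF z]]
      have dN: "?N differentiable (at z)" using d by simp
      have "D i ?N z = 0" for i
        using exhaust_3[of i]
        by (elim disjE; simp add: der_add der_mult der_const d Dcomp[OF z] Yeq tractor_def distinct_3; simp add: algebra_simps)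
      then have "fderiv ?N z v = 0" for v
        unfolding der_def by (rule linear_eq_0_on_frame[OF zV linear_frechet_derivative[OF dN]])
      then have "fderiv ?N z = (\<lambda>v. 0)" by (rule ext)
      then have "(?N has_derivative (\<lambda>v. 0)) (at z)"
        using frechet_derivative_has[OF dN] by (simp only:)
      then show ?thesis by (rule has_derivative_at_withinI)
    qed
    then have "\<exists>k. \<forall>z\<in>ball x0 r. ?N z = k"
      by (rule has_derivative_zero_constant[OF convex_ball])
    then obtain k where k: "\<And>z. z \<in> ball x0 r \<Longrightarrow> ?N z = k" by blast
    have "?N x0 = 0" by (simp add: defs Y0)
    then show ?thesis using k[of x0] k[OF x] r(1) by simp
  qed
  have "isCont s x0" using comp(1)[of x0] r(1) has_derivative_continuous by auto
  moreover have "s x0 = 1" by (simp add: s_def Y0)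
  ultimately obtain d where d: "d > 0" "\<And>x. dist x x0 < d \<Longrightarrow> dist (s x) 1 < 1"
    unfolding continuous_at_eps_delta by (metis zero_less_one)
  \<comment> \<open>On the smaller ball \<open>s\<close> is within 1 of its value 1 at the centre,
    hence positive, and its logarithm exists.\<close>
  define r' where "r' = min r d"
  have r': "r' > 0" "ball x0 r' \<subseteq> V" "ball x0 r' \<subseteq> ball x0 r" using r d by (auto simp: r'_def)
  have pos: "s x > 0" if "x \<in> ball x0 r'" for x
    using d(2)[of x] that by (auto simp: r'_def dist_real_def dist_commute)
  have ss: "smooth_on (ball x0 r') s"
    unfolding s_def[abs_def]
    by (intro smooth_on_bounded_linear[OF bounded_linear_fst] smooth_on_subset[OF sY] open_ball r')
  define lam where "lam x = - ln (s x)" for x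
  have lam: "smooth_on (ball x0 r') lam"
    unfolding lam_def[abs_def] by (intro smooth_on_minus smooth_on_ln ss pos)
  have exp_lam: "exp (- lam x) = s x" if "x \<in> ball x0 r'" for x
    using pos[OF that] by (simp add: lam_def)
  interpret F: circle_frame "ball x0 r'" G E a b H K
    by (rule restrict_circle_frame[OF open_ball r'(2)])
  show thesis
  proof (rule that[OF r'(1,2) lam])
    fix x u v w assume x: "x \<in> ball x0 r'"
    have xr: "x \<in> ball x0 r" using x r' by auto
    have D1: "D i (\<lambda>x. exp (- lam x)) z = fst (tractor i z (Y z))" if z: "z \<in> ball x0 r'" for i z
      using F.D_cong[OF z exp_lam] Dcomp(1)[of z i] z r'(3) by auto
    \<comment> \<open>The first derivatives of \<open>exp (- lam)\<close> are \<open>m1\<close>,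
      \<open>m2\<close>, \<open>m3\<close> on the whole ball, so the second derivatives are again
      given by rows of \<open>tractor\<close>.\<close>
    have D2: "D i (D 1 (\<lambda>x. exp (- lam x))) x = D i m1 x" "D i (D 2 (\<lambda>x. exp (- lam x))) x = D i m2 x"
      "D i (D 3 (\<lambda>x. exp (- lam x))) x = D i m3 x" for i
      by (rule F.D_cong[OF x], simp add: D1 Yeq tractor_def distinct_3)+
    show "riem (\<lambda>x u v. exp (2 * lam x) * G x u v) x u v w = 0"
      by (rule F.flat_of_second_derivatives[OF lam x, of "q x"];
        simp add: D1[OF x] D2 Dcomp[OF xr] Yeq tractor_def distinct_3 exp_lam[OF x])
        (use null[OF xr] in linarith)
  qed
qed

end

section \<open>Surfaces\<close>

definition area_of :: "(real^2 \<Rightarrow> real^2 \<Rightarrow> real^2 \<Rightarrow> real) \<Rightarrow> real^2 \<Rightarrow> real^2 \<Rightarrow> real^2 \<Rightarrow> real" where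
  "area_of h y u v =
     sqrt (det (\<chi> i j. h y (axis i 1) (axis j 1))) * det (vector [u, v] :: real^2^2)"

text \<open>The Gram-Schmidt process on the coordinate fields. The second vector is first multiplied
  by \<open>h y X X\<close>, which avoids a quotient; its squared length is then
  \<open>h y X X\<close> times the Gram determinant.\<close>

definition gram_schmidt :: "(real^2 \<Rightarrow> real^2 \<Rightarrow> real^2 \<Rightarrow> real) \<Rightarrow> 2 \<Rightarrow> real^2 \<Rightarrow> real^2" where
  "gram_schmidt h i y = (let X = axis 1 1; Y = axis 2 1 in
     if i = 1 then inverse (sqrt (h y X X)) *\<^sub>R X
     else inverse (sqrt (h y X X * (h y X X * h y Y Y - h y X Y * h y X Y))) *\<^sub>R (h y X X *\<^sub>R Y - h y X Y *\<^sub>R X))"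

lemma axis_sum_2: "(u :: real^2) = u $ 1 *\<^sub>R axis 1 1 + u $ 2 *\<^sub>R axis 2 1"
  by (simp add: vec_eq_iff forall_2 axis_def)

locale surface_chart =
  fixes W :: "(real^2) set" and h :: "real^2 \<Rightarrow> real^2 \<Rightarrow> real^2 \<Rightarrow> real"
  assumes open_W: "open W"
    and bil_h: "\<And>y. y \<in> W \<Longrightarrow> bilinear (h y)"
    and sym_h: "\<And>y u v. y \<in> W \<Longrightarrow> h y u v = h y v u"
    and pos_h: "\<And>y u. y \<in> W \<Longrightarrow> u \<noteq> 0 \<Longrightarrow> h y u u > 0"
    and smooth_h: "\<And>u v. smooth_on W (\<lambda>y. h y u v)"
begin

abbreviation "X \<equiv> axis 1 1 :: real^2"
abbreviation "Y \<equiv> axis 2 1 :: real^2"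
abbreviation "e \<equiv> gram_schmidt h"

lemma disc_pos:
  assumes y: "y \<in> W"
  shows "h y X X > 0" "h y X X * h y Y Y - h y X Y * h y X Y > 0"
proof -
  show 1: "h y X X > 0" by (rule pos_h[OF y]) (simp add: axis_eq_0_iff)
  let ?u = "h y X X *\<^sub>R Y - h y X Y *\<^sub>R X"
  have "?u $ 2 \<noteq> 0" using 1 by (simp add: axis_def)
  then have "?u \<noteq> 0" by (metis zero_index)
  then have "h y ?u ?u > 0" by (rule pos_h[OF y])
  moreover have "h y ?u ?u = h y X X * (h y X X * h y Y Y - h y X Y * h y X Y)"
    using sym_h[OF y, of Y X]
    by (simp add: bilinear_lsub[OF bil_h[OF y]] bilinear_rsub[OF bil_h[OF y]] bilinear_lmul[OF bil_h[OF y]]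
      bilinear_rmul[OF bil_h[OF y]] algebra_simps)
  ultimately show "h y X X * h y Y Y - h y X Y * h y X Y > 0"
    using 1 by (simp add: zero_less_mult_iff)
qed

text \<open>The process keeps the orientation, so the area is 1 and not -1. This fixes the sign of
  \<open>H\<close> in the bracket of the lifted frame.\<close>

lemma area_frame: "y \<in> W \<Longrightarrow> area_of h y (e 1 y) (e 2 y) = 1"
proof -
  assume y: "y \<in> W"
  note p = disc_pos[OF y]
  have "sqrt (h y X X * (h y X X * h y Y Y - h y X Y * h y X Y)) * sqrt (h y X X) =
      h y X X * sqrt (h y X X * h y Y Y - h y X Y * h y X Y)"
    using p by (simp add: real_sqrt_mult)
  then show ?thesis
    using p sym_h[OF y, of Y X]
    by (simp add: area_of_def gram_schmidt_def det_2 Let_def vector_2 axis_def field_simps)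
qed

lemma area_zero: "area_of h y 0 v = 0" "area_of h y u 0 = 0"
  by (simp_all add: area_of_def det_2 vector_2)

sublocale orthonormal_frame W h e
proof
  fix y assume y: "y \<in> W"
  note p = disc_pos[OF y]
  note b = bilinear_lsub[OF bil_h[OF y]] bilinear_rsub[OF bil_h[OF y]] bilinear_lmul[OF bil_h[OF y]]
      bilinear_rmul[OF bil_h[OF y]] bilinear_ladd[OF bil_h[OF y]] bilinear_radd[OF bil_h[OF y]]
  let ?A = "h y X X" and ?D = "h y X X * h y Y Y - h y X Y * h y X Y"
  have n: "inverse (sqrt ?A) * (inverse (sqrt ?A) * ?A) = 1"
    "inverse (sqrt (?A * ?D)) * (inverse (sqrt (?A * ?D)) * (?A * ?D)) = 1"
    using p by (simp_all add: field_simps)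
  show orth: "h y (e i y) (e j y) = of_bool (i = j)" for i j
  proof -
    have "h y (e 1 y) (e 1 y) = 1"
      using n(1) by (simp add: gram_schmidt_def Let_def b)
    moreover have "h y (e 1 y) (e 2 y) = 0"
      by (simp add: gram_schmidt_def Let_def b)
    moreover have "h y (e 2 y) (e 2 y) = inverse (sqrt (?A * ?D)) * (inverse (sqrt (?A * ?D)) * (?A * ?D))"
      using sym_h[OF y, of Y X] by (simp add: gram_schmidt_def Let_def b algebra_simps)
    ultimately show ?thesis
      using exhaust_2[of i] exhaust_2[of j] sym_h[OF y, of "e 2 y" "e 1 y"] n(2) by auto
  qed
  show "(\<Sum>i\<in>UNIV. h y u (e i y) *\<^sub>R e i y) = u" for u
  proof -
    \<comment> \<open>The part of \<open>u\<close> orthogonal to both frame vectors. It is then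
      orthogonal to \<open>X\<close> and \<open>Y\<close>, hence to itself.\<close>
    define w where "w = u - (\<Sum>i\<in>UNIV. h y u (e i y) *\<^sub>R e i y)"
    have we: "h y w (e i y) = 0" for i
      using exhaust_2[of i] by (auto simp: w_def sum_2 b orth)
    have "X = sqrt ?A *\<^sub>R e 1 y" using p by (simp add: gram_schmidt_def Let_def)
    then have "h y w X = h y w (sqrt ?A *\<^sub>R e 1 y)" by (rule arg_cong)
    then have wX: "h y w X = 0" by (simp only: b we) simp
    have "?A *\<^sub>R Y - h y X Y *\<^sub>R X = sqrt (?A * ?D) *\<^sub>R e 2 y" using p by (simp add: gram_schmidt_def Let_def)
    then have "h y w (?A *\<^sub>R Y - h y X Y *\<^sub>R X) = 0" using we[of 2] b(4) by simp
    then have wY: "h y w Y = 0" using p(1) by (simp add: b wX)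
    have "h y w w = h y w (w $ 1 *\<^sub>R X + w $ 2 *\<^sub>R Y)" using axis_sum_2[of w] by (rule arg_cong)
    then have "h y w w = 0" by (simp add: b wX wY)
    then have "w = 0" using pos_h[OF y, of w] by fastforce
    then show ?thesis by (simp add: w_def)
  qed
next
  have prod: "h y X X * (h y X X * h y Y Y - h y X Y * h y X Y) > 0" if "y \<in> W" for y
    by (intro mult_pos_pos disc_pos that)
  show "smooth_on W (e i)" for i
    unfolding gram_schmidt_def Let_def
  proof (cases "i = 1")
    case True
    show "smooth_on W (\<lambda>y. if i = 1 then inverse (sqrt (h y X X)) *\<^sub>R X
      else inverse (sqrt (h y X X * (h y X X * h y Y Y - h y X Y * h y X Y))) *\<^sub>R (h y X X *\<^sub>R Y - h y X Y *\<^sub>R X))"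
      unfolding if_P[OF True]
      by (intro smooth_on_scaleR smooth_on_inverse smooth_on_sqrt smooth_h smooth_on_const open_W)
        (auto dest: disc_pos simp: less_le)
  next
    case False
    show "smooth_on W (\<lambda>y. if i = 1 then inverse (sqrt (h y X X)) *\<^sub>R X
      else inverse (sqrt (h y X X * (h y X X * h y Y Y - h y X Y * h y X Y))) *\<^sub>R (h y X X *\<^sub>R Y - h y X Y *\<^sub>R X))"
      unfolding if_not_P[OF False]
      by (intro smooth_on_scaleR smooth_on_inverse smooth_on_sqrt smooth_on_diff smooth_on_mult smooth_h
          smooth_on_const open_W prod) (auto dest: prod)
  qed
qed (use open_W bil_h sym_h smooth_h in auto)

text \<open>Composed with the projection, \<open>conn1\<close> and \<open>conn2\<close> become the
  coefficients \<open>a\<close> and \<open>b\<close> of \<open>circle_frame\<close>.\<close>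

definition conn1 :: "real^2 \<Rightarrow> real" where "conn1 = str 1 2 1"
definition conn2 :: "real^2 \<Rightarrow> real" where "conn2 = str 1 2 2"

lemma str_2: "y \<in> W \<Longrightarrow> str i i k y = 0" "y \<in> W \<Longrightarrow> str 2 1 k y = - str 1 2 k y"
  by (simp_all add: str_def bilinear_lzero[OF bil] bilinear_lsub[OF bil])

lemma gam_2:
  assumes y: "y \<in> W"
  shows "gam 1 1 1 y = 0" "gam 1 1 2 y = - conn1 y" "gam 1 2 1 y = conn1 y" "gam 1 2 2 y = 0"
    "gam 2 1 1 y = 0" "gam 2 1 2 y = - conn2 y" "gam 2 2 1 y = conn2 y" "gam 2 2 2 y = 0"
  by (simp_all add: gam_def str_2[OF y] conn1_def conn2_def)

lemma smooth_conn: "smooth_on W conn1" "smooth_on W conn2"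
  unfolding conn1_def conn2_def by (rule smooth_str)+

lemma bracket_e: "y \<in> W \<Longrightarrow> der (e 1) (e 2) y - der (e 2) (e 1) y = conn1 y *\<^sub>R e 1 y + conn2 y *\<^sub>R e 2 y"
  by (simp add: bracket_frame sum_2 conn1_def conn2_def)

text \<open>Cartan's structure equations for a frame with bracket \<open>conn1 e1 + conn2 e2\<close>
  lead to this expression. As a definition it is visibly smooth, and it pulls back along the lifted
  frame term by term.\<close>

definition gauss_curv :: "real^2 \<Rightarrow> real" where
  "gauss_curv y = der (e 1) conn2 y - der (e 2) conn1 y - (conn1 y)\<^sup>2 - (conn2 y)\<^sup>2"

lemma gauss_curv: "y \<in> W \<Longrightarrow> h y (riem h y (e 1 y) (e 2 y) (e 2 y)) (e 1 y) = gauss_curv y"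
proof -
  assume y: "y \<in> W"
  have "der X (gam 2 2 1) y = der X conn2 y" "der X (gam 1 2 1) y = der X conn1 y" for X
    using der_cong[OF open_W y] gam_2 by metis+
  then show ?thesis
    unfolding G_riem_frame[OF y] curv_def gauss_curv_def
    by (simp add: sum_2 gam_2[OF y] str_2[OF y] conn1_def[symmetric] conn2_def[symmetric] power2_eq_square)
qed

lemma smooth_gauss_curv: "smooth_on W gauss_curv"
  unfolding gauss_curv_def[abs_def]
  by (intro smooth_on_diff smooth_on_der smooth_E smooth_conn smooth_on_power)

definition grad :: "(real^2 \<Rightarrow> real) \<Rightarrow> real^2 \<Rightarrow> real^2" where
  "grad f y = (\<Sum>i\<in>UNIV. der (e i) f y *\<^sub>R e i y)"

text \<open>The expansion in the frame exhibits the vector that \<open>gradient\<close> describes by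
  \<open>THE\<close>.\<close>

lemma grad:
  assumes f: "smooth_on W f" and y: "y \<in> W"
  shows "(THE w. \<forall>v. h y w v = fderiv f y v) = grad f y"
proof (rule the_equality)
  have lin: "linear (fderiv f y)"
    by (rule linear_frechet_derivative[OF smooth_on_differentiable[OF f y]])
  show "\<forall>v. h y (grad f y) v = fderiv f y v"
  proof
    fix v
    have "fderiv f y v = fderiv f y (\<Sum>i\<in>UNIV. h y v (e i y) *\<^sub>R e i y)"
      by (simp only: span[OF y])
    also have "\<dots> = h y (grad f y) v"
      by (simp add: linear_sum[OF lin] linear_scale[OF lin] grad_def G_sum_left[OF y] der_def sym[OF y, of v] mult.commute)
    finally show "h y (grad f y) v = fderiv f y v" ..
  qed
  then show "w = grad f y" if "\<forall>v. h y w v = fderiv f y v" for w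
    using that by (intro frame_eqI[OF y]) simp
qed

text \<open>Both sides are linear in \<open>u\<close>, so the equation is tested on the frame. The
  component of the Hessian for \<open>e j\<close> and \<open>e k\<close> is the iterated derivative
  of \<open>f\<close> plus the terms with \<open>gam j i k\<close>.\<close>

lemma hessian_equations:
  assumes f: "smooth_on W f" and y: "y \<in> W"
  shows "(\<forall>u. fderiv (grad f) y u + chr h y u (grad f y) = k *\<^sub>R u) \<longleftrightarrow>
    der (e 1) (der (e 1) f) y + conn1 y * der (e 2) f y = k \<and>
    der (e 2) (der (e 2) f) y - conn2 y * der (e 1) f y = k \<and>
    der (e 1) (der (e 2) f) y = conn1 y * der (e 1) f y \<and>
    der (e 2) (der (e 1) f) y = - conn2 y * der (e 2) f y" (is "?L \<longleftrightarrow> ?R")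
proof -
  have sg: "smooth_on W (grad f)"
    unfolding grad_def[abs_def]
    by (intro smooth_on_sum open_W smooth_on_scaleR smooth_on_der smooth_E f)
  define Q where "Q u = fderiv (grad f) y u + chr h y u (grad f y)" for u
  have D: "linear (fderiv (grad f) y)"
    by (rule linear_frechet_derivative[OF smooth_on_differentiable[OF sg y]])
  have lin: "linear (\<lambda>u. Q u - k *\<^sub>R u)"
    by (rule linearI) (simp_all add: Q_def linear_add[OF D] linear_scale[OF D]
        bilinear_ladd[OF bilinear_chr[OF y]] bilinear_lmul[OF bilinear_chr[OF y]] algebra_simps)
  have Q: "Q (e j y) = (\<Sum>k\<in>UNIV. (der (e j) (der (e k) f) y + (\<Sum>i\<in>UNIV. der (e i) f y * gam j i k y)) *\<^sub>R e k y)" for j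
  proof -
    have "Q (e j y) = cov h (e j) (\<lambda>y. \<Sum>k\<in>UNIV. der (e k) f y *\<^sub>R e k y) y"
      by (simp add: Q_def cov_def der_def[of _ "\<lambda>y. \<Sum>k\<in>UNIV. der (e k) f y *\<^sub>R e k y"] grad_def[abs_def])
    also have "\<dots> = (\<Sum>k\<in>UNIV. der (e j) (der (e k) f) y *\<^sub>R e k y) +
        (\<Sum>i\<in>UNIV. \<Sum>k\<in>UNIV. (der (e i) f y * gam j i k y) *\<^sub>R e k y)"
      by (simp add: cov_sum[OF y smooth_on_der[OF smooth_E f]] cov_frame[OF y] sum.distrib scaleR_sum_right)
    also have "(\<Sum>i\<in>UNIV. \<Sum>k\<in>UNIV. (der (e i) f y * gam j i k y) *\<^sub>R e k y) =
        (\<Sum>k\<in>UNIV. \<Sum>i\<in>UNIV. (der (e i) f y * gam j i k y) *\<^sub>R e k y)"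
      by (rule sum.swap)
    finally show ?thesis
      by (simp add: scaleR_add_left sum.distrib scaleR_sum_left)
  qed
  have Qh: "h y (Q (e j y)) (e k y) = der (e j) (der (e k) f) y + (\<Sum>i\<in>UNIV. der (e i) f y * gam j i k y)" for j k
    unfolding Q by (rule G_frame_sum[OF y])
  have "?L \<longleftrightarrow> (\<forall>j. Q (e j y) = k *\<^sub>R e j y)"
  proof
    assume *: "\<forall>j. Q (e j y) = k *\<^sub>R e j y"
    have "Q u - k *\<^sub>R u = 0" for u
    proof -
      have "Q u - k *\<^sub>R u = (\<lambda>u. Q u - k *\<^sub>R u) (\<Sum>i\<in>UNIV. h y u (e i y) *\<^sub>R e i y)"
        by (simp only: span[OF y])
      also have "\<dots> = 0" by (simp only: linear_sum[OF lin] linear_scale[OF lin] *) simp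
      finally show ?thesis .
    qed
    then show ?L by (simp add: Q_def)
  qed (simp add: Q_def)
  also have "\<dots> \<longleftrightarrow> (\<forall>j l. h y (Q (e j y)) (e l y) = h y (k *\<^sub>R e j y) (e l y))"
    using frame_eqI[OF y] by metis
  also have "\<dots> \<longleftrightarrow> ?R"
    unfolding Qh bilinear_lmul[OF bil[OF y]] orth[OF y]
    by (auto simp: forall_2 sum_2 gam_2[OF y] algebra_simps)
  finally show ?thesis .
qed

end

section \<open>Coordinates of a circle bundle\<close>

text \<open>The matrix with rows \<open>x\<close>, \<open>y\<close>, \<open>z\<close> has trivial
  kernel, and the triple product is its determinant.\<close>

lemma triple_product_nonzero:
  fixes x y z :: "real^3"
  assumes "\<And>u. x \<bullet> u = 0 \<Longrightarrow> y \<bullet> u = 0 \<Longrightarrow> z \<bullet> u = 0 \<Longrightarrow> u = 0"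
  shows "x \<bullet> cross3 y z \<noteq> 0"
proof -
  let ?A = "vector [x, y, z] :: real^3^3"
  have "u = 0" if "?A *v u = 0" for u
  proof -
    have "(?A *v u) $ i = 0" for i using that by simp
    then have "row i ?A \<bullet> u = 0" for i by (simp add: matrix_vector_mult_def row_def inner_vec_def)
    from this[of 1] this[of 2] this[of 3] show ?thesis
      by (intro assms) (simp_all add: row_def vec_lambda_eta vector_3)
  qed
  then have "invertible ?A"
    by (simp add: invertible_left_inverse matrix_left_invertible_ker)
  then show ?thesis by (simp add: dot_cross_det invertible_det_nz)
qed

lemma linear_functional_vector:
  fixes \<phi> :: "real^'n \<Rightarrow> real"
  assumes "linear \<phi>"
  shows "(\<chi> j. \<phi> (axis j 1)) \<bullet> u = \<phi> u"
proof -
  have "\<phi> u = \<phi> (\<Sum>j\<in>UNIV. (u $ j) *\<^sub>R axis j 1)"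
    using basis_expansion[of u] by (simp add: scalar_mult_eq_scaleR)
  also have "\<dots> = (\<Sum>j\<in>UNIV. u $ j * \<phi> (axis j 1))"
    by (simp add: linear_sum[OF assms] linear_scale[OF assms])
  finally show ?thesis by (simp add: inner_vec_def mult.commute)
qed

lemma smooth_on_vec:
  fixes f :: "'a::euclidean_space \<Rightarrow> real^'n"
  assumes "open S" "\<And>j. smooth_on S (\<lambda>x. f x $ j)"
  shows "smooth_on S f"
proof (rule smooth_on_cong)
  show "smooth_on S (\<lambda>x. \<Sum>j\<in>UNIV. (f x $ j) *\<^sub>R axis j 1)"
    by (intro smooth_on_sum smooth_on_scaleR smooth_on_const assms)
  show "(\<Sum>j\<in>UNIV. (f x $ j) *\<^sub>R axis j 1) = f x" for x
    using basis_expansion[of "f x"] by (simp add: scalar_mult_eq_scaleR)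
qed

lemma smooth_on_cross3: "smooth_on S f \<Longrightarrow> smooth_on S g \<Longrightarrow> smooth_on S (\<lambda>x. cross3 (f x) (g x))"
  by (rule smooth_on_bilinear[OF bilinear_cross[unfolded bilinear_conv_bounded_bilinear]])

text \<open>A chart of the total space over a chart of the base. With \<eta> =
  \<open>GP x (T x)\<close>, the assumption \<open>split_P\<close> says that the metric is \<eta>^2
  plus the pullback of \<open>h\<close>, and \<open>d_eta\<close> that d\<eta> is \<open>H\<close>
  times the pullback of the area form. The group action survives only through its generator
  \<open>T\<close>. \<open>H\<close> is a bare function, as in
  \<open>curvature_function\<close>.\<close>

locale circle_chart = surface_chart W h
  for W :: "(real^2) set" and h :: "real^2 \<Rightarrow> real^2 \<Rightarrow> real^2 \<Rightarrow> real" +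
  fixes V :: "(real^3) set" and GP :: "real^3 \<Rightarrow> real^3 \<Rightarrow> real^3 \<Rightarrow> real" and q :: "real^3 \<Rightarrow> real^2"
    and T :: "real^3 \<Rightarrow> real^3" and H :: "real^2 \<Rightarrow> real"
  assumes open_P: "open V"
    and bil_P: "\<And>x. x \<in> V \<Longrightarrow> bilinear (GP x)"
    and sym_P: "\<And>x u v. x \<in> V \<Longrightarrow> GP x u v = GP x v u"
    and pos_P: "\<And>x u. x \<in> V \<Longrightarrow> u \<noteq> 0 \<Longrightarrow> GP x u u > 0"
    and smooth_P: "\<And>u v. smooth_on V (\<lambda>x. GP x u v)"
    and smooth_q: "smooth_on V q" and q_in: "\<And>x. x \<in> V \<Longrightarrow> q x \<in> W"
    and smooth_T: "smooth_on V T" and GP_T: "\<And>x. x \<in> V \<Longrightarrow> GP x (T x) (T x) = 1"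
    and Dq_T: "\<And>x. x \<in> V \<Longrightarrow> fderiv q x (T x) = 0"
    and split_P: "\<And>x u v. x \<in> V \<Longrightarrow> GP x u v = GP x (T x) u * GP x (T x) v +
      h (q x) (fderiv q x u) (fderiv q x v)"
    and d_eta: "\<And>x u v. x \<in> V \<Longrightarrow>
      fderiv (\<lambda>x. GP x (T x) v) x u - fderiv (\<lambda>x. GP x (T x) u) x v =
      H (q x) * area_of h (q x) (fderiv q x u) (fderiv q x v)"
begin

abbreviation Dq :: "real^3 \<Rightarrow> real^3 \<Rightarrow> real^2" where
  "Dq x \<equiv> fderiv q x"

text \<open>The coframe is stored as vectors of \<open>real^3\<close>, so that cross products give
  the dual frame by Cramer's rule; smoothness of the lifts is then immediate.\<close>

definition cov1 :: "real^3 \<Rightarrow> real^3" where "cov1 x = (\<chi> j. h (q x) (e 1 (q x)) (Dq x (axis j 1)))"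
definition cov2 :: "real^3 \<Rightarrow> real^3" where "cov2 x = (\<chi> j. h (q x) (e 2 (q x)) (Dq x (axis j 1)))"
definition cov3 :: "real^3 \<Rightarrow> real^3" where "cov3 x = (\<chi> j. GP x (T x) (axis j 1))"
definition vol :: "real^3 \<Rightarrow> real" where "vol x = cov1 x \<bullet> cross3 (cov2 x) (cov3 x)"

text \<open>The frame dual to the coframe: horizontal lifts of \<open>e 1\<close>, \<open>e 2\<close> together with \<open>T\<close>.\<close>

definition lift :: "3 \<Rightarrow> real^3 \<Rightarrow> real^3" where
  "lift i x = (if i = 1 then inverse (vol x) *\<^sub>R cross3 (cov2 x) (cov3 x)
     else if i = 2 then inverse (vol x) *\<^sub>R cross3 (cov3 x) (cov1 x) else T x)"

lemma linear_Dq: "x \<in> V \<Longrightarrow> linear (Dq x)"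
  by (rule linear_frechet_derivative[OF smooth_on_differentiable[OF smooth_q]])

lemma covectors:
  assumes x: "x \<in> V"
  shows "cov1 x \<bullet> u = h (q x) (e 1 (q x)) (Dq x u)" "cov2 x \<bullet> u = h (q x) (e 2 (q x)) (Dq x u)"
    "cov3 x \<bullet> u = GP x (T x) u"
proof -
  have lin: "linear (\<lambda>u. h (q x) w (Dq x u))" for w
    using linear_compose[OF linear_Dq[OF x], of "h (q x) w"] bil[OF q_in[OF x]]
    by (simp add: bilinear_def o_def)
  show "cov1 x \<bullet> u = h (q x) (e 1 (q x)) (Dq x u)"
    unfolding cov1_def by (rule linear_functional_vector[OF lin])
  show "cov2 x \<bullet> u = h (q x) (e 2 (q x)) (Dq x u)"
    unfolding cov2_def by (rule linear_functional_vector[OF lin])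
  have "linear (GP x (T x))" using bil_P[OF x] by (simp add: bilinear_def)
  from linear_functional_vector[OF this] show "cov3 x \<bullet> u = GP x (T x) u" unfolding cov3_def .
qed

text \<open>A tangent vector is determined by its projection and its value under \<eta>, because
  \<open>split_P\<close> expresses the positive definite metric through these two. Brackets are
  compared in this way.\<close>

lemma vector_eq_0:
  assumes x: "x \<in> V" and "Dq x u = 0" "GP x (T x) u = 0"
  shows "u = 0"
proof (rule ccontr)
  assume "u \<noteq> 0"
  then have "GP x u u > 0" by (rule pos_P[OF x])
  moreover have "GP x u u = 0"
    using split_P[OF x, of u u] assms(2,3) bilinear_lzero[OF bil[OF q_in[OF x]]] by simp
  ultimately show False by simp
qed

lemma vector_eqI:
  assumes x: "x \<in> V" and "Dq x u = Dq x v" "GP x (T x) u = GP x (T x) v"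
  shows "u = v"
  using vector_eq_0[OF x, of "u - v"] assms(2,3)
  by (simp add: linear_diff[OF linear_Dq[OF x]] bilinear_rsub[OF bil_P[OF x]])

lemma vol_nonzero: "x \<in> V \<Longrightarrow> vol x \<noteq> 0"
  unfolding vol_def
proof (rule triple_product_nonzero)
  fix u assume x: "x \<in> V" and u: "cov1 x \<bullet> u = 0" "cov2 x \<bullet> u = 0" "cov3 x \<bullet> u = 0"
  have "h (q x) (Dq x u) (e i (q x)) = h (q x) 0 (e i (q x))" for i
    using u(1,2) exhaust_2[of i] sym[OF q_in[OF x], of "Dq x u"]
    by (auto simp: covectors[OF x] bilinear_lzero[OF bil[OF q_in[OF x]]])
  then have "Dq x u = 0" by (rule frame_eqI[OF q_in[OF x]])
  then show "u = 0" using u(3) by (intro vector_eq_0[OF x]) (simp_all add: covectors[OF x])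
qed

lemma Dq_lift:
  assumes x: "x \<in> V"
  shows "Dq x (lift 1 x) = e 1 (q x)" "Dq x (lift 2 x) = e 2 (q x)" "Dq x (lift 3 x) = 0"
    "GP x (T x) (lift 1 x) = 0" "GP x (T x) (lift 2 x) = 0" "GP x (T x) (lift 3 x) = 1"
proof -
  note y = q_in[OF x]
  have v: "vol x \<noteq> 0" by (rule vol_nonzero[OF x])
  have t: "cov2 x \<bullet> cross3 (cov3 x) (cov1 x) = vol x"
    unfolding vol_def by (simp add: cross3_simps)
  have 1: "cov1 x \<bullet> lift 1 x = 1" "cov2 x \<bullet> lift 1 x = 0" "cov3 x \<bullet> lift 1 x = 0"
    "cov1 x \<bullet> lift 2 x = 0" "cov2 x \<bullet> lift 2 x = 1" "cov3 x \<bullet> lift 2 x = 0"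
    using v t by (simp_all add: lift_def dot_cross_self vol_def[symmetric])
  show "GP x (T x) (lift 1 x) = 0" "GP x (T x) (lift 2 x) = 0" "GP x (T x) (lift 3 x) = 1"
    using 1(3,6) GP_T[OF x] unfolding covectors[OF x] by (simp_all add: lift_def[of 3])
  show "Dq x (lift 3 x) = 0" using Dq_T[OF x] by (simp add: lift_def)
  have "h (q x) (Dq x (lift 1 x)) (e i (q x)) = h (q x) (e 1 (q x)) (e i (q x))" for i
    using 1(1,2) exhaust_2[of i] sym[OF y, of "Dq x (lift 1 x)"] by (auto simp: covectors[OF x] orth[OF y])
  then show "Dq x (lift 1 x) = e 1 (q x)" by (rule frame_eqI[OF y])
  have "h (q x) (Dq x (lift 2 x)) (e i (q x)) = h (q x) (e 2 (q x)) (e i (q x))" for i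
    using 1(4,5) exhaust_2[of i] sym[OF y, of "Dq x (lift 2 x)"] by (auto simp: covectors[OF x] orth[OF y])
  then show "Dq x (lift 2 x) = e 2 (q x)" by (rule frame_eqI[OF y])
qed

lemma smooth_compose_q: "smooth_on W f \<Longrightarrow> smooth_on V (\<lambda>x. f (q x))"
  by (rule smooth_on_compose[OF _ smooth_q q_in])

lemma smooth_lift: "smooth_on V (lift i)"
proof -
  have "smooth_on V (\<lambda>x. \<chi> j. h (q x) (e i (q x)) (Dq x (axis j 1)))" for i
    by (rule smooth_on_vec[OF open_P], simp,
        rule smooth_on_bilinear_family[OF bil smooth_G q_in smooth_q smooth_compose_q[OF smooth_E]
          smooth_on_frechet_derivative[OF smooth_q]])
  then have "smooth_on V cov1" "smooth_on V cov2"
    unfolding cov1_def[abs_def] cov2_def[abs_def] by simp_all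
  moreover have "smooth_on V cov3"
    unfolding cov3_def[abs_def]
    by (rule smooth_on_vec[OF open_P], simp,
        rule smooth_on_bilinear_family[where f = "\<lambda>x. x", OF bil_P smooth_P _ smooth_on_ident[OF open_P] smooth_T
          smooth_on_const[OF open_P]])
  ultimately have c: "smooth_on V cov1" "smooth_on V cov2" "smooth_on V cov3" .
  then have "smooth_on V vol"
    unfolding vol_def[abs_def] by (intro smooth_on_inner smooth_on_cross3)
  then have v: "smooth_on V (\<lambda>x. inverse (vol x))" by (rule smooth_on_inverse[OF _ vol_nonzero])
  show ?thesis
    using exhaust_3[of i] smooth_on_scaleR[OF v smooth_on_cross3[OF c(2,3)]]
      smooth_on_scaleR[OF v smooth_on_cross3[OF c(3,1)]] smooth_T
    by (auto simp: lift_def[abs_def])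
qed

lemma frame_P: "orthonormal_frame V GP lift"
proof
  show orth_P: "GP x (lift i x) (lift j x) = of_bool (i = j)" if x: "x \<in> V" for x i j
    using exhaust_3[of i] exhaust_3[of j]
    by (auto simp: split_P[OF x, of "lift i x"] Dq_lift[OF x] orth[OF q_in[OF x]]
        bilinear_lzero[OF bil[OF q_in[OF x]]] bilinear_rzero[OF bil[OF q_in[OF x]]])
  show "(\<Sum>i\<in>UNIV. GP x u (lift i x) *\<^sub>R lift i x) = u" if x: "x \<in> V" for x u
  proof (rule vector_eqI[OF x])
    note y = q_in[OF x]
    have G: "GP x u (lift 1 x) = h (q x) (Dq x u) (e 1 (q x))" "GP x u (lift 2 x) = h (q x) (Dq x u) (e 2 (q x))"
      "GP x u (lift 3 x) = GP x (T x) u"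
      using split_P[OF x, of u] by (simp_all add: Dq_lift[OF x] bilinear_rzero[OF bil[OF y]])
    show "Dq x (\<Sum>i\<in>UNIV. GP x u (lift i x) *\<^sub>R lift i x) = Dq x u"
      using span[OF y, of "Dq x u"]
      by (simp add: sum_3 sum_2 linear_add[OF linear_Dq[OF x]] linear_scale[OF linear_Dq[OF x]] Dq_lift[OF x] G)
    show "GP x (T x) (\<Sum>i\<in>UNIV. GP x u (lift i x) *\<^sub>R lift i x) = GP x (T x) u"
      by (simp add: sum_3 bilinear_radd[OF bil_P[OF x]] bilinear_rmul[OF bil_P[OF x]] Dq_lift[OF x] G)
  qed
qed (use open_P bil_P sym_P smooth_P smooth_lift in auto)

lemma der_lift_compose:
  assumes x: "x \<in> V" and f: "smooth_on W f"
  shows "der (lift 1) (\<lambda>x. f (q x)) x = der (e 1) f (q x)" "der (lift 2) (\<lambda>x. f (q x)) x = der (e 2) f (q x)"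
    "der (lift 3) (\<lambda>x. f (q x)) x = 0"
proof -
  note c = der_compose[OF smooth_on_differentiable[OF smooth_q x] smooth_on_differentiable[OF f q_in[OF x]]]
  show "der (lift 1) (\<lambda>x. f (q x)) x = der (e 1) f (q x)" "der (lift 2) (\<lambda>x. f (q x)) x = der (e 2) f (q x)"
    "der (lift 3) (\<lambda>x. f (q x)) x = 0"
    unfolding c using linear_0[OF linear_frechet_derivative[OF smooth_on_differentiable[OF f q_in[OF x]]]]
    by (simp_all add: der_def Dq_lift[OF x])
qed

text \<open>\<open>der_commute\<close> for the vector-valued function \<open>q\<close>, whose
  derivatives along the lifts are the base frame at \<open>q x\<close> or zero.\<close>

lemma Dq_bracket:
  assumes x: "x \<in> V"
  shows "Dq x (der (lift 1) (lift 2) x - der (lift 2) (lift 1) x) = der (e 1) (e 2) (q x) - der (e 2) (e 1) (q x)"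
    "Dq x (der (lift 1) (lift 3) x - der (lift 3) (lift 1) x) = 0"
    "Dq x (der (lift 2) (lift 3) x - der (lift 3) (lift 2) x) = 0"
proof -
  have q: "der (lift i) (der (lift 1) q) x = der (lift i) (\<lambda>x. e 1 (q x)) x"
    "der (lift i) (der (lift 2) q) x = der (lift i) (\<lambda>x. e 2 (q x)) x"
    "der (lift i) (der (lift 3) q) x = der (lift i) (\<lambda>x. 0) x" for i
    by (rule der_cong[OF open_P x], simp add: der_def Dq_lift)+
  note c = der_commute[OF smooth_lift smooth_lift smooth_q x, symmetric]
  show "Dq x (der (lift 1) (lift 2) x - der (lift 2) (lift 1) x) = der (e 1) (e 2) (q x) - der (e 2) (e 1) (q x)"
    "Dq x (der (lift 1) (lift 3) x - der (lift 3) (lift 1) x) = 0"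
    "Dq x (der (lift 2) (lift 3) x - der (lift 3) (lift 2) x) = 0"
    unfolding c q by (simp_all add: der_lift_compose[OF x smooth_E] der_const)
qed

text \<open>The functions \<eta>(lift j) are constant, so of d\<eta>(X, Y) = X(\<eta>(Y)) -
  Y(\<eta>(X)) - \<eta>([X, Y]) only the bracket term remains for two lifts.\<close>

lemma eta_bracket:
  assumes x: "x \<in> V"
  shows "GP x (T x) (der (lift i) (lift j) x - der (lift j) (lift i) x) =
    - H (q x) * area_of h (q x) (Dq x (lift i x)) (Dq x (lift j x))"
proof -
  define B where "B x (u :: real^3) v = GP x (T x) v" for x u v
  have Dconst: "der (lift i) (\<lambda>x. GP x (T x) (lift j x)) x = 0" for i j
  proof -
    have "der (lift i) (\<lambda>x. GP x (T x) (lift j x)) x = der (lift i) (\<lambda>x. of_bool (j = 3)) x"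
      using exhaust_3[of j] by (intro der_cong[OF open_P x]) (auto simp: Dq_lift)
    then show ?thesis by (simp add: der_const)
  qed
  have D: "der (lift i) (\<lambda>x. GP x (T x) (lift j x)) x =
    fderiv (\<lambda>z. GP z (T z) (lift j x)) x (lift i x) + GP x (T x) (der (lift i) (lift j) x)" for i j
  proof -
    have 1: "((\<lambda>z. GP z (T z) v) has_derivative (\<lambda>u. fderiv (\<lambda>z. GP z (T x) v) x u +
        GP x (fderiv T x u) v + GP x (T x) 0)) (at x)" for v
      by (rule has_derivative_bilinear_family[where f = "\<lambda>x. x" and h = "\<lambda>_. v", OF bil_P smooth_P x has_derivative_ident
            smooth_on_has_derivative[OF smooth_T x] has_derivative_const])
    have 2: "((\<lambda>z. GP z (T z) (lift j z)) has_derivative (\<lambda>u. fderiv (\<lambda>z. GP z (T x) (lift j x)) x u +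
        GP x (fderiv T x u) (lift j x) + GP x (T x) (fderiv (lift j) x u))) (at x)"
      by (rule has_derivative_bilinear_family[where f = "\<lambda>x. x", OF bil_P smooth_P x has_derivative_ident
            smooth_on_has_derivative[OF smooth_T x] smooth_on_has_derivative[OF smooth_lift x]])
    show ?thesis
      using frechet_derivative_eqI[OF 1, of "lift j x"] der_eqI[OF 2, of "lift i"]
      by (simp add: der_def bilinear_rzero[OF bil_P[OF x]])
  qed
  show ?thesis
    using d_eta[OF x, of "lift j x" "lift i x"] D[of i j] D[of j i] Dconst[of i j] Dconst[of j i]
    by (simp add: bilinear_rsub[OF bil_P[OF x]])
qed

text \<open>The vertical part of the bracket of the two horizontal lifts is a smooth expression, and
  it equals \<open>- H (q x)\<close> because the base frame has area 1.\<close>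

lemma curvature_function_smooth: "smooth_on V (\<lambda>x. H (q x))"
proof (rule smooth_on_cong)
  show "smooth_on V (\<lambda>x. - GP x (T x) (der (lift 1) (lift 2) x - der (lift 2) (lift 1) x))"
    by (intro smooth_on_minus smooth_on_bilinear_family[where f = "\<lambda>x. x", OF bil_P smooth_P _ smooth_on_ident[OF open_P] smooth_T]
        smooth_on_diff smooth_on_der smooth_lift)
  show "- GP x (T x) (der (lift 1) (lift 2) x - der (lift 2) (lift 1) x) = H (q x)" if "x \<in> V" for x
    using eta_bracket[OF that, of 1 2] by (simp add: Dq_lift[OF that] area_frame[OF q_in[OF that]])
qed

lemma circle_frame_P:
  assumes H: "smooth_on W H"
  shows "circle_frame V GP lift (\<lambda>x. conn1 (q x)) (\<lambda>x. conn2 (q x)) (\<lambda>x. H (q x)) (\<lambda>x. gauss_curv (q x))"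
proof -
  interpret F: orthonormal_frame V GP lift by (rule frame_P)
  have K: "gauss_curv (q x) = der (lift 1) (\<lambda>x. conn2 (q x)) x - der (lift 2) (\<lambda>x. conn1 (q x)) x -
      (conn1 (q x))\<^sup>2 - (conn2 (q x))\<^sup>2" if "x \<in> V" for x
    by (simp add: der_lift_compose[OF that] smooth_conn gauss_curv_def)
  show ?thesis
  proof
    fix x assume x: "x \<in> V"
    note y = q_in[OF x]
    note l = linear_add[OF linear_Dq[OF x]] linear_diff[OF linear_Dq[OF x]] linear_scale[OF linear_Dq[OF x]]
      bilinear_radd[OF bil_P[OF x]] bilinear_rsub[OF bil_P[OF x]] bilinear_rmul[OF bil_P[OF x]]
    show "der (lift 1) (lift 2) x - der (lift 2) (lift 1) x =
      conn1 (q x) *\<^sub>R lift 1 x + conn2 (q x) *\<^sub>R lift 2 x - H (q x) *\<^sub>R lift 3 x"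
    proof (rule vector_eqI[OF x])
      show "Dq x (der (lift 1) (lift 2) x - der (lift 2) (lift 1) x) =
        Dq x (conn1 (q x) *\<^sub>R lift 1 x + conn2 (q x) *\<^sub>R lift 2 x - H (q x) *\<^sub>R lift 3 x)"
        unfolding Dq_bracket[OF x] bracket_e[OF y] by (simp add: l Dq_lift[OF x])
      show "GP x (T x) (der (lift 1) (lift 2) x - der (lift 2) (lift 1) x) =
        GP x (T x) (conn1 (q x) *\<^sub>R lift 1 x + conn2 (q x) *\<^sub>R lift 2 x - H (q x) *\<^sub>R lift 3 x)"
        unfolding eta_bracket[OF x] by (simp add: l Dq_lift[OF x] area_frame[OF y])
    qed
    have "der (lift 1) (lift 3) x - der (lift 3) (lift 1) x = 0"
      by (rule vector_eq_0[OF x]) (simp_all only: Dq_bracket[OF x] eta_bracket[OF x] Dq_lift[OF x] area_zero mult_zero_right)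
    then show "der (lift 1) (lift 3) x = der (lift 3) (lift 1) x" by simp
    have "der (lift 2) (lift 3) x - der (lift 3) (lift 2) x = 0"
      by (rule vector_eq_0[OF x]) (simp_all only: Dq_bracket[OF x] eta_bracket[OF x] Dq_lift[OF x] area_zero mult_zero_right)
    then show "der (lift 2) (lift 3) x = der (lift 3) (lift 2) x" by simp
  qed (simp_all add: smooth_compose_q smooth_conn smooth_gauss_curv H der_lift_compose(3) K)
qed

end

section \<open>The two equations on the base, in a chart\<close>

context surface_chart
begin

text \<open>Pointwise form of the two conditions: constancy is replaced by a vanishing differential,
  and the constant is recovered globally by \<open>invariant_constant\<close>.\<close>

definition surface_equations :: "(real^2 \<Rightarrow> real) \<Rightarrow> real^2 \<Rightarrow> bool" where
  "surface_equations H y \<longleftrightarrow>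
    (\<forall>u. fderiv (grad H) y u + chr h y u (grad H y) =
      (H y * ((H y)\<^sup>2 - gauss_curv y)) *\<^sub>R u) \<and>
    (\<forall>u. fderiv (\<lambda>y. 2 * gauss_curv y - 3 * (H y)\<^sup>2) y u = 0)"

lemma surface_equations_iff:
  assumes H: "smooth_on W H" and y: "y \<in> W"
  shows "surface_equations H y \<longleftrightarrow>
    der (e 1) (der (e 1) H) y + conn1 y * der (e 2) H y = H y * ((H y)\<^sup>2 - gauss_curv y) \<and>
    der (e 2) (der (e 2) H) y - conn2 y * der (e 1) H y = H y * ((H y)\<^sup>2 - gauss_curv y) \<and>
    der (e 1) (der (e 2) H) y = conn1 y * der (e 1) H y \<and>
    der (e 2) (der (e 1) H) y = - conn2 y * der (e 2) H y \<and>
    der (e 1) gauss_curv y = 3 * H y * der (e 1) H y \<and>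
    der (e 2) gauss_curv y = 3 * H y * der (e 2) H y"
proof -
  let ?F = "\<lambda>y. 2 * gauss_curv y - 3 * (H y)\<^sup>2"
  have F: "smooth_on W ?F"
    by (intro smooth_on_diff smooth_on_mult smooth_on_const open_W smooth_gauss_curv smooth_on_power H)
  note d = smooth_on_differentiable[OF smooth_gauss_curv y] smooth_on_differentiable[OF H y]
  have lin: "linear (fderiv ?F y)"
    by (rule linear_frechet_derivative[OF smooth_on_differentiable[OF F y]])
  have D: "der X ?F y = 2 * der X gauss_curv y - 6 * H y * der X H y" for X
    by (simp add: power2_eq_square der_diff der_mult der_const d)
  have "(\<forall>u. fderiv ?F y u = 0) \<longleftrightarrow> (\<forall>i. der (e i) ?F y = 0)"
  proof
    assume 0: "\<forall>i. der (e i) ?F y = 0"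
    show "\<forall>u. fderiv ?F y u = 0"
    proof
      fix u
      have "fderiv ?F y u = fderiv ?F y (\<Sum>i\<in>UNIV. h y u (e i y) *\<^sub>R e i y)"
        by (simp only: span[OF y])
      also have "\<dots> = 0" using 0 by (simp only: linear_sum[OF lin] linear_scale[OF lin] der_def) simp
      finally show "fderiv ?F y u = 0" .
    qed
  qed (simp add: der_def)
  then show ?thesis
    unfolding surface_equations_def hessian_equations[OF H y] by (auto simp: D forall_2)
qed

end

context circle_chart
begin

lemma restrict_chart:
  assumes "open V'" "V' \<subseteq> V"
  shows "circle_chart W h V' GP q T H"
proof
  fix x u v assume "x \<in> V'"
  then have x: "x \<in> V" using assms(2) by blast
  show "bilinear (GP x)" "GP x u v = GP x v u" "GP x (T x) (T x) = 1" "q x \<in> W"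
    "fderiv q x (T x) = 0" "u \<noteq> 0 \<Longrightarrow> GP x u u > 0"
    by (fact bil_P[OF x] sym_P[OF x] GP_T[OF x] q_in[OF x] Dq_T[OF x] pos_P[OF x])+
  show "GP x u v = GP x (T x) u * GP x (T x) v +
      h (q x) (fderiv q x u) (fderiv q x v)"
    by (rule split_P[OF x])
  show "fderiv (\<lambda>x. GP x (T x) v) x u - fderiv (\<lambda>x. GP x (T x) u) x v =
      H (q x) * area_of h (q x) (fderiv q x u) (fderiv q x v)"
    by (rule d_eta[OF x])
qed (use assms smooth_on_subset[OF smooth_P assms] smooth_on_subset[OF smooth_q assms]
  smooth_on_subset[OF smooth_T assms] in auto)

lemma lift_second_derivatives:
  assumes H: "smooth_on W H" and x: "x \<in> V"
  shows "der (lift 1) (der (lift 1) (\<lambda>x. H (q x))) x = der (e 1) (der (e 1) H) (q x)"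
    "der (lift 1) (der (lift 2) (\<lambda>x. H (q x))) x = der (e 1) (der (e 2) H) (q x)"
    "der (lift 2) (der (lift 1) (\<lambda>x. H (q x))) x = der (e 2) (der (e 1) H) (q x)"
    "der (lift 2) (der (lift 2) (\<lambda>x. H (q x))) x = der (e 2) (der (e 2) H) (q x)"
proof -
  have 1: "der (lift i) (der (lift 1) (\<lambda>x. H (q x))) x = der (lift i) (\<lambda>x. der (e 1) H (q x)) x" for i
    by (rule der_cong[OF open_P x]) (simp add: der_lift_compose H)
  have 2: "der (lift i) (der (lift 2) (\<lambda>x. H (q x))) x = der (lift i) (\<lambda>x. der (e 2) H (q x)) x" for i
    by (rule der_cong[OF open_P x]) (simp add: der_lift_compose H)
  show "der (lift 1) (der (lift 1) (\<lambda>x. H (q x))) x = der (e 1) (der (e 1) H) (q x)"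
    "der (lift 1) (der (lift 2) (\<lambda>x. H (q x))) x = der (e 1) (der (e 2) H) (q x)"
    "der (lift 2) (der (lift 1) (\<lambda>x. H (q x))) x = der (e 2) (der (e 1) H) (q x)"
    "der (lift 2) (der (lift 2) (\<lambda>x. H (q x))) x = der (e 2) (der (e 2) H) (q x)"
    unfolding 1 2 by (simp_all add: der_lift_compose[OF x smooth_on_der[OF smooth_E H]])
qed

lemma surface_equations_of_flat:
  assumes H: "smooth_on W H" and lam: "smooth_on V lam"
    and flat: "\<forall>x\<in>V. \<forall>u v w. riem (\<lambda>x u v. exp (2 * lam x) * GP x u v) x u v w = 0"
    and x: "x \<in> V"
  shows "surface_equations H (q x)"
proof -
  note e = circle_frame.equations_of_flat[OF circle_frame_P[OF H] lam flat x]
  show ?thesis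
    unfolding surface_equations_iff[OF H q_in[OF x]]
    using e by (simp add: lift_second_derivatives[OF H x] der_lift_compose[OF x H] der_lift_compose[OF x smooth_gauss_curv])
qed

lemma flat_of_surface_equations:
  assumes H: "smooth_on W H" and eqs: "\<And>y. y \<in> W \<Longrightarrow> surface_equations H y" and x0: "x0 \<in> V"
  obtains r lam where "r > 0" "ball x0 r \<subseteq> V" "smooth_on (ball x0 r) lam"
    "\<And>x u v w. x \<in> ball x0 r \<Longrightarrow> riem (\<lambda>x u v. exp (2 * lam x) * GP x u v) x u v w = 0"
proof (rule circle_frame.flat_of_equations[OF circle_frame_P[OF H] _ _ _ _ _ _ x0])
  fix x assume x: "x \<in> V"
  note e = eqs[OF q_in[OF x], unfolded surface_equations_iff[OF H q_in[OF x]] power2_eq_square]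
  note l = lift_second_derivatives[OF H x] der_lift_compose[OF x H] der_lift_compose[OF x smooth_gauss_curv]
  show "der (lift 1) (der (lift 1) (\<lambda>x. H (q x))) x =
      H (q x) * (H (q x) * H (q x) - gauss_curv (q x)) - conn1 (q x) * der (lift 2) (\<lambda>x. H (q x)) x"
    "der (lift 2) (der (lift 2) (\<lambda>x. H (q x))) x =
      H (q x) * (H (q x) * H (q x) - gauss_curv (q x)) + conn2 (q x) * der (lift 1) (\<lambda>x. H (q x)) x"
    "der (lift 1) (der (lift 2) (\<lambda>x. H (q x))) x = conn1 (q x) * der (lift 1) (\<lambda>x. H (q x)) x"
    "der (lift 2) (der (lift 1) (\<lambda>x. H (q x))) x = - (conn2 (q x) * der (lift 2) (\<lambda>x. H (q x)) x)"
    "der (lift 1) (\<lambda>x. gauss_curv (q x)) x = 3 * H (q x) * der (lift 1) (\<lambda>x. H (q x)) x"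
    "der (lift 2) (\<lambda>x. gauss_curv (q x)) x = 3 * H (q x) * der (lift 2) (\<lambda>x. H (q x)) x"
    using e by (simp_all add: l)
qed (rule that)

end

section \<open>Charts of manifolds\<close>

definition in_chart :: "('a, 'e) chart \<Rightarrow> ('a, 'e) tensor2 \<Rightarrow> 'e \<Rightarrow> 'e \<Rightarrow> 'e \<Rightarrow> real" where
  "in_chart c g x = g c (chart_inv c x)"

locale chart =
  fixes c :: "('a, 'e::euclidean_space) chart"
  assumes inj: "inj_on (snd c) (fst c)" and open_image: "open (snd c ` fst c)"
begin

lemma chart_inv [simp]: "p \<in> fst c \<Longrightarrow> chart_inv c (snd c p) = p"
  using inj by (simp add: chart_inv_def)

lemma chart_inv_in: "x \<in> snd c ` fst c \<Longrightarrow> chart_inv c x \<in> fst c"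
  by (auto simp: inj)

lemma chart_chart_inv: "x \<in> snd c ` fst c \<Longrightarrow> snd c (chart_inv c x) = x"
  by auto

lemma christoffel_chart:
  "p \<in> fst c \<Longrightarrow> christoffel c g p u v = chr (in_chart c g) (snd c p) u v"
  by (simp add: christoffel_def chr_def in_chart_def dchart_def o_def)

lemma riemann_chart:
  assumes p: "p \<in> fst c"
  shows "riemann c g p u v w = riem (in_chart c g) (snd c p) u v w"
proof -
  have nabla_const: "nabla c g q v (\<lambda>_. w) = chr (in_chart c g) (snd c q) v w" if "q \<in> fst c" for q v w
    by (simp add: nabla_def dchart_def o_def christoffel_chart[OF that])
  have "fderiv ((\<lambda>q. nabla c g q v (\<lambda>_. w)) \<circ> chart_inv c) (snd c p) =
      fderiv (\<lambda>x. chr (in_chart c g) x v w) (snd c p)" for v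
    using p by (intro frechet_derivative_eq_on_open[OF open_image]) (auto simp: nabla_const)
  then show ?thesis
    by (simp add: riemann_def riem_def nabla_def[of c g p] dchart_def nabla_const p christoffel_chart)
qed

end

lemma manifold_chart:
  assumes "smooth_manifold M" "c \<in> man_atlas M"
  shows "chart c" "openin (man_top M) (fst c)" "fst c \<subseteq> points M"
    "homeomorphic_map (subtopology (man_top M) (fst c)) (top_of_set (snd c ` fst c)) (snd c)"
proof -
  have *: "openin (man_top M) (fst c)" "open (snd c ` fst c)"
    "homeomorphic_map (subtopology (man_top M) (fst c)) (top_of_set (snd c ` fst c)) (snd c)"
    using assms unfolding smooth_manifold_def by blast+
  then show "openin (man_top M) (fst c)"
    "homeomorphic_map (subtopology (man_top M) (fst c)) (top_of_set (snd c ` fst c)) (snd c)" by blast+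
  show s: "fst c \<subseteq> points M" using *(1) by (rule openin_subset)
  have "inj_on (snd c) (topspace (subtopology (man_top M) (fst c)))"
    using *(3) homeomorphic_imp_injective_map by blast
  then show "chart c" using *(2) s by (simp add: chart_def inf_absorb2)
qed

lemma manifold_chart_at:
  assumes "smooth_manifold M" "p \<in> points M"
  obtains c where "c \<in> charts_at M p"
  using assms unfolding smooth_manifold_def by blast

lemma open_chart_image:
  assumes M: "smooth_manifold M" "c \<in> man_atlas M" and U: "openin (man_top M) U" "U \<subseteq> fst c"
  shows "open (snd c ` U)"
proof -
  have "openin (subtopology (man_top M) (fst c)) U"
    using openin_subtopology_Int2[OF U(1), of "fst c"] U(2) by (simp add: inf_absorb2)
  then have "openin (top_of_set (snd c ` fst c)) (snd c ` U)"
    using manifold_chart(4)[OF M] homeomorphic_imp_open_map open_map_def by blast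
  then show ?thesis
    using openin_open_trans chart.open_image[OF manifold_chart(1)[OF M]] by blast
qed

lemma open_chart_preimage:
  assumes M: "smooth_manifold M" "c \<in> man_atlas M" and B: "open B" "B \<subseteq> snd c ` fst c"
  shows "openin (man_top M) (chart_inv c ` B)"
proof -
  interpret chart c by (rule manifold_chart[OF M])
  have top: "topspace (subtopology (man_top M) (fst c)) = fst c"
    using manifold_chart(3)[OF M] by (simp add: inf_absorb2)
  have eq: "chart_inv c ` B = {p \<in> topspace (subtopology (man_top M) (fst c)). snd c p \<in> B}"
    unfolding top
  proof (intro equalityI subsetI)
    fix p assume "p \<in> chart_inv c ` B"
    then obtain x where x: "x \<in> B" "p = chart_inv c x" by blast
    then have "x \<in> snd c ` fst c" using B(2) by blast
    then show "p \<in> {p \<in> fst c. snd c p \<in> B}" using x chart_inv_in chart_chart_inv by simp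
  next
    fix p assume p: "p \<in> {p \<in> fst c. snd c p \<in> B}"
    then have "p = chart_inv c (snd c p)" by simp
    then show "p \<in> chart_inv c ` B" using p by blast
  qed
  have "continuous_map (subtopology (man_top M) (fst c)) (top_of_set (snd c ` fst c)) (snd c)"
    using manifold_chart(4)[OF M] homeomorphic_imp_continuous_map by blast
  then have "openin (subtopology (man_top M) (fst c)) (chart_inv c ` B)"
    unfolding eq by (rule openin_continuous_map_preimage) (use B in \<open>auto simp: openin_open\<close>)
  then show ?thesis
    using openin_trans_full manifold_chart(2)[OF M] by blast
qed

text \<open>Adding the functional \<open>t \<bullet> u\<close> as a third coordinate makes
  \<open>L\<close> a bijection of \<open>real^3\<close>; it sends the component of \<open>v\<close>
  orthogonal to \<open>t\<close> to zero. With this the vertical space is spanned by the generator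
  of the action.\<close>

lemma kernel_line:
  fixes L :: "real^3 \<Rightarrow> real^2"
  assumes L: "linear L" "surj L" and t: "L t = 0" "t \<noteq> 0" and v: "L v = 0"
  shows "\<exists>k. v = k *\<^sub>R t"
proof -
  define F :: "real^3 \<Rightarrow> real^3" where "F u = vector [L u $ 1, L u $ 2, t \<bullet> u]" for u
  have F: "F u $ 1 = L u $ 1" "F u $ 2 = L u $ 2" "F u $ 3 = t \<bullet> u" for u
    by (simp_all add: F_def vector_3)
  have lin: "linear F"
    by (rule linearI) (simp_all add: vec_eq_iff forall_3 F linear_add[OF L(1)] linear_scale[OF L(1)] inner_add_right)
  have "\<exists>u. w = F u" for w
  proof -
    obtain u0 where u0: "L u0 = vector [w $ 1, w $ 2]" using L(2) by (metis surjD)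
    let ?u = "u0 + ((w $ 3 - t \<bullet> u0) / (t \<bullet> t)) *\<^sub>R t"
    have "L ?u = L u0" by (simp add: linear_add[OF L(1)] linear_scale[OF L(1)] t)
    moreover have "t \<bullet> ?u = w $ 3" using t(2) by (simp add: inner_add_right)
    ultimately have "w = F ?u" by (simp add: vec_eq_iff forall_3 F u0 vector_2)
    then show ?thesis ..
  qed
  then have "surj F" by (simp add: surj_def)
  then have inj: "inj F" using linear_surjective_imp_injective[OF lin] by blast
  let ?w = "v - ((t \<bullet> v) / (t \<bullet> t)) *\<^sub>R t"
  have "F ?w = 0"
    using t by (simp add: vec_eq_iff forall_3 F linear_diff[OF L(1)] linear_scale[OF L(1)] v inner_diff_right)
  then have "?w = 0" using linear_injective_0[OF lin] inj by blast
  then show ?thesis by (metis eq_iff_diff_eq_0)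
qed

text \<open>The member of the circle atlas with z = 1, with \<open>w / 1\<close> kept so that it
  matches the atlas literally. It is centred at the unit, where the generator is computed.\<close>

abbreviation circle_chart_1 :: "(complex, real) chart" where
  "circle_chart_1 \<equiv> (sphere 0 1 - {- 1}, \<lambda>w. Arg (w / 1))"

abbreviation product_chart :: "('a, 'e) chart \<Rightarrow> ('a \<times> complex, 'e \<times> real) chart" where
  "product_chart c \<equiv> (fst c \<times> fst circle_chart_1, map_prod (snd c) (snd circle_chart_1))"

lemma product_chart_in_atlas:
  "c \<in> man_atlas M \<Longrightarrow> product_chart c \<in> man_atlas (prod_manifold M circle_manifold)"
proof -
  assume "c \<in> man_atlas M"
  moreover have "circle_chart_1 \<in> man_atlas circle_manifold"
    unfolding circle_manifold_def by simp (rule exI[of _ 1], simp)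
  ultimately show ?thesis
    unfolding prod_manifold_def by (auto intro!: image_eqI[where x = "(c, circle_chart_1)"])
qed

lemma cis_Arg_sphere: "w \<in> sphere 0 1 \<Longrightarrow> cis (Arg w) = w"
proof -
  assume "w \<in> sphere 0 1"
  then have "norm w = 1" by simp
  then have "w \<noteq> 0" "sgn w = w" by (auto simp: sgn_div_norm)
  then show ?thesis using cis_Arg[of w] by simp
qed

lemma chart_inv_product_chart:
  assumes inj: "inj_on (snd c) (fst c)" and "p \<in> fst c" "w \<in> sphere 0 1 - {- 1}"
  shows "chart_inv (product_chart c) (snd c p, Arg w) = (p, w)"
proof -
  have "inj_on (snd (product_chart c)) (fst (product_chart c))"
  proof (rule inj_onI)
    fix z z' assume z: "z \<in> fst (product_chart c)" "z' \<in> fst (product_chart c)"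
      "snd (product_chart c) z = snd (product_chart c) z'"
    then have "snd z = snd z'" using cis_Arg_sphere[of "snd z"] cis_Arg_sphere[of "snd z'"] by (auto simp del: cis_Arg)
    moreover have "fst z = fst z'" using z inj by (auto dest: inj_onD)
    ultimately show "z = z'" by (rule prod_eqI[rotated])
  qed
  then show ?thesis
    unfolding chart_inv_def by (rule inv_into_f_eq) (use assms in auto)
qed

text \<open>Smoothness of the action is stated with charts of a product. Here it becomes a smooth
  function \<open>F\<close> of the coordinates and the angle, on an open set that contains the
  points with angle 0.\<close>

lemma action_in_chart:
  fixes P :: "('p, 'e::euclidean_space) manifold" and M :: "('m, 'f::euclidean_space) manifold"
  assumes pcb: "principal_circle_bundle P M \<pi> act" and c: "c \<in> man_atlas P"
  obtains N F where "smooth_on N F" "\<And>x. x \<in> snd c ` fst c \<Longrightarrow> (x, 0) \<in> N"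
    "\<And>x \<phi>. (x, \<phi>) \<in> N \<Longrightarrow> act (chart_inv c x) (cis \<phi>) \<in> fst c \<and> x \<in> snd c ` fst c \<and>
       F (x, \<phi>) = snd c (act (chart_inv c x) (cis \<phi>))"
proof -
  have P: "smooth_manifold P" and act1: "\<And>p. p \<in> points P \<Longrightarrow> act p 1 = p"
    and sm: "smooth_map (prod_manifold P circle_manifold) P (\<lambda>(p, z). act p z)"
    using pcb unfolding principal_circle_bundle_def by blast+
  interpret chart c by (rule manifold_chart[OF P c])
  let ?C = "product_chart c" and ?f = "\<lambda>(p, z). act p z"
  let ?N = "snd ?C ` (fst ?C \<inter> ?f -` fst c)" and ?F = "snd c \<circ> ?f \<circ> chart_inv ?C"
  show thesis
  proof (rule that[of ?N ?F])
    show "smooth_on ?N ?F"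
      using sm product_chart_in_atlas[OF c] c unfolding smooth_map_def by blast
    show "(x, 0) \<in> ?N" if x: "x \<in> snd c ` fst c" for x
    proof -
      obtain p where p: "p \<in> fst c" "x = snd c p" using x by blast
      have "act p 1 = p" using p(1) act1 manifold_chart(3)[OF P c] by blast
      then have "(p, 1) \<in> fst ?C \<inter> ?f -` fst c" using p(1) by simp
      moreover have "(x, 0) = snd ?C (p, 1)" using p by simp
      ultimately show ?thesis by (rule image_eqI[rotated])
    qed
    fix x \<phi> assume "(x, \<phi>) \<in> ?N"
    then obtain z where z: "z \<in> fst ?C \<inter> ?f -` fst c" "(x, \<phi>) = snd ?C z" by (rule imageE)
    obtain p w where pw: "z = (p, w)" by (rule prod.exhaust)
    have w: "p \<in> fst c" "w \<in> sphere 0 1 - {- 1}" "act p w \<in> fst c" "x = snd c p" "\<phi> = Arg w"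
      using z unfolding pw by simp_all
    have "?F (x, \<phi>) = snd c (act p w)" using w chart_inv_product_chart[OF inj w(1,2)] by simp
    then show "act (chart_inv c x) (cis \<phi>) \<in> fst c \<and> x \<in> snd c ` fst c \<and>
       ?F (x, \<phi>) = snd c (act (chart_inv c x) (cis \<phi>))"
      using w cis_Arg_sphere[of w] by (simp del: cis_Arg)
  qed
qed

text \<open>The generator is the derivative of \<open>F\<close> in the angle at 0, hence smooth. The
  projection is constant along the orbits, so it annihilates this derivative.\<close>

lemma generating_field_in_chart:
  fixes P :: "('p, 'e::euclidean_space) manifold" and M :: "('m, 'f::euclidean_space) manifold"
  assumes pcb: "principal_circle_bundle P M \<pi> act" and c: "c \<in> man_atlas P" and d: "d \<in> man_atlas M"
  shows "smooth_on (snd c ` fst c) (\<lambda>x. generating_field act c (chart_inv c x))"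
    "x \<in> snd c ` (fst c \<inter> \<pi> -` fst d) \<Longrightarrow>
      fderiv (snd d \<circ> \<pi> \<circ> chart_inv c) x (generating_field act c (chart_inv c x)) = 0"
proof -
  have P: "smooth_manifold P" and act1: "\<And>p. p \<in> points P \<Longrightarrow> act p 1 = p"
    and \<pi>: "smooth_map P M \<pi>" and \<pi>_act: "\<And>p z. p \<in> points P \<Longrightarrow> z \<in> sphere 0 1 \<Longrightarrow> \<pi> (act p z) = \<pi> p"
    using pcb unfolding principal_circle_bundle_def by blast+
  interpret chart c by (rule manifold_chart[OF P c])
  obtain N F where F: "smooth_on N F" "\<And>x. x \<in> snd c ` fst c \<Longrightarrow> (x, 0) \<in> N"
    "\<And>x \<phi>. (x, \<phi>) \<in> N \<Longrightarrow> act (chart_inv c x) (cis \<phi>) \<in> fst c \<and> x \<in> snd c ` fst c \<and>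
       F (x, \<phi>) = snd c (act (chart_inv c x) (cis \<phi>))"
    using action_in_chart[OF pcb c] by blast
  have Pair: "((\<lambda>\<phi>. (x, \<phi>)) has_derivative (\<lambda>h. (0, h))) (at 0)" for x :: 'e
    by (auto intro!: derivative_eq_intros)
  have op: "open {\<phi>. (x, \<phi>) \<in> N}" for x
  proof -
    have "continuous_on UNIV (\<lambda>\<phi>::real. (x, \<phi>))" by (intro continuous_intros)
    from open_vimage[OF smooth_on_open[OF F(1)] this] show ?thesis by (simp only: vimage_def)
  qed
  have gen: "generating_field act c (chart_inv c x) = fderiv F (x, 0) (0, 1)"
    if x: "x \<in> snd c ` fst c" for x
  proof -
    note x0 = F(2)[OF x]
    have "((\<lambda>\<phi>. F (x, \<phi>)) has_derivative (\<lambda>h. fderiv F (x, 0) (0, h))) (at 0)"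
      using diff_chain_at[OF Pair smooth_on_has_derivative[OF F(1) x0]] by (simp add: o_def)
    then have "((\<lambda>\<phi>. snd c (act (chart_inv c x) (cis \<phi>))) has_derivative (\<lambda>h. fderiv F (x, 0) (0, h))) (at 0)"
    proof (rule has_derivative_transform_within_open[OF _ op[of x]])
      show "F (x, \<phi>) = snd c (act (chart_inv c x) (cis \<phi>))" if "\<phi> \<in> {\<phi>. (x, \<phi>) \<in> N}" for \<phi>
        using F(3) that by blast
    qed (use x0 in simp)
    moreover have "(\<lambda>h. fderiv F (x, 0) (0, h)) = (\<lambda>h. h *\<^sub>R fderiv F (x, 0) (0, 1))"
    proof
      fix h :: real
      show "fderiv F (x, 0) (0, h) = h *\<^sub>R fderiv F (x, 0) (0, 1)"
        using linear_scale[OF linear_frechet_derivative[OF smooth_on_differentiable[OF F(1) x0]], of h "(0, 1)"] by simp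
    qed
    ultimately have "((\<lambda>\<phi>. snd c (act (chart_inv c x) (cis \<phi>))) has_vector_derivative fderiv F (x, 0) (0, 1)) (at 0)"
      unfolding has_vector_derivative_def by (simp only:)
    then show ?thesis unfolding generating_field_def by (rule vector_derivative_at)
  qed
  show "smooth_on (snd c ` fst c) (\<lambda>x. generating_field act c (chart_inv c x))"
  proof (rule smooth_on_cong)
    show "smooth_on (snd c ` fst c) (\<lambda>x. fderiv F (x, 0) (0, 1))"
      by (rule smooth_on_compose[where g = "\<lambda>x. (x, 0)" and f = "\<lambda>z. fderiv F z (0, 1)",
            OF smooth_on_frechet_derivative[OF F(1)] smooth_on_Pair[OF smooth_on_ident[OF open_image] smooth_on_const[OF open_image]] F(2)])
  qed (simp add: gen)
  let ?q = "snd d \<circ> \<pi> \<circ> chart_inv c"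
  assume "x \<in> snd c ` (fst c \<inter> \<pi> -` fst d)"
  then have x: "x \<in> snd c ` fst c" and xV: "x \<in> snd c ` (fst c \<inter> \<pi> -` fst d)" by auto
  note x0 = F(2)[OF x]
  have sq: "smooth_on (snd c ` (fst c \<inter> \<pi> -` fst d)) ?q"
    using \<pi> c d unfolding smooth_map_def by blast
  have const: "?q (F (x, \<phi>)) = ?q x" if "(x, \<phi>) \<in> N" for \<phi>
    using F(3)[OF that] \<pi>_act[of "chart_inv c x" "cis \<phi>"] chart_inv_in[OF x] manifold_chart(3)[OF P c] by auto
  have Fx: "F (x, 0) = x"
    using F(3)[OF x0] act1 chart_inv_in[OF x] manifold_chart(3)[OF P c] chart_chart_inv[OF x] by (auto simp: subset_iff)
  have "((\<lambda>\<phi>. F (x, \<phi>)) has_derivative (\<lambda>h. fderiv F (x, 0) (0, h))) (at 0)"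
    using diff_chain_at[OF Pair smooth_on_has_derivative[OF F(1) x0]] by (simp add: o_def)
  moreover have "(?q has_derivative fderiv ?q x) (at (F (x, 0)))"
    unfolding Fx by (rule smooth_on_has_derivative[OF sq xV])
  ultimately have "(?q \<circ> (\<lambda>\<phi>. F (x, \<phi>)) has_derivative fderiv ?q x \<circ> (\<lambda>h. fderiv F (x, 0) (0, h))) (at 0)"
    by (rule diff_chain_at)
  moreover have "(?q \<circ> (\<lambda>\<phi>. F (x, \<phi>)) has_derivative (\<lambda>h. 0)) (at 0)"
  proof (rule has_derivative_transform_within_open[OF has_derivative_const op[of x]])
    show "?q x = (?q \<circ> (\<lambda>\<phi>. F (x, \<phi>))) \<phi>" if "\<phi> \<in> {\<phi>. (x, \<phi>) \<in> N}" for \<phi>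
      using const that by simp
  qed (use x0 in simp)
  ultimately have "fderiv ?q x \<circ> (\<lambda>h. fderiv F (x, 0) (0, h)) = (\<lambda>h. 0)"
    by (rule has_derivative_unique)
  then show "fderiv ?q x (generating_field act c (chart_inv c x)) = 0"
    unfolding gen[OF x] by (metis comp_apply)
qed

lemma metric_in_chart:
  assumes "riemannian_metric M g" "c \<in> man_atlas M" and c: "chart c"
  shows "x \<in> snd c ` fst c \<Longrightarrow> bilinear (in_chart c g x)"
    "x \<in> snd c ` fst c \<Longrightarrow> in_chart c g x u v = in_chart c g x v u"
    "x \<in> snd c ` fst c \<Longrightarrow> u \<noteq> 0 \<Longrightarrow> in_chart c g x u u > 0"
    "smooth_on (snd c ` fst c) (\<lambda>x. in_chart c g x u v)"
proof -
  note inv = chart.chart_inv_in[OF c]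
  have "\<forall>p\<in>fst c. bilinear (g c p) \<and> (\<forall>u v. g c p u v = g c p v u) \<and> (\<forall>u. u \<noteq> 0 \<longrightarrow> g c p u u > 0)"
    and "smooth_on (snd c ` fst c) ((\<lambda>p. g c p u v) \<circ> chart_inv c)"
    using assms(1,2) unfolding riemannian_metric_def by blast+
  then show "x \<in> snd c ` fst c \<Longrightarrow> bilinear (in_chart c g x)"
    "x \<in> snd c ` fst c \<Longrightarrow> in_chart c g x u v = in_chart c g x v u"
    "x \<in> snd c ` fst c \<Longrightarrow> u \<noteq> 0 \<Longrightarrow> in_chart c g x u u > 0"
    "smooth_on (snd c ` fst c) (\<lambda>x. in_chart c g x u v)"
    using inv[of x] by (auto simp: in_chart_def o_def)
qed

lemma surface_chart_in_chart:
  assumes "riemannian_metric M h" "d \<in> man_atlas M" "chart d"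
  shows "surface_chart (snd d ` fst d) (in_chart d h)"
  using metric_in_chart[OF assms] chart.open_image[OF assms(3)] by unfold_locales auto

section \<open>Circle bundles with circle metric\<close>

locale metric_circle_bundle =
  fixes P :: "('p, real^3) manifold" and M :: "('m, real^2) manifold"
    and \<pi> :: "'p \<Rightarrow> 'm" and act :: "'p \<Rightarrow> complex \<Rightarrow> 'p"
    and g :: "('p, real^3) tensor2" and h :: "('m, real^2) tensor2"
    and K H :: "'m \<Rightarrow> real"
  assumes circle_bundle: "circle_bundle_with_circle_metric P M \<pi> act g"
    and metric_h: "riemannian_metric M h" and submersion_h: "riemannian_submersion P g M h \<pi>"
    and gauss: "gaussian_curvature M h K"
    and curv: "curvature_function P g M h \<pi> act H"
begin

lemma total_space_and_base:
  shows P: "smooth_manifold P" and M: "smooth_manifold M" and smooth_\<pi>: "smooth_map P M \<pi>"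
    and principal: "principal_circle_bundle P M \<pi> act" and metric_g: "riemannian_metric P g"
  using circle_bundle unfolding circle_bundle_with_circle_metric_def principal_circle_bundle_def by blast+

abbreviation base_domain :: "('m, real^2) chart \<Rightarrow> (real^2) set" where
  "base_domain d \<equiv> snd d ` fst d"

abbreviation total_domain :: "('p, real^3) chart \<Rightarrow> ('m, real^2) chart \<Rightarrow> (real^3) set" where
  "total_domain c d \<equiv> snd c ` (fst c \<inter> \<pi> -` fst d)"

abbreviation proj :: "('p, real^3) chart \<Rightarrow> ('m, real^2) chart \<Rightarrow> real^3 \<Rightarrow> real^2" where
  "proj c d \<equiv> snd d \<circ> \<pi> \<circ> chart_inv c"

abbreviation vert :: "('p, real^3) chart \<Rightarrow> real^3 \<Rightarrow> real^3" where
  "vert c x \<equiv> generating_field act c (chart_inv c x)"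

text \<open>The transition from bundle to coordinates. The content lies in \<open>split_P\<close>,
  where isometry on horizontal vectors is turned into a formula for all vectors, and in
  \<open>d_eta\<close>, where the imaginary unit is cancelled from the curvature form.\<close>

lemma bundle_chart:
  assumes c: "c \<in> man_atlas P" and d: "d \<in> man_atlas M"
  shows "circle_chart (base_domain d) (in_chart d h) (total_domain c d) (in_chart c g) (proj c d) (vert c) (H \<circ> chart_inv d)"
proof -
  interpret c: chart c by (rule manifold_chart[OF P c])
  interpret d: chart d by (rule manifold_chart[OF M d])
  interpret surface_chart "base_domain d" "in_chart d h"
    by (rule surface_chart_in_chart[OF metric_h d]) unfold_locales
  let ?V = "total_domain c d" and ?q = "proj c d"
  have sq: "smooth_on ?V ?q" using smooth_\<pi> c d unfolding smooth_map_def by blast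
  note V = smooth_on_open[OF sq]
  have VV: "?V \<subseteq> snd c ` fst c" by blast
  note mg = metric_in_chart[OF metric_g c c.chart_axioms]
  have q: "?q x = snd d (\<pi> (chart_inv c x))" for x by simp
  have T: "smooth_on (snd c ` fst c) (vert c)" by (rule generating_field_in_chart(1)[OF principal c d])
  have pt: "\<exists>p. p \<in> fst c \<and> \<pi> p \<in> fst d \<and> p \<in> points P \<and> x = snd c p \<and> chart_inv c x = p"
    if "x \<in> ?V" for x
    using that manifold_chart(3)[OF P c] by auto
  show ?thesis
  proof
    show "open ?V" "smooth_on ?V ?q" by (fact V sq)+
    show "smooth_on ?V (\<lambda>x. in_chart c g x u v)" for u v by (rule smooth_on_subset[OF mg(4) V VV])
    show "smooth_on ?V (vert c)" by (rule smooth_on_subset[OF T V VV])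
  next
    fix x u v assume xV: "x \<in> ?V"
    then have x: "x \<in> snd c ` fst c" using VV by blast
    show "bilinear (in_chart c g x)" "in_chart c g x u v = in_chart c g x v u"
      "u \<noteq> 0 \<Longrightarrow> in_chart c g x u u > 0"
      by (fact mg(1)[OF x] mg(2)[OF x] mg(3)[OF x])+
    note bil = mg(1)[OF x]
    obtain p where p: "p \<in> fst c" "\<pi> p \<in> fst d" "p \<in> points P" "x = snd c p" "chart_inv c x = p"
      using pt[OF xV] by blast
    have cp: "c \<in> charts_at P p" and dp: "d \<in> charts_at M (\<pi> p)" using c d p by auto
    show "?q x \<in> base_domain d" using p by simp
    have "sqrt (g c p (generating_field act c p) (generating_field act c p)) = 1"
      using circle_bundle p(3) cp unfolding circle_bundle_with_circle_metric_def by blast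
    then show unit: "in_chart c g x (vert c x) (vert c x) = 1" by (simp add: in_chart_def p(5))
    show Dq: "fderiv ?q x (vert c x) = 0"
      by (rule generating_field_in_chart(2)[OF principal c d xV])
    have tm: "tangent_map c d \<pi> p = fderiv ?q x"
      unfolding p(4) by (simp add: tangent_map_def dchart_def fun_eq_iff)
    have lin: "linear (fderiv ?q x)"
      by (rule linear_frechet_derivative[OF smooth_on_differentiable[OF sq xV]])
    have "surj (tangent_map c d \<pi> p)"
      using submersion_h p(3) cp dp unfolding riemannian_submersion_def submersion_def by blast
    then have surj: "surj (fderiv ?q x)" by (simp only: tm)
    let ?G = "in_chart c g x" and ?T = "vert c x" and ?D = "fderiv ?q x"
    have Gx: "?G = g c p" by (simp add: in_chart_def p(5) fun_eq_iff)
    have T0: "?T \<noteq> 0" using unit bilinear_lzero[OF bil] by force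
    \<comment> \<open>The kernel of the projection is a line because of the submersion property, and
      the unit vector \<open>?T\<close> spans it. Orthogonality to \<open>?T\<close> therefore means
      being horizontal.\<close>
    have hor: "u \<in> horizontal M \<pi> g c p" if "?G ?T u = 0" for u
      unfolding horizontal_def
    proof (intro CollectI ballI)
      fix w assume "w \<in> vertical M \<pi> c p"
      then have "?D w = 0" using dp unfolding vertical_def tm[symmetric] by blast
      then obtain k where "w = k *\<^sub>R ?T" using kernel_line[OF lin surj Dq T0] by blast
      then have "?G u w = k * ?G ?T u" using bilinear_rmul[OF bil] mg(2)[OF x] by simp
      then show "g c p u w = 0" using that by (simp add: Gx)
    qed
    show "?G u v = ?G ?T u * ?G ?T v + in_chart d h (?q x) (?D u) (?D v)"
    proof -
      \<comment> \<open>\<open>u'\<close> and \<open>v'\<close> are the horizontal parts. They have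
        the same projections as \<open>u\<close> and \<open>v\<close>, and the submersion is
        isometric on them.\<close>
      define u' where "u' = u - ?G ?T u *\<^sub>R ?T"
      define v' where "v' = v - ?G ?T v *\<^sub>R ?T"
      note b = bilinear_lsub[OF bil] bilinear_rsub[OF bil] bilinear_lmul[OF bil] bilinear_rmul[OF bil]
      have "?G ?T u' = 0" "?G ?T v' = 0" by (simp_all add: u'_def v'_def b unit)
      then have "u' \<in> horizontal M \<pi> g c p" "v' \<in> horizontal M \<pi> g c p" by (simp_all add: hor)
      then have "h d (\<pi> p) (tangent_map c d \<pi> p u') (tangent_map c d \<pi> p v') = g c p u' v'"
        using submersion_h p(3) cp dp unfolding riemannian_submersion_def by blast
      moreover have "tangent_map c d \<pi> p u' = ?D u" "tangent_map c d \<pi> p v' = ?D v"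
        unfolding tm u'_def v'_def by (simp_all add: linear_diff[OF lin] linear_scale[OF lin] Dq)
      moreover have "in_chart d h (?q x) = h d (\<pi> p)"
        using p(2) by (simp add: in_chart_def p(5) fun_eq_iff)
      ultimately have "in_chart d h (?q x) (?D u) (?D v) = ?G u' v'" by (simp add: Gx)
      also have "\<dots> = ?G u v - ?G ?T u * ?G ?T v"
        using mg(2)[OF x, of u ?T] by (simp add: u'_def v'_def b unit)
      finally show ?thesis by simp
    qed
    show "fderiv (\<lambda>x. in_chart c g x (vert c x) v) x u -
        fderiv (\<lambda>x. in_chart c g x (vert c x) u) x v =
      (H \<circ> chart_inv d) (?q x) * area_of (in_chart d h) (?q x) (?D u) (?D v)"
    proof -
      have "exterior_derivative (connection_form act g) c p u v =
          \<i> * complex_of_real (H (\<pi> p) * area_form h d (\<pi> p) (tangent_map c d \<pi> p u) (tangent_map c d \<pi> p v))"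
        using curv p(3) cp dp unfolding curvature_function_def by blast
      moreover have "area_form h d (\<pi> p) = area_of (in_chart d h) (?q x)"
        using p(2) by (simp add: area_form_def area_of_def in_chart_def p(5) fun_eq_iff)
      moreover have "dchart c (\<lambda>q. connection_form act g c q v) p u =
          \<i> * complex_of_real (fderiv (\<lambda>x. in_chart c g x (vert c x) v) x u)" for u v
      proof -
        have "smooth_on (snd c ` fst c) (\<lambda>x. in_chart c g x (vert c x) v)"
          by (rule smooth_on_bilinear_family[where f = "\<lambda>x. x", OF mg(1,4) _ smooth_on_ident[OF c.open_image] T
                smooth_on_const[OF c.open_image]])
        then have "(\<lambda>x. in_chart c g x (vert c x) v) differentiable (at x)"
          by (rule smooth_on_differentiable[OF _ x])
        then have "fderiv (\<lambda>x. \<i> * complex_of_real (in_chart c g x (vert c x) v)) x u =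
            \<i> * complex_of_real (fderiv (\<lambda>x. in_chart c g x (vert c x) v) x u)"
          by (intro frechet_derivative_bounded_linear bounded_linear_compose[OF bounded_linear_mult_right bounded_linear_of_real])
        then show ?thesis
          by (simp add: dchart_def connection_form_def in_chart_def o_def p(4))
      qed
      ultimately have "\<i> * complex_of_real (fderiv (\<lambda>x. in_chart c g x (vert c x) v) x u -
          fderiv (\<lambda>x. in_chart c g x (vert c x) u) x v) =
        \<i> * complex_of_real (H (\<pi> p) * area_of (in_chart d h) (?q x) (?D u) (?D v))"
        unfolding exterior_derivative_def tm by (simp add: right_diff_distrib)
      then have "fderiv (\<lambda>x. in_chart c g x (vert c x) v) x u -
          fderiv (\<lambda>x. in_chart c g x (vert c x) u) x v =
        H (\<pi> p) * area_of (in_chart d h) (?q x) (?D u) (?D v)"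
        unfolding mult_cancel_left of_real_eq_iff by simp
      then show ?thesis using p(2) by (simp add: p(5))
    qed
  qed
qed

text \<open>A local trivialization inverted at the unit of the circle. It provides a point over
  \<open>m\<close>, and it lets functions known only after composition with \<open>\<pi>\<close> be
  compared on the base.\<close>

lemma local_section:
  assumes m: "m \<in> points M" and d: "d \<in> charts_at M m"
  obtains p c N S where "p \<in> points P" "\<pi> p = m" "c \<in> charts_at P p" "snd d m \<in> N" "smooth_on N S"
    "\<And>y. y \<in> N \<Longrightarrow> S y \<in> total_domain c d \<and> proj c d (S y) = y"
proof -
  have dM: "d \<in> man_atlas M" and md: "m \<in> fst d" using d by auto
  interpret d: chart d by (rule manifold_chart[OF M dM])
  obtain U \<Phi> where U: "m \<in> U" and diffeo: "diffeomorphism (restrict_manifold P (points P \<inter> \<pi> -` U))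
          (prod_manifold (restrict_manifold M U) circle_manifold) \<Phi>"
    and \<Phi>: "\<And>p. p \<in> points P \<inter> \<pi> -` U \<Longrightarrow> fst (\<Phi> p) = \<pi> p"
    using principal m unfolding principal_circle_bundle_def by metis
  let ?P = "restrict_manifold P (points P \<inter> \<pi> -` U)"
    and ?N = "prod_manifold (restrict_manifold M U) circle_manifold"
  obtain \<Psi> where \<Psi>: "smooth_map ?N ?P \<Psi>" "\<And>n. n \<in> points ?N \<Longrightarrow> \<Phi> (\<Psi> n) = n"
    using diffeo unfolding diffeomorphism_def by blast
  have points_N: "points ?N = (points M \<inter> U) \<times> sphere 0 1"
    by (simp add: prod_manifold_def restrict_manifold_def circle_manifold_def)
  have points_P: "points ?P = points P \<inter> \<pi> -` U"
    by (auto simp: restrict_manifold_def)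
  have \<Psi>_in: "\<Psi> n \<in> points P \<inter> \<pi> -` U" "\<pi> (\<Psi> n) = fst n" if "n \<in> points ?N" for n
  proof -
    have "continuous_map (man_top ?N) (man_top ?P) \<Psi>" using \<Psi>(1) unfolding smooth_map_def by blast
    then have "\<Psi> n \<in> points ?P" using that by (auto simp: continuous_map_def)
    then show 1: "\<Psi> n \<in> points P \<inter> \<pi> -` U" by (simp only: points_P)
    show "\<pi> (\<Psi> n) = fst n" using \<Phi>[OF 1] \<Psi>(2)[OF that] by simp
  qed
  have n0: "(m, 1) \<in> points ?N" unfolding points_N using m U by simp
  define p where "p = \<Psi> (m, 1)"
  have p: "p \<in> points P" "\<pi> p = m" using \<Psi>_in[OF n0] by (auto simp: p_def)
  obtain c where c: "c \<in> charts_at P p" using manifold_chart_at[OF P p(1)] by blast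
  interpret c: chart c using c by (intro manifold_chart[OF P]) auto
  define d' where "d' = (fst d \<inter> U, snd d)"
  define c' where "c' = (fst c \<inter> (points P \<inter> \<pi> -` U), snd c)"
  let ?D = "product_chart d'"
  have "d' \<in> man_atlas (restrict_manifold M U)"
    unfolding restrict_manifold_def d'_def using dM by auto
  then have D: "?D \<in> man_atlas ?N" by (rule product_chart_in_atlas)
  have C: "c' \<in> man_atlas ?P"
    unfolding restrict_manifold_def c'_def using c by auto
  define F where "F = snd c' \<circ> \<Psi> \<circ> chart_inv ?D"
  define Z where "Z = snd ?D ` (fst ?D \<inter> \<Psi> -` fst c')"
  have F: "smooth_on Z F"
    using \<Psi>(1) D C unfolding smooth_map_def Z_def F_def by blast
  \<comment> \<open>The slice of angle 0 in the product chart, that is the points whose circle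
    component is 1.\<close>
  define N where "N = (\<lambda>y. (y, 0 :: real)) -` Z"
  have N: "open N"
    unfolding N_def by (rule open_vimage[OF smooth_on_open[OF F]]) (intro continuous_intros)
  have inj: "inj_on (snd d') (fst d')"
    unfolding d'_def using d.inj by (auto intro: inj_on_subset)
  show thesis
  proof (rule that[of p c N "\<lambda>y. F (y, 0)"])
    show "p \<in> points P" "\<pi> p = m" "c \<in> charts_at P p" by (fact p c)+
    have "(m, 1) \<in> fst ?D \<inter> \<Psi> -` fst c'"
      using c \<Psi>_in[OF n0] U md by (simp add: d'_def c'_def p_def)
    moreover have "(snd d m, 0) = snd ?D (m, 1)" by (simp add: d'_def)
    ultimately have "(snd d m, 0) \<in> Z" unfolding Z_def by (rule image_eqI[rotated])
    then show "snd d m \<in> N" by (simp add: N_def)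
    show "smooth_on N (\<lambda>y. F (y, 0))"
      by (rule smooth_on_compose[OF F smooth_on_Pair[OF smooth_on_ident[OF N] smooth_on_const[OF N]]])
        (simp add: N_def)
    fix y assume "y \<in> N"
    then have "(y, 0) \<in> Z" by (simp add: N_def)
    then obtain z where z: "z \<in> fst ?D \<inter> \<Psi> -` fst c'" "(y, 0) = snd ?D z" unfolding Z_def by (rule imageE)
    obtain m' w where zz: "z = (m', w)" by (rule prod.exhaust)
    have w: "m' \<in> fst d" "m' \<in> U" "w \<in> sphere 0 1 - {- 1}" "\<Psi> (m', w) \<in> fst c" "y = snd d m'" "Arg w = 0"
      using z unfolding zz by (simp_all add: d'_def c'_def)
    have n: "(m', w) \<in> points ?N"
      unfolding points_N using w manifold_chart(3)[OF M dM] by auto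
    have "F (y, 0) = snd c (\<Psi> (m', w))"
      using chart_inv_product_chart[OF inj, of m' w] w by (simp add: F_def c'_def d'_def)
    moreover have "\<pi> (\<Psi> (m', w)) = m'" using \<Psi>_in(2)[OF n] by simp
    ultimately show "F (y, 0) \<in> total_domain c d \<and> proj c d (F (y, 0)) = y"
      using w by simp
  qed
qed

text \<open>On the total space \<open>H\<close> is smooth after composition with the projection, by
  \<open>curvature_function_smooth\<close>; composing further with a smooth section gives
  \<open>H\<close> back near \<open>y\<close>.\<close>

lemma smooth_H:
  assumes d: "d \<in> man_atlas M"
  shows "smooth_on (base_domain d) (H \<circ> chart_inv d)"
proof (rule smooth_on_local)
  interpret d: chart d by (rule manifold_chart[OF M d])
  show "open (base_domain d)" by (rule d.open_image)
  fix y assume "y \<in> base_domain d"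
  then obtain m where m: "m \<in> fst d" "y = snd d m" by blast
  have mM: "m \<in> points M" using m manifold_chart(3)[OF M d] by blast
  have dm: "d \<in> charts_at M m" using d m by simp
  show "\<exists>N. y \<in> N \<and> smooth_on N (H \<circ> chart_inv d)"
  proof (rule local_section[OF mM dm])
    fix p c N S assume S: "c \<in> charts_at P p" "snd d m \<in> N" "smooth_on N S"
      "\<And>y. y \<in> N \<Longrightarrow> S y \<in> total_domain c d \<and> proj c d (S y) = y"
  interpret circle_chart "base_domain d" "in_chart d h" "total_domain c d" "in_chart c g" "proj c d" "vert c" "H \<circ> chart_inv d"
    using S(1) by (intro bundle_chart d) simp
  have "smooth_on N (\<lambda>y. (H \<circ> chart_inv d) (proj c d (S y)))"
    by (rule smooth_on_compose[OF curvature_function_smooth S(3)]) (use S(4) in blast)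
  then have "smooth_on N (H \<circ> chart_inv d)"
    by (rule smooth_on_cong) (use S(4) in metis)
    then show ?thesis using S(2) m by blast
  qed
qed

section \<open>The two equations on the base, freed from charts\<close>

abbreviation invariant :: "'m \<Rightarrow> real" where
  "invariant m \<equiv> 2 * K m - 3 * (H m)\<^sup>2"

lemma surface_base: "d \<in> man_atlas M \<Longrightarrow> surface_chart (base_domain d) (in_chart d h)"
  by (rule surface_chart_in_chart[OF metric_h _ manifold_chart(1)[OF M]])

text \<open>\<open>gaussian_curvature\<close> is evaluated on the orthonormal pair
  \<open>e 1\<close>, \<open>e 2\<close>, whose Gram determinant is 1.\<close>

lemma K_in_chart:
  assumes d: "d \<in> man_atlas M" and m: "m \<in> fst d"
  shows "K m = surface_chart.gauss_curv (in_chart d h) (snd d m)"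
proof -
  interpret d: chart d by (rule manifold_chart[OF M d])
  interpret surface_chart "base_domain d" "in_chart d h" by (rule surface_base[OF d])
  let ?y = "snd d m"
  have y: "?y \<in> base_domain d" using m by blast
  have "m \<in> points M" "d \<in> charts_at M m" using manifold_chart(3)[OF M d] m d by auto
  then have "h d m (riemann d h m (e 1 ?y) (e 2 ?y) (e 2 ?y)) (e 1 ?y) =
      K m * (h d m (e 1 ?y) (e 1 ?y) * h d m (e 2 ?y) (e 2 ?y) - (h d m (e 1 ?y) (e 2 ?y))\<^sup>2)"
    using gauss unfolding gaussian_curvature_def by blast
  moreover have "h d m = in_chart d h ?y" using m by (simp add: in_chart_def fun_eq_iff)
  ultimately show ?thesis
    using gauss_curv[OF y] by (simp add: d.riemann_chart[OF m] orth[OF y])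
qed

lemma hessian_in_chart:
  assumes d: "d \<in> man_atlas M" and m: "m \<in> fst d"
  shows "hessian d h H m u =
    fderiv (surface_chart.grad (in_chart d h) (H \<circ> chart_inv d)) (snd d m) u +
    chr (in_chart d h) (snd d m) u (surface_chart.grad (in_chart d h) (H \<circ> chart_inv d) (snd d m))"
proof -
  interpret d: chart d by (rule manifold_chart[OF M d])
  interpret surface_chart "base_domain d" "in_chart d h" by (rule surface_base[OF d])
  have gr: "gradient d h H p = grad (H \<circ> chart_inv d) (snd d p)" if "p \<in> fst d" for p
    using grad[OF smooth_H[OF d], of "snd d p"] that
    by (simp add: gradient_def dchart_def in_chart_def)
  have "fderiv (gradient d h H \<circ> chart_inv d) (snd d m) =
      fderiv (grad (H \<circ> chart_inv d)) (snd d m)"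
    using m gr by (intro frechet_derivative_eq_on_open[OF d.open_image]) auto
  then show ?thesis
    by (simp add: hessian_def nabla_def dchart_def d.christoffel_chart[OF m] gr[OF m])
qed

lemma surface_equations_in_chart:
  assumes d: "d \<in> man_atlas M" and m: "m \<in> fst d"
  shows "surface_chart.surface_equations (in_chart d h) (H \<circ> chart_inv d) (snd d m) \<longleftrightarrow>
    (\<forall>u. hessian d h H m u = (H m * ((H m)\<^sup>2 - K m)) *\<^sub>R u) \<and>
    (\<forall>u. fderiv (invariant \<circ> chart_inv d) (snd d m) u = 0)"
proof -
  interpret d: chart d by (rule manifold_chart[OF M d])
  interpret surface_chart "base_domain d" "in_chart d h" by (rule surface_base[OF d])
  have "fderiv (invariant \<circ> chart_inv d) (snd d m) =
      fderiv (\<lambda>y. 2 * gauss_curv y - 3 * ((H \<circ> chart_inv d) y)\<^sup>2) (snd d m)"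
    using m K_in_chart[OF d] by (intro frechet_derivative_eq_on_open[OF d.open_image]) auto
  then show ?thesis
    unfolding surface_equations_def hessian_in_chart[OF d m]
    using m K_in_chart[OF d m] by simp
qed

lemma invariant_differentiable:
  assumes d: "d \<in> man_atlas M" and y: "y \<in> base_domain d"
  shows "(invariant \<circ> chart_inv d) differentiable (at y)"
proof -
  interpret d: chart d by (rule manifold_chart[OF M d])
  interpret surface_chart "base_domain d" "in_chart d h" by (rule surface_base[OF d])
  have "smooth_on (base_domain d) (\<lambda>y. 2 * gauss_curv y - 3 * ((H \<circ> chart_inv d) y)\<^sup>2)"
    by (intro smooth_on_diff smooth_on_mult smooth_on_const d.open_image smooth_gauss_curv
        smooth_on_power smooth_H d)
  then have "smooth_on (base_domain d) (invariant \<circ> chart_inv d)"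
    by (rule smooth_on_cong) (use K_in_chart[OF d] in auto)
  then show ?thesis using y by (rule smooth_on_differentiable)
qed

text \<open>The equations at \<open>m\<close> are read off at any point over \<open>m\<close>, in a
  chart that is cut down to the open set where the conformal factor lives.\<close>

lemma surface_equations_of_conformally_flat:
  assumes flat: "conformally_flat P g" and m: "m \<in> points M" and d: "d \<in> charts_at M m"
  shows "surface_chart.surface_equations (in_chart d h) (H \<circ> chart_inv d) (snd d m)"
proof (rule local_section[OF m d])
  have dM: "d \<in> man_atlas M" and md: "m \<in> fst d" using d by auto
  fix p c assume p: "p \<in> points P" "\<pi> p = m" and c: "c \<in> charts_at P p"
  have cP: "c \<in> man_atlas P" and pc: "p \<in> fst c" using c by auto
  interpret c: chart c by (rule manifold_chart[OF P cP])
  interpret d: chart d by (rule manifold_chart[OF M dM])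
  obtain U lam where U: "openin (man_top P) U" "p \<in> U"
    and lam: "smooth_map (restrict_manifold P U) real_manifold lam"
    and flatU: "flat_on P U (\<lambda>c q u v. exp (2 * lam q) * g c q u v)"
    using flat p(1) unfolding conformally_flat_def by blast
  interpret C: circle_chart "base_domain d" "in_chart d h" "total_domain c d" "in_chart c g" "proj c d" "vert c" "H \<circ> chart_inv d"
    by (rule bundle_chart[OF cP dM])
  have "(fst c \<inter> U, snd c) \<in> man_atlas (restrict_manifold P U)"
    using cP by (auto simp: restrict_manifold_def)
  moreover have "(UNIV, id) \<in> man_atlas real_manifold" by (simp add: real_manifold_def)
  ultimately have "smooth_on (snd (fst c \<inter> U, snd c) ` (fst (fst c \<inter> U, snd c) \<inter> lam -` fst (UNIV :: real set, id :: real \<Rightarrow> real)))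
      (snd (UNIV :: real set, id) \<circ> lam \<circ> chart_inv (fst c \<inter> U, snd c))"
    using lam unfolding smooth_map_def by blast
  then have "smooth_on (snd c ` (fst c \<inter> U)) (lam \<circ> chart_inv (fst c \<inter> U, snd c))" by simp
  \<comment> \<open>The restricted chart has its own \<open>chart_inv\<close>, which agrees with
    that of \<open>c\<close> only on the image of the smaller domain.\<close>
  then have sl: "smooth_on (snd c ` (fst c \<inter> U)) (lam \<circ> chart_inv c)"
  proof (rule smooth_on_cong)
    fix x assume "x \<in> snd c ` (fst c \<inter> U)"
    then obtain p' where p': "p' \<in> fst c \<inter> U" "x = snd c p'" by blast
    have "inj_on (snd c) (fst c \<inter> U)" using c.inj by (auto intro: inj_on_subset)
    then have "chart_inv (fst c \<inter> U, snd c) x = p'"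
      using p' by (simp add: chart_inv_def)
    then show "(lam \<circ> chart_inv (fst c \<inter> U, snd c)) x = (lam \<circ> chart_inv c) x" using p' by simp
  qed
  let ?V = "total_domain c d \<inter> snd c ` (fst c \<inter> U)"
  have V: "open ?V" using C.open_P smooth_on_open[OF sl] by blast
  interpret R: circle_chart "base_domain d" "in_chart d h" ?V "in_chart c g" "proj c d" "vert c" "H \<circ> chart_inv d"
    by (rule C.restrict_chart[OF V]) blast
  have x: "snd c p \<in> ?V" using p pc md U(2) by auto
  have "\<forall>x\<in>?V. \<forall>u v w. riem (\<lambda>x u v. exp (2 * (lam \<circ> chart_inv c) x) * in_chart c g x u v) x u v w = 0"
  proof (intro ballI allI)
    fix x u v w assume "x \<in> ?V"
    then obtain p' where p': "p' \<in> fst c" "p' \<in> U" "x = snd c p'" by blast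
    have "riemann c (\<lambda>c q u v. exp (2 * lam q) * g c q u v) p' u v w = 0"
      using flatU p' cP unfolding flat_on_def by blast
    moreover have "in_chart c (\<lambda>c q u v. exp (2 * lam q) * g c q u v) =
        (\<lambda>x u v. exp (2 * (lam \<circ> chart_inv c) x) * in_chart c g x u v)"
      by (simp add: in_chart_def fun_eq_iff)
    ultimately show "riem (\<lambda>x u v. exp (2 * (lam \<circ> chart_inv c) x) * in_chart c g x u v) x u v w = 0"
      using c.riemann_chart[OF p'(1)] p'(3) by simp
  qed
  moreover have "smooth_on ?V (lam \<circ> chart_inv c)" by (rule smooth_on_subset[OF sl V]) blast
  ultimately have "C.surface_equations (H \<circ> chart_inv d) (proj c d (snd c p))"
    using R.surface_equations_of_flat[OF smooth_H[OF dM] _ _ x] by blast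
  then show ?thesis using pc p(2) by simp
qed

text \<open>In a ball inside a chart the vanishing differential makes the invariant constant, so it
  is locally constant on \<open>M\<close>, and connectedness does the rest.\<close>

lemma invariant_constant:
  assumes connected: "connected_space (man_top M)"
    and D: "\<And>m d. m \<in> points M \<Longrightarrow> d \<in> charts_at M m \<Longrightarrow>
      \<forall>u. fderiv (invariant \<circ> chart_inv d) (snd d m) u = 0"
  shows "\<exists>\<alpha>. \<forall>m\<in>points M. invariant m = \<alpha>"
proof (cases "points M = {}")
  case False
  then obtain m0 where m0: "m0 \<in> points M" by blast
  have nbhd: "\<exists>N. openin (man_top M) N \<and> m \<in> N \<and> (\<forall>m'\<in>N. invariant m' = invariant m)"
    if m: "m \<in> points M" for m
  proof -
    obtain d where d: "d \<in> man_atlas M" "m \<in> fst d" using manifold_chart_at[OF M m] by blast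
    interpret d: chart d by (rule manifold_chart[OF M d(1)])
    obtain r where r: "r > 0" "ball (snd d m) r \<subseteq> base_domain d"
      using d.open_image d(2) open_contains_ball by blast
    let ?B = "ball (snd d m) r" and ?f = "invariant \<circ> chart_inv d"
    have "(?f has_derivative (\<lambda>h. 0)) (at y within ?B)" if y: "y \<in> ?B" for y
    proof -
      have yd: "y \<in> base_domain d" using y r by blast
      then obtain m' where m': "m' \<in> fst d" "y = snd d m'" by blast
      have "m' \<in> points M" "d \<in> charts_at M m'" using m' d manifold_chart(3)[OF M d(1)] by auto
      from D[OF this] have "fderiv ?f y = (\<lambda>h. 0)" unfolding m'(2) by (intro ext) blast
      then have "(?f has_derivative (\<lambda>h. 0)) (at y)"
        using frechet_derivative_has[OF invariant_differentiable[OF d(1) yd]] by (simp only:)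
      then show ?thesis by (rule has_derivative_at_withinI)
    qed
    then have "\<exists>k. \<forall>y\<in>?B. ?f y = k" by (rule has_derivative_zero_constant[OF convex_ball])
    then obtain k where k: "\<And>y. y \<in> ?B \<Longrightarrow> ?f y = k" by blast
    have "snd d m \<in> ?B" using r by simp
    moreover have "invariant m = k" using k[OF \<open>snd d m \<in> ?B\<close>] d(2) by simp
    moreover have "invariant m' = k" if "m' \<in> chart_inv d ` ?B" for m' using that k by auto
    ultimately have "\<forall>m'\<in>chart_inv d ` ?B. invariant m' = invariant m" by simp
    moreover have "m \<in> chart_inv d ` ?B"
      using \<open>snd d m \<in> ?B\<close> d(2) by (intro image_eqI[of _ _ "snd d m"]) simp_all
    ultimately show ?thesis using open_chart_preimage[OF M d(1) open_ball r(2)] by blast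
  qed
  \<comment> \<open>Stated for an arbitrary predicate so that it covers a level set and its
    complement at once.\<close>
  have op: "openin (man_top M) {m \<in> points M. Q (invariant m)}" for Q
  proof (subst openin_subopen, intro ballI)
    fix m assume m: "m \<in> {m \<in> points M. Q (invariant m)}"
    then have "m \<in> points M" by simp
    from nbhd[OF this] obtain N where N: "openin (man_top M) N" "m \<in> N" "\<forall>m'\<in>N. invariant m' = invariant m"
      by (elim exE conjE)
    have "N \<subseteq> {m \<in> points M. Q (invariant m)}"
    proof
      fix m' assume "m' \<in> N"
      then have "m' \<in> points M" "invariant m' = invariant m" using openin_subset[OF N(1)] N(3) by blast+
      then show "m' \<in> {m \<in> points M. Q (invariant m)}" using m by simp
    qed
    then show "\<exists>T. openin (man_top M) T \<and> m \<in> T \<and> T \<subseteq> {m \<in> points M. Q (invariant m)}" using N by blast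
  qed
  let ?A = "{m \<in> points M. invariant m = invariant m0}"
  have "points M - ?A = {m \<in> points M. invariant m \<noteq> invariant m0}" by blast
  then have "closedin (man_top M) ?A" using op[of "\<lambda>t. t \<noteq> invariant m0"] by (auto simp: closedin_def)
  then have "?A = {} \<or> ?A = points M"
    using connected op[of "\<lambda>t. t = invariant m0"] unfolding connected_space_clopen_in by blast
  then show ?thesis using m0 by blast
qed auto

text \<open>The factor \<open>lam\<close> is constructed in a single chart \<open>c\<close>, whereas
  \<open>smooth_map\<close> and \<open>flat_on\<close> ask about all charts of the atlas. Flatness
  passes to another chart along the coordinate change, an isometry by the transformation law of
  \<open>g\<close>.\<close>

lemma conformally_flat_of_surface_equations:
  assumes eqs: "\<And>m d. m \<in> points M \<Longrightarrow> d \<in> charts_at M m \<Longrightarrow>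
    surface_chart.surface_equations (in_chart d h) (H \<circ> chart_inv d) (snd d m)"
  shows "conformally_flat P g"
  unfolding conformally_flat_def
proof
  fix p assume p: "p \<in> points P"
  have "\<pi> p \<in> points M"
    using smooth_\<pi> p unfolding smooth_map_def continuous_map_def by blast
  then obtain d where d: "d \<in> charts_at M (\<pi> p)" using manifold_chart_at[OF M] by blast
  obtain c where c: "c \<in> charts_at P p" using manifold_chart_at[OF P p] by blast
  have cP: "c \<in> man_atlas P" and pc: "p \<in> fst c" and dM: "d \<in> man_atlas M" and pd: "\<pi> p \<in> fst d"
    using c d by auto
  interpret c: chart c by (rule manifold_chart[OF P cP])
  interpret C: circle_chart "base_domain d" "in_chart d h" "total_domain c d" "in_chart c g" "proj c d" "vert c" "H \<circ> chart_inv d"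
    by (rule bundle_chart[OF cP dM])
  have x0: "snd c p \<in> total_domain c d" using pc pd by blast
  have eqs': "C.surface_equations (H \<circ> chart_inv d) y" if y: "y \<in> base_domain d" for y
  proof -
    obtain m where m: "m \<in> fst d" "y = snd d m" using y by blast
    then have "m \<in> points M" "d \<in> charts_at M m" using manifold_chart(3)[OF M dM] dM by auto
    then show ?thesis using eqs m(2) by blast
  qed
  show "\<exists>U lam. openin (man_top P) U \<and> p \<in> U \<and> smooth_map (restrict_manifold P U) real_manifold lam \<and>
      flat_on P U (\<lambda>c q u v. exp (2 * lam q) * g c q u v)"
  proof (rule C.flat_of_surface_equations[OF smooth_H[OF dM] eqs' x0])
    fix r lam assume r: "r > 0" "ball (snd c p) r \<subseteq> total_domain c d" and lam: "smooth_on (ball (snd c p) r) lam"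
      and flat: "\<And>x u v w. x \<in> ball (snd c p) r \<Longrightarrow> riem (\<lambda>x u v. exp (2 * lam x) * in_chart c g x u v) x u v w = 0"
    let ?B = "ball (snd c p) r"
    define U where "U = chart_inv c ` ?B"
    have B: "?B \<subseteq> snd c ` fst c" using r(2) by blast
    have U: "openin (man_top P) U" unfolding U_def by (rule open_chart_preimage[OF P cP open_ball B])
    have U_iff: "q \<in> U \<longleftrightarrow> q \<in> fst c \<and> snd c q \<in> ?B" for q
    proof
      assume "q \<in> U"
      then obtain x where x: "x \<in> ?B" "q = chart_inv c x" unfolding U_def by blast
      have "x \<in> snd c ` fst c" using x(1) B by blast
      then show "q \<in> fst c \<and> snd c q \<in> ?B" using x c.chart_inv_in c.chart_chart_inv by metis
    next
      assume q: "q \<in> fst c \<and> snd c q \<in> ?B"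
      then have "q = chart_inv c (snd c q)" by simp
      then show "q \<in> U" unfolding U_def using q by blast
    qed
    have pU: "p \<in> U" using pc r(1) by (simp add: U_iff)
    have Uc: "U \<subseteq> fst c" using U_iff by blast
    have transition: "smooth_on (snd c' ` (fst c' \<inter> U)) (snd c \<circ> chart_inv c')"
      "open (snd c' ` (fst c' \<inter> U))" "chart c'" if c': "c' \<in> man_atlas P" for c'
    proof -
      show "chart c'" by (rule manifold_chart[OF P c'])
      show op: "open (snd c' ` (fst c' \<inter> U))"
        by (rule open_chart_image[OF P c' openin_Int[OF manifold_chart(2)[OF P c'] U]]) blast
      have "smooth_on (snd c' ` (fst c' \<inter> fst c)) (snd c \<circ> chart_inv c')"
        using P c' cP unfolding smooth_manifold_def by blast
      then show "smooth_on (snd c' ` (fst c' \<inter> U)) (snd c \<circ> chart_inv c')"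
        by (rule smooth_on_subset[OF _ op]) (use Uc in blast)
    qed
    have lam': "smooth_on (snd c' ` (fst c' \<inter> U)) (\<lambda>y. lam (snd c (chart_inv c' y)))" if c': "c' \<in> man_atlas P" for c'
    proof -
      interpret c': chart c' by (rule transition(3)[OF c'])
      have "(snd c \<circ> chart_inv c') y \<in> ?B" if y: "y \<in> snd c' ` (fst c' \<inter> U)" for y
      proof -
        obtain q where q: "q \<in> fst c' \<inter> U" "y = snd c' q" using y by blast
        then have "snd c q \<in> ?B" using U_iff by blast
        then show ?thesis using q by simp
      qed
      from smooth_on_compose[OF lam transition(1)[OF c'] this] show ?thesis by (simp only: o_apply)
    qed
    have "continuous_map (subtopology (man_top P) U) euclidean (lam \<circ> snd c)"
    proof (rule continuous_map_compose)
      have "continuous_map (subtopology (man_top P) (fst c)) (top_of_set (snd c ` fst c)) (snd c)"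
        using manifold_chart(4)[OF P cP] homeomorphic_imp_continuous_map by blast
      then have "continuous_map (subtopology (man_top P) (fst c)) euclidean (snd c)"
        by (simp add: continuous_map_in_subtopology)
      then have "continuous_map (subtopology (man_top P) U) euclidean (snd c)"
        using continuous_map_from_subtopology_mono Uc by blast
      then show "continuous_map (subtopology (man_top P) U) (top_of_set ?B) (snd c)"
        unfolding continuous_map_in_subtopology using U_iff by auto
      show "continuous_map (top_of_set ?B) euclidean lam"
        using smooth_on_continuous[OF lam] by simp
    qed
    moreover have "smooth_on (snd c1 ` (fst c1 \<inter> (lam \<circ> snd c) -` fst d1)) (snd d1 \<circ> (lam \<circ> snd c) \<circ> chart_inv c1)"
      if c1: "c1 \<in> man_atlas (restrict_manifold P U)" and d1: "d1 \<in> man_atlas real_manifold" for c1 d1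
    proof -
      obtain c' where c': "c' \<in> man_atlas P" "c1 = (fst c' \<inter> U, snd c')"
        using c1 unfolding restrict_manifold_def by auto
      interpret c': chart c' by (rule transition(3)[OF c'(1)])
      have d1': "d1 = (UNIV, id)" using d1 by (simp add: real_manifold_def)
      have "smooth_on (snd c' ` (fst c' \<inter> U)) (id \<circ> (lam \<circ> snd c) \<circ> chart_inv c1)"
      proof (rule smooth_on_cong[OF lam'[OF c'(1)]])
        fix y assume "y \<in> snd c' ` (fst c' \<inter> U)"
        then obtain q where q: "q \<in> fst c' \<inter> U" "y = snd c' q" by blast
        have "inj_on (snd c') (fst c' \<inter> U)" using c'.inj by (auto intro: inj_on_subset)
        then have "chart_inv c1 y = q" using q by (simp add: chart_inv_def c'(2))
        then show "lam (snd c (chart_inv c' y)) = (id \<circ> (lam \<circ> snd c) \<circ> chart_inv c1) y" using q by simp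
      qed
      then show ?thesis by (simp add: d1' c'(2))
    qed
    ultimately have "smooth_map (restrict_manifold P U) real_manifold (lam \<circ> snd c)"
      unfolding smooth_map_def by (simp add: restrict_manifold_def real_manifold_def)
    moreover have "flat_on P U (\<lambda>k q u v. exp (2 * (lam \<circ> snd c) q) * g k q u v)"
      unfolding flat_on_def
    proof (intro ballI allI)
      fix q c' u v w assume q: "q \<in> U" and "c' \<in> charts_at P q"
      then have c': "c' \<in> man_atlas P" and qc': "q \<in> fst c'" by auto
      interpret c': chart c' by (rule transition(3)[OF c'])
      let ?V = "snd c ` (fst c' \<inter> U)" and ?V' = "snd c' ` (fst c' \<inter> U)"
      let ?G = "\<lambda>x u v. exp (2 * lam x) * in_chart c g x u v"
        and ?G' = "\<lambda>y u v. exp (2 * lam (snd c (chart_inv c' y))) * in_chart c' g y u v"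
      have VB: "?V \<subseteq> ?B" using U_iff by auto
      have opV: "open ?V"
        by (rule open_chart_image[OF P cP openin_Int[OF manifold_chart(2)[OF P c'] U]]) (use Uc in blast)
      interpret R: circle_chart "base_domain d" "in_chart d h" ?V "in_chart c g" "proj c d" "vert c" "H \<circ> chart_inv d"
        by (rule C.restrict_chart[OF opV]) (use VB r(2) in blast)
      \<comment> \<open>\<open>push_forward_flat\<close> transports a frame of the conformal metric;
        the rescaled lifts in the chart \<open>c\<close> serve as that frame.\<close>
      have frame: "orthonormal_frame ?V ?G (\<lambda>i x. exp (- lam x) *\<^sub>R C.lift i x)"
        by (rule orthonormal_frame.conformal_frame[OF R.frame_P smooth_on_subset[OF lam opV VB]])
      have V': "?V' \<subseteq> snd c' ` fst c'" by blast
      note mg = metric_in_chart[OF metric_g c' c'.chart_axioms]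
      have \<tau>: "smooth_on ?V (snd c' \<circ> chart_inv c)"
      proof -
        have "smooth_on (snd c ` (fst c \<inter> fst c')) (snd c' \<circ> chart_inv c)"
          using P c' cP unfolding smooth_manifold_def by blast
        then show ?thesis by (rule smooth_on_subset[OF _ opV]) (use Uc in blast)
      qed
      have pt: "\<exists>q. q \<in> fst c \<and> q \<in> fst c' \<and> q \<in> U \<and> x = snd c q" if "x \<in> ?V" for x using that Uc by blast
      have pt': "\<exists>q. q \<in> fst c \<and> q \<in> fst c' \<and> q \<in> U \<and> y = snd c' q" if "y \<in> ?V'" for y using that Uc by blast
      have "riem ?G' (snd c' q) u v w = 0"
      proof (rule orthonormal_frame.push_forward_flat[OF frame \<tau> _ _ transition(1)[OF c']])
        show "(snd c' \<circ> chart_inv c) x \<in> ?V'" "(snd c \<circ> chart_inv c') ((snd c' \<circ> chart_inv c) x) = x"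
          if "x \<in> ?V" for x using pt[OF that] by auto
        show "(snd c \<circ> chart_inv c') y \<in> ?V" "(snd c' \<circ> chart_inv c) ((snd c \<circ> chart_inv c') y) = y"
          if "y \<in> ?V'" for y using pt'[OF that] by auto
        show "snd c' q \<in> ?V'" using q qc' by blast
        show "riem ?G x u v w = 0" if "x \<in> ?V" for x u v w by (rule flat) (use that VB in blast)
        show "smooth_on ?V' (\<lambda>y. ?G' y u v)" for u v
          by (intro smooth_on_mult smooth_on_exp smooth_on_const transition(2) lam' c'
              smooth_on_subset[OF mg(4) _ V'])
        show "?G' ((snd c' \<circ> chart_inv c) x) (fderiv (snd c' \<circ> chart_inv c) x u)
            (fderiv (snd c' \<circ> chart_inv c) x v) = ?G x u v" if x: "x \<in> ?V" for x u v
        proof -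
          obtain q where q: "q \<in> fst c" "q \<in> fst c'" "q \<in> U" "x = snd c q" using pt[OF x] by blast
          have "q \<in> points P" using q(1) manifold_chart(3)[OF P cP] by blast
          then have "g c q u v = g c' q (dchart c (snd c') q u) (dchart c (snd c') q v)"
            using metric_g cP c' q(1,2) unfolding riemannian_metric_def by blast
          then show ?thesis using q by (simp add: in_chart_def dchart_def)
        qed
        fix y assume "y \<in> ?V'"
        then have y: "y \<in> snd c' ` fst c'" by blast
        show "?G' y u v = ?G' y v u" for u v using mg(2)[OF y] by simp
        note b = mg(1)[OF y]
        show "bilinear (?G' y)"
          using bilinear_ladd[OF b] bilinear_radd[OF b] bilinear_lmul[OF b] bilinear_rmul[OF b]
          unfolding bilinear_def by (intro conjI allI linearI) (simp_all add: algebra_simps)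
      qed
      moreover have "in_chart c' (\<lambda>k q u v. exp (2 * (lam \<circ> snd c) q) * g k q u v) = ?G'"
        by (simp add: in_chart_def fun_eq_iff)
      ultimately show "riemann c' (\<lambda>k q u v. exp (2 * (lam \<circ> snd c) q) * g k q u v) q u v w = 0"
        using c'.riemann_chart[OF qc'] by simp
    qed
    ultimately show ?thesis using U pU by blast
  qed
qed

end

theorem theorem6:
  fixes P :: "('p, real^3) manifold" and M :: "('m, real^2) manifold"
    and \<pi> :: "'p \<Rightarrow> 'm" and act :: "'p \<Rightarrow> complex \<Rightarrow> 'p"
    and g :: "('p, real^3) tensor2" and h :: "('m, real^2) tensor2"
    and K H :: "'m \<Rightarrow> real"
  assumes circle_bundle: "circle_bundle_with_circle_metric P M \<pi> act g"
    and connected: "connected_space (man_top M)"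
    and base_metric: "riemannian_metric M h" "riemannian_submersion P g M h \<pi>"
    and gauss: "gaussian_curvature M h K"
    and curv: "curvature_function P g M h \<pi> act H"
  shows "conformally_flat P g \<longleftrightarrow>
    (\<exists>\<alpha>::real.
       (\<forall>m\<in>points M. \<forall>c\<in>charts_at M m. \<forall>u.
          hessian c h H m u = (H m * ((H m)\<^sup>2 - K m)) *\<^sub>R u) \<and>
       (\<forall>m\<in>points M. 2 * K m - 3 * (H m)\<^sup>2 = \<alpha>))"
proof -
  interpret metric_circle_bundle P M \<pi> act g h K H
    using assms by unfold_locales
  have eqs: "surface_chart.surface_equations (in_chart d h) (H \<circ> chart_inv d) (snd d m) \<longleftrightarrow>
    (\<forall>u. hessian d h H m u = (H m * ((H m)\<^sup>2 - K m)) *\<^sub>R u) \<and>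
    (\<forall>u. fderiv (invariant \<circ> chart_inv d) (snd d m) u = 0)"
    if "d \<in> charts_at M m" for m d
    using that by (intro surface_equations_in_chart) auto
  show ?thesis
  proof
    assume flat: "conformally_flat P g"
    note e = surface_equations_of_conformally_flat[OF flat]
    \<comment> \<open>The local equations give a vanishing differential at every point;
      connectedness turns this into one constant for all of \<open>M\<close>.\<close>
    have "\<exists>\<alpha>. \<forall>m\<in>points M. invariant m = \<alpha>"
      by (rule invariant_constant[OF connected]) (use e eqs in blast)
    then show "\<exists>\<alpha>. (\<forall>m\<in>points M. \<forall>c\<in>charts_at M m. \<forall>u.
          hessian c h H m u = (H m * ((H m)\<^sup>2 - K m)) *\<^sub>R u) \<and>
       (\<forall>m\<in>points M. invariant m = \<alpha>)"
      using e eqs by blast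
  next
    assume "\<exists>\<alpha>. (\<forall>m\<in>points M. \<forall>c\<in>charts_at M m. \<forall>u.
          hessian c h H m u = (H m * ((H m)\<^sup>2 - K m)) *\<^sub>R u) \<and>
       (\<forall>m\<in>points M. invariant m = \<alpha>)"
    then obtain \<alpha> where hess: "\<And>m c u. m \<in> points M \<Longrightarrow> c \<in> charts_at M m \<Longrightarrow>
        hessian c h H m u = (H m * ((H m)\<^sup>2 - K m)) *\<^sub>R u"
      and \<alpha>: "\<And>m. m \<in> points M \<Longrightarrow> invariant m = \<alpha>" by blast
    show "conformally_flat P g"
    proof (rule conformally_flat_of_surface_equations)
      fix m d assume m: "m \<in> points M" and d: "d \<in> charts_at M m"
      then have dM: "d \<in> man_atlas M" "m \<in> fst d" by auto
      interpret d: chart d by (rule manifold_chart[OF M dM(1)])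
      have "fderiv (invariant \<circ> chart_inv d) (snd d m) = fderiv (\<lambda>_. \<alpha>) (snd d m)"
        by (rule frechet_derivative_eq_on_open[OF d.open_image])
          (use dM(2) \<alpha> manifold_chart(3)[OF M dM(1)] in auto)
      then show "surface_chart.surface_equations (in_chart d h) (H \<circ> chart_inv d) (snd d m)"
        using eqs[OF d] hess[OF m d] by simp
    qed
  qed
qed

end
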